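(* Let $F:=f\circ h+g$ on $\mathbb{R}^n$ be closed and level-bounded, where $h:\mathbb{R}^n\to\mathbb{R}^d$ is $\mathcal{C}^2$-smooth, $f:\mathbb{R}^d\to\mathbb{R}$ is convex, and $g:\mathbb{R}^n\to\mathbb{R}\cup\{\infty\}$ is closed and $\sigma$-weakly convex ($\sigma>0$). Assume there is $\eta>0$ such that $$\big|f(h(y))-f\big(h(x)+\nabla h(x)(y-x)\big)\big|\le\frac{\eta}{2}\|y-x\|^2\qquad\text{for all }x,y\in\mathbb{R}^n.$$ Let $x^*$ be a critical point of $F$, let $\beta\in(0,\min\{\sigma^{-1},\eta^{-1}\})$, and let $$H(x)=\operatorname*{arg\,min}_{y\in\mathbb{R}^n}\; f\big(h(x)+\nabla h(x)(y-x)\big)+g(y)+\frac1{2\beta}\|y-x\|^2 .$$ Suppose that $F$ admits a $\mathcal{C}^3$-composite active manifold $\mathcal{M}$ at $x^*$ and that $h$ is $\mathcal{C}^4$-smooth near $x^*$. Then: (i) $H$ is $\mathcal{C}^2$-smooth around $x^*$, and both $H$ and $\nabla H$ are Lipschitz continuous around $x^*$. (ii) Suppose in addition that there are $\rho>0$ and $\gamma\in(0,1)$ with $\|H(x)-H(y)\|\le\gamma\|x-y\|$ for all $x,y$ in the closed ball $\mathcal{B}_{x^*}(\rho)$, and that there is a constant $M_\alpha$ such that the Anderson acceleration coefficients satisfy $\sum_{i=0}^{m_k}|\alpha^k_i|\le M_\alpha$ for all $k\in\mathbb{N}$. Then, if the initial point $x^0$ is sufficiently close to $x^*$, the iterates $\{x^k\}$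 produced by Anderson acceleration (memory $m\ge1$) applied to $H$ from $x^0$ converge to $x^*$ R-linearly with some $\hat\gamma\in(\gamma,1)$; namely, for all $k\ge0$, $$\|H(x^k)-x^k\|\le\hat\gamma^k\|H(x^0)-x^0\|\quad\text{and}\quad\|x^k-x^*\|\le\frac{1+\gamma}{1-\gamma}\,\hat\gamma^k\|x^0-x^*\|.$$
   Context: $\|\cdot\|$ is the Euclidean norm; $\mathcal{B}_x(\rho)$ and $\hat{\mathcal{B}}_x(\rho)$ are the closed and open balls of radius $\rho$ around $x$; $\mathrm{rint}$ denotes relative interior; $\nabla h(x)$ is the Jacobian and $\nabla h(x)^*$ its adjoint (transpose). A function $g$ is $\sigma$-weakly convex if $x\mapsto g(x)+\frac\sigma2\|x\|^2$ is convex. Subdifferentials. For a set $Q$ and $x\in Q$, the regular normal cone is $N_Q(x)=\{\nu:\limsup_{y\to x,\,y\in Q}\langle\nu,y-x\rangle/\|y-x\|\le0\}$; the limiting normal cone consists of all limits of $\nu_i\in N_Q(x_i)$ with $x_i\in Q$, $x_i\to x$; the Clarke normal cone $N^c_Q(x)$ is the closed convex hull of the limiting normal cone. For $\varphi$ finite at $x$, $\partial\varphi(x)=\{\nu:(\nu,-1)\in N_{\mathrm{epi}\varphi}(x,\varphi(x))\}$ and $\partial_c\varphi(x)=\{\nu:(\nu,-1)\in N^c_{\mathrm{epi}\varphi}(x,\varphi(x))\}$. A critical point of $\varphi$ is $x$ with $0\in\partial\varphi(x)$. The function $\varphi$ is regular at $x$ if $\mathrm{epi}\varphi$ is locally closed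 around $(x,\varphi(x))$ and $N_{\mathrm{epi}\varphi}(x,\varphi(x))=N^c_{\mathrm{epi}\varphi}(x,\varphi(x))$. The subderivative is $d\varphi(x)(\bar\nu)=\liminf_{\tau\downarrow0,\ \nu\to\bar\nu}\frac{\varphi(x+\tau\nu)-\varphi(x)}{\tau}$. Smooth manifold. $\mathcal{M}\subset\mathbb{R}^n$ is a $\mathcal{C}^p$-smooth manifold of dimension $r$ around $\bar x\in\mathcal{M}$ if there are $\epsilon>0$ and a $\mathcal{C}^p$-smooth $G:\mathbb{R}^n\to\mathbb{R}^{n-r}$ with $\nabla G(\bar x)$ of full row rank and $\mathcal{M}\cap\hat{\mathcal{B}}_{\bar x}(\epsilon)=\{x\in\hat{\mathcal{B}}_{\bar x}(\epsilon):G(x)=0\}$. Tangent and normal spaces: $T_{\mathcal{M}}(x)=\ker\nabla G(x)$, $N_{\mathcal{M}}(x)=T_{\mathcal{M}}(x)^\perp$. Active manifold. A closed function $\varphi$ admits a $\mathcal{C}^p$-active manifold $\mathcal{M}\ni\bar x$ at $\bar x$ if: (1) near $\bar x$, $\mathcal{M}$ is a $\mathcal{C}^p$-smooth manifold and the restriction of $\varphi$ to $\mathcal{M}$ is $\mathcal{C}^p$-smooth; (2) for all $x\in\mathcal{M}$ near $\bar x$, $\varphi$ is regular at $x$ and has a subgradient there; (3) $d\varphi(\bar x)(-\nu)>-d\varphi(\bar x)(\nu)$ for all nonzero $\nu\in N_{\mathcal{M}}(\bar x)$; (4) the set-valued map $\partial_c\varphi$ is continuous at $\bar x$ relative to $\mathcal{M}$.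 Composite active manifold. $F=f\circ h+g$ admits a $\mathcal{C}^p$-composite active manifold $\mathcal{M}:=\mathcal{G}\cap h^{-1}(\mathcal{F})$ at a critical point $x^*$ if for any $w^*\in\partial f(h(x^* ))$ and $v^*\in\partial g(x^* )$ with $0=\nabla h(x^* )^*w^*+v^*$: (1) there exist $\mathcal{C}^p$-smooth manifolds $\mathcal{G}\subset\mathbb{R}^n$ and $\mathcal{F}\subset\mathbb{R}^d$ containing $x^*$ and $h(x^* )$ respectively with the transversality condition $\nabla h(x^* )[T_{\mathcal{G}}(x^* )]+T_{\mathcal{F}}(h(x^* ))=\mathbb{R}^d$; (2) $v^*\in\mathrm{rint}(\partial g(x^* ))$ and $w^*\in\mathrm{rint}(\partial f(h(x^* )))$; (3) $\mathcal{G}$ is a ($\mathcal{C}^p$-)active manifold of $g$ at $x^*$ and $\mathcal{F}$ is a ($\mathcal{C}^p$-)active manifold of $f$ at $h(x^* )$. Anderson acceleration with memory $m\ge1$ for a mapping $H$, started at $x^0$: put $H^k=H(x^k)$, $r^k=H^k-x^k$, $m_k=\min(m,k)$. For $k=0,1,2,\dots$ let $\alpha^k=(\alpha^k_0,\dots,\alpha^k_{m_k})$ be a minimizer of $\big\|\sum_{i=0}^{m_k}\alpha_i r^{k-m_k+i}\big\|^2$ over $\alpha\in\mathbb{R}^{m_k+1}$ with $\sum_i\alpha_i=1$, and set $x^{k+1}=\sum_{i=0}^{m_k}\alpha^k_iH^{k-m_k+i}$. "Sufficiently close" may depend on $M_\alpha$, $m$ and $H$. *)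

theory Defs
  imports "HOL-Analysis.Analysis"
begin

text \<open>Class \<open>C\<^sup>k\<close> on an open set \<open>S\<close> of a finite-dimensional space: iterated directional
  derivatives up to order \<open>k\<close> exist (each function being Frechet differentiable) and those of
  order \<open>k\<close> are continuous.\<close>

fun higher_differentiable_on ::
  "'a::euclidean_space set \<Rightarrow> ('a \<Rightarrow> 'b::euclidean_space) \<Rightarrow> nat \<Rightarrow> bool" where
  "higher_differentiable_on S f 0 \<longleftrightarrow> continuous_on S f"
| "higher_differentiable_on S f (Suc k) \<longleftrightarrow>
     (\<forall>x\<in>S. f differentiable (at x)) \<and>
     (\<forall>v. higher_differentiable_on S (\<lambda>x. frechet_derivative f (at x) v) k)"

section \<open>Extended-real-valued functions\<close>

definition epi :: "('a \<Rightarrow> ereal) \<Rightarrow> ('a \<times> real) set" where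
  "epi \<phi> = {(x, t). \<phi> x \<le> ereal t}"

definition closed_fun :: "('a::euclidean_space \<Rightarrow> ereal) \<Rightarrow> bool" where
  "closed_fun \<phi> \<longleftrightarrow> closed (epi \<phi>)"

definition convex_fun :: "('a::euclidean_space \<Rightarrow> ereal) \<Rightarrow> bool" where
  "convex_fun \<phi> \<longleftrightarrow> convex (epi \<phi>)"

definition weakly_convex :: "real \<Rightarrow> ('a::euclidean_space \<Rightarrow> ereal) \<Rightarrow> bool" where
  "weakly_convex \<sigma> \<phi> \<longleftrightarrow> convex_fun (\<lambda>x. \<phi> x + ereal (\<sigma> / 2 * (norm x)\<^sup>2))"

definition level_bounded :: "('a::euclidean_space \<Rightarrow> ereal) \<Rightarrow> bool" where
  "level_bounded \<phi> \<longleftrightarrow> (\<forall>c::real. bounded {x. \<phi> x \<le> ereal c})"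

section \<open>Normal cones and subdifferentials\<close>

text \<open>At an isolated point of \<open>Q\<close> the filter is trivial, so that \<open>Limsup\<close> is \<open>-\<infinity>\<close> and every
  vector is normal.\<close>

definition regular_normal_cone :: "'a::euclidean_space set \<Rightarrow> 'a \<Rightarrow> 'a set" where
  "regular_normal_cone Q x =
     {\<nu>. x \<in> Q \<and> Limsup (at x within Q) (\<lambda>y. ereal ((\<nu> \<bullet> (y - x)) / norm (y - x))) \<le> 0}"

definition limiting_normal_cone :: "'a::euclidean_space set \<Rightarrow> 'a \<Rightarrow> 'a set" where
  "limiting_normal_cone Q x =
     {\<nu>. \<exists>X N. (\<forall>i. X i \<in> Q \<and> N i \<in> regular_normal_cone Q (X i)) \<and>
               X \<longlonglongrightarrow> x \<and> N \<longlonglongrightarrow> \<nu>}"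

definition clarke_normal_cone :: "'a::euclidean_space set \<Rightarrow> 'a \<Rightarrow> 'a set" where
  "clarke_normal_cone Q x = closure (convex hull (limiting_normal_cone Q x))"

text \<open>Both subdifferentials are empty at points where \<open>\<phi>\<close> is not finite.\<close>

definition subdiff :: "('a::euclidean_space \<Rightarrow> ereal) \<Rightarrow> 'a \<Rightarrow> 'a set" where
  "subdiff \<phi> x =
     {\<nu>. \<bar>\<phi> x\<bar> \<noteq> \<infinity> \<and> (\<nu>, -1) \<in> regular_normal_cone (epi \<phi>) (x, real_of_ereal (\<phi> x))}"

definition clarke_subdiff :: "('a::euclidean_space \<Rightarrow> ereal) \<Rightarrow> 'a \<Rightarrow> 'a set" where
  "clarke_subdiff \<phi> x =
     {\<nu>. \<bar>\<phi> x\<bar> \<noteq> \<infinity> \<and> (\<nu>, -1) \<in> clarke_normal_cone (epi \<phi>) (x, real_of_ereal (\<phi> x))}"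

definition critical_point :: "('a::euclidean_space \<Rightarrow> ereal) \<Rightarrow> 'a \<Rightarrow> bool" where
  "critical_point \<phi> x \<longleftrightarrow> 0 \<in> subdiff \<phi> x"

definition regular_at :: "('a::euclidean_space \<Rightarrow> ereal) \<Rightarrow> 'a \<Rightarrow> bool" where
  "regular_at \<phi> x \<longleftrightarrow> \<bar>\<phi> x\<bar> \<noteq> \<infinity> \<and>
     (let z = (x, real_of_ereal (\<phi> x)) in
        (\<exists>\<epsilon>>0. closed (epi \<phi> \<inter> cball z \<epsilon>)) \<and>
        regular_normal_cone (epi \<phi>) z = clarke_normal_cone (epi \<phi>) z)"

definition subderivative :: "('a::euclidean_space \<Rightarrow> ereal) \<Rightarrow> 'a \<Rightarrow> 'a \<Rightarrow> ereal" where
  "subderivative \<phi> x w =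
     Liminf (at_right (0::real) \<times>\<^sub>F nhds w) (\<lambda>(\<tau>, \<nu>). (\<phi> (x + \<tau> *\<^sub>R \<nu>) - \<phi> x) / ereal \<tau>)"

section \<open>Smooth manifolds\<close>

text \<open>The map \<open>G\<close> from \<open>R\<^sup>n\<close> to \<open>R\<^sup>n\<^sup>-\<^sup>r\<close>, whose codomain depends on \<open>r\<close>, is given by its \<open>n - r\<close>
  component functions \<open>G i\<close>.  The rows of its Jacobian are the derivatives of the components;
  full row rank means that they are linearly independent.\<close>

definition local_equations ::
  "nat \<Rightarrow> nat \<Rightarrow> 'a::euclidean_space set \<Rightarrow> 'a \<Rightarrow> (nat \<Rightarrow> 'a \<Rightarrow> real) \<Rightarrow> bool" where
  "local_equations p r M x G \<longleftrightarrow>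
     r \<le> DIM('a) \<and>
     (\<forall>i < DIM('a) - r. higher_differentiable_on UNIV (G i) p) \<and>
     (\<forall>c :: nat \<Rightarrow> real.
        (\<forall>v. (\<Sum>i < DIM('a) - r. c i * frechet_derivative (G i) (at x) v) = 0) \<longrightarrow>
        (\<forall>i < DIM('a) - r. c i = 0)) \<and>
     (\<exists>\<epsilon>>0. M \<inter> ball x \<epsilon> = {y \<in> ball x \<epsilon>. \<forall>i < DIM('a) - r. G i y = 0})"

definition smooth_manifold_at ::
  "nat \<Rightarrow> nat \<Rightarrow> 'a::euclidean_space set \<Rightarrow> 'a \<Rightarrow> bool" where
  "smooth_manifold_at p r M x \<longleftrightarrow> x \<in> M \<and> (\<exists>G. local_equations p r M x G)"

text \<open>The kernel of the Jacobian does not depend on the chosen \<open>C\<^sup>p\<close> equations (\<open>p \<ge> 1\<close>).\<close>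

definition tangent_space :: "nat \<Rightarrow> 'a::euclidean_space set \<Rightarrow> 'a \<Rightarrow> 'a set" where
  "tangent_space p M x =
     (SOME T. \<exists>r G. local_equations p r M x G \<and>
        T = {v. \<forall>i < DIM('a) - r. frechet_derivative (G i) (at x) v = 0})"

definition normal_space :: "nat \<Rightarrow> 'a::euclidean_space set \<Rightarrow> 'a \<Rightarrow> 'a set" where
  "normal_space p M x = orthogonal_comp (tangent_space p M x)"

section \<open>Active manifolds\<close>

text \<open>The restriction of \<open>\<phi>\<close> to \<open>M\<close> is smooth near \<open>x\<close> if it has a smooth local extension.\<close>

definition smooth_restriction_at ::
  "nat \<Rightarrow> ('a::euclidean_space \<Rightarrow> ereal) \<Rightarrow> 'a set \<Rightarrow> 'a \<Rightarrow> bool" where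
  "smooth_restriction_at p \<phi> M x \<longleftrightarrow>
     (\<exists>\<epsilon>>0. \<exists>\<psi> :: 'a \<Rightarrow> real. higher_differentiable_on (ball x \<epsilon>) \<psi> p \<and>
        (\<forall>y \<in> M \<inter> ball x \<epsilon>. \<phi> y = ereal (\<psi> y)))"

text \<open>Painleve-Kuratowski continuity of a set-valued map at \<open>x\<close> relative to \<open>M\<close>: outer and inner
  semicontinuity.\<close>

definition setvalued_continuous_at ::
  "('a::euclidean_space \<Rightarrow> 'b::euclidean_space set) \<Rightarrow> 'a set \<Rightarrow> 'a \<Rightarrow> bool" where
  "setvalued_continuous_at S M x \<longleftrightarrow>
     (\<forall>X V v. (\<forall>i. X i \<in> M) \<longrightarrow> X \<longlonglongrightarrow> x \<longrightarrow> (\<forall>i. V i \<in> S (X i)) \<longrightarrow> V \<longlonglongrightarrow> v \<longrightarrow> v \<in> S x) \<and>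
     (\<forall>v \<in> S x. \<forall>X. (\<forall>i. X i \<in> M) \<longrightarrow> X \<longlonglongrightarrow> x \<longrightarrow>
        (\<exists>V. V \<longlonglongrightarrow> v \<and> (\<forall>\<^sub>F i in sequentially. V i \<in> S (X i))))"

definition active_manifold ::
  "nat \<Rightarrow> ('a::euclidean_space \<Rightarrow> ereal) \<Rightarrow> 'a set \<Rightarrow> 'a \<Rightarrow> bool" where
  "active_manifold p \<phi> M x \<longleftrightarrow>
     (\<exists>r. smooth_manifold_at p r M x) \<and> smooth_restriction_at p \<phi> M x \<and>
     (\<exists>\<epsilon>>0. \<forall>y \<in> M \<inter> ball x \<epsilon>. regular_at \<phi> y \<and> subdiff \<phi> y \<noteq> {}) \<and>
     (\<forall>\<nu> \<in> normal_space p M x. \<nu> \<noteq> 0 \<longrightarrow> subderivative \<phi> x (- \<nu>) > - subderivative \<phi> x \<nu>) \<and>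
     setvalued_continuous_at (clarke_subdiff \<phi>) M x"

definition composite_active_manifold ::
  "nat \<Rightarrow> (real^'d \<Rightarrow> real) \<Rightarrow> (real^'n \<Rightarrow> real^'d) \<Rightarrow> (real^'n \<Rightarrow> ereal) \<Rightarrow>
   (real^'n) set \<Rightarrow> real^'n \<Rightarrow> bool" where
  "composite_active_manifold p f h g M x \<longleftrightarrow>
     (\<forall>w \<in> subdiff (\<lambda>z. ereal (f z)) (h x). \<forall>v \<in> subdiff g x.
        0 = transpose (jacobian h (at x)) *v w + v \<longrightarrow>
        (\<exists>\<G> \<F>. M = \<G> \<inter> h -` \<F> \<and>
           (\<exists>r. smooth_manifold_at p r \<G> x) \<and>
           (\<exists>r. smooth_manifold_at p r \<F> (h x)) \<and>
           {jacobian h (at x) *v a + b |a b.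
              a \<in> tangent_space p \<G> x \<and> b \<in> tangent_space p \<F> (h x)} = UNIV \<and>
           v \<in> rel_interior (subdiff g x) \<and>
           w \<in> rel_interior (subdiff (\<lambda>z. ereal (f z)) (h x)) \<and>
           active_manifold p g \<G> x \<and>
           active_manifold p (\<lambda>z. ereal (f z)) \<F> (h x)))"

section \<open>Anderson acceleration\<close>

text \<open>\<open>x\<close> is a sequence of iterates and \<open>\<alpha> k i\<close>, for \<open>i \<le> min m k\<close>, the coefficients of step \<open>k\<close>.
  Any choice of the (possibly non-unique) minimizers is allowed.\<close>

definition anderson_iterates ::
  "('a::euclidean_space \<Rightarrow> 'a) \<Rightarrow> nat \<Rightarrow> (nat \<Rightarrow> 'a) \<Rightarrow> (nat \<Rightarrow> nat \<Rightarrow> real) \<Rightarrow> bool" where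
  "anderson_iterates H m x \<alpha> \<longleftrightarrow>
     (\<forall>k. let mk = min m k; r = (\<lambda>j. H (x j) - x j) in
        is_arg_min (\<lambda>a. (norm (\<Sum>i\<le>mk. a i *\<^sub>R r (k - mk + i)))\<^sup>2)
          (\<lambda>a. (\<Sum>i\<le>mk. a i) = 1) (\<alpha> k) \<and>
        x (Suc k) = (\<Sum>i\<le>mk. \<alpha> k i *\<^sub>R H (x (k - mk + i))))"

end

theory Submission
  imports Defs
begin

text \<open>
  Near a pair \<open>(x, v)\<close> with \<open>v\<close> in the relative interior of the subdifferential, an active manifold
  describes the graph of the subdifferential by smooth equations with multipliers: a Lagrangian gradient
  that leaves the subdifferential along the manifold could be separated from it by a normal direction,
  and in the limit this contradicts sharpness and the relative interior condition.
  Inserted into the optimality condition of the prox-linear subproblem, this gives a square system of class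
  \<open>C\<^sup>2\<close>, nondegenerate by strong convexity and transversality.  The implicit function theorem
  solves it; since the subproblem is strongly convex, the solution is \<open>H\<close>, so that no separate
  identification argument is needed.

  For Anderson acceleration, \<open>H\<close> is affine up to a quadratic error near the fixed point.  As the
  combined residual is at most the last one, each step contracts the residual by \<open>\<gamma>\<close> up to a quadratic
  term, which is absorbed by passing from \<open>\<gamma>\<close> to \<open>(1 + \<gamma>) / 2\<close>.
\<close>

section \<open>Calculus of functions of class \<open>C\<^sup>k\<close>\<close>

text \<open>The definition of a composite active manifold quantifies over all pairs
  \<open>(w, v)\<close> of multipliers, so it yields nothing until one pair exists. Such a pair
  comes from separating a ray from the epigraph of a perturbed prox-linear model; as
  \<open>f\<close> is finite everywhere, the hyperplane cannot be vertical. The curvature behind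
  nondegeneracy is not read off a Hessian. The points of the chart are genuine subgradients, so
  hypomonotonicity along a curve in the manifold, divided by the squared parameter, bounds the
  derivative of the Lagrangian gradient below by \<open>- \<sigma>\<close> for \<open>g\<close> and
  by \<open>0\<close> for \<open>f\<close>. With \<open>\<beta> * \<sigma> < 1\<close>, the
  linearized subproblem is then strictly monotone in the primal direction. Since the class is
  defined by directional derivatives, a family of linear maps is called smooth when
  \<open>L x v\<close> is smooth in \<open>x\<close> for each fixed \<open>v\<close>; inversion of
  linear maps is treated in this sense too. Data of class 3 give Lagrangian gradients of class 2,
  which is the order obtained for \<open>H\<close>. In the acceleration part, the gap between
  \<open>\<gamma>\<close> and \<open>\<gamma>'\<close> pays for the quadratic error, and the length
  of the memory is paid for by a factor \<open>\<gamma>' ^ m\<close> in the admissible distance of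
  the starting point.\<close>

lemma higher_differentiable_on_cong:
  assumes "open S" "\<And>x. x \<in> S \<Longrightarrow> f x = g x" "higher_differentiable_on S f k"
  shows "higher_differentiable_on S g k"
  using assms
proof (induction k arbitrary: f g)
  case 0
  then show ?case by (simp cong: continuous_on_cong)
next
  case (Suc k)
  have der: "(g has_derivative frechet_derivative f (at x)) (at x)" if "x \<in> S" for x
  proof -
    have "(f has_derivative frechet_derivative f (at x)) (at x)"
      using Suc.prems that frechet_derivative_works by auto
    then show ?thesis
      by (rule has_derivative_transform_within_open[of _ _ _ _ S]) (use Suc.prems that in auto)
  qed
  have eq: "frechet_derivative f (at x) = frechet_derivative g (at x)" if "x \<in> S" for x
    by (rule frechet_derivative_at[OF der[OF that]])
  have "higher_differentiable_on S (\<lambda>x. frechet_derivative g (at x) v) k" for v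
    by (rule Suc.IH[OF Suc.prems(1), of "\<lambda>x. frechet_derivative f (at x) v"])
       (use Suc.prems eq in auto)
  then show ?case
    using der by (auto simp: differentiable_def)
qed

text \<open>The working introduction rule for the inductions on the order: an explicit formula for
  the derivative can be used directly instead of \<open>frechet_derivative\<close>.\<close>

lemma higher_differentiable_on_SucI:
  assumes S: "open S" and der: "\<And>x. x \<in> S \<Longrightarrow> (f has_derivative f' x) (at x)"
    and smooth: "\<And>v. higher_differentiable_on S (\<lambda>x. f' x v) k"
  shows "higher_differentiable_on S f (Suc k)"
proof -
  have "higher_differentiable_on S (\<lambda>x. frechet_derivative f (at x) v) k" for v
    by (rule higher_differentiable_on_cong[OF S _ smooth[of v]])
       (use frechet_derivative_at[OF der] in metis)
  then show ?thesis
    using der by (auto simp: differentiable_def)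
qed

lemma higher_differentiable_on_subset:
  "higher_differentiable_on S f k \<Longrightarrow> T \<subseteq> S \<Longrightarrow> higher_differentiable_on T f k"
  by (induction k arbitrary: f) (auto intro: continuous_on_subset)

lemma higher_differentiable_on_SucD:
  "higher_differentiable_on S f (Suc k) \<Longrightarrow> higher_differentiable_on S f k"
proof (induction k arbitrary: f)
  case 0
  then show ?case
    by (auto intro!: continuous_at_imp_continuous_on differentiable_imp_continuous_within)
next
  case (Suc k)
  then show ?case
    by (metis higher_differentiable_on.simps(2))
qed

lemma higher_differentiable_on_le:
  "higher_differentiable_on S f k \<Longrightarrow> j \<le> k \<Longrightarrow> higher_differentiable_on S f j"
  by (induction k) (auto simp: le_Suc_eq dest: higher_differentiable_on_SucD simp del: higher_differentiable_on.simps)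

lemma higher_differentiable_on_has_derivative:
  assumes "higher_differentiable_on S f k" "k \<ge> 1" "x \<in> S"
  shows "(f has_derivative frechet_derivative f (at x)) (at x)"
proof (cases k)
  case (Suc j)
  then show ?thesis using assms by (auto simp: frechet_derivative_works[symmetric])
qed (use assms in auto)

lemma higher_differentiable_on_continuous_on:
  "higher_differentiable_on S f k \<Longrightarrow> continuous_on S f"
  using higher_differentiable_on_le[of S f k 0] by simp

lemma higher_differentiable_on_frechet:
  "higher_differentiable_on S f (Suc k) \<Longrightarrow>
   higher_differentiable_on S (\<lambda>x. frechet_derivative f (at x) v) k"
  by simp

lemma higher_differentiable_on_const:
  "higher_differentiable_on S (\<lambda>x. c) k"
  by (induction k arbitrary: c) auto

lemma higher_differentiable_on_linear:
  assumes "open S" "linear f"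
  shows "higher_differentiable_on S f k"
proof (cases k)
  case 0
  then show ?thesis using assms linear_continuous_on linear_conv_bounded_linear by auto
next
  case (Suc j)
  show ?thesis unfolding Suc
    by (rule higher_differentiable_on_SucI[OF assms(1), where f'="\<lambda>_. f"])
       (auto simp: assms linear_imp_has_derivative higher_differentiable_on_const)
qed

lemma higher_differentiable_on_add:
  assumes "open S" "higher_differentiable_on S f k" "higher_differentiable_on S g k"
  shows "higher_differentiable_on S (\<lambda>x. f x + g x) k"
  using assms
proof (induction k arbitrary: f g)
  case 0
  then show ?case by (auto intro: continuous_on_add)
next
  case (Suc k)
  show ?case
    by (rule higher_differentiable_on_SucI[OF assms(1),
          where f'="\<lambda>x v. frechet_derivative f (at x) v + frechet_derivative g (at x) v"])
       (use Suc in \<open>auto intro!: has_derivative_add higher_differentiable_on_has_derivative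
           simp del: higher_differentiable_on.simps intro: higher_differentiable_on_frechet\<close>)
qed

lemma higher_differentiable_on_sum:
  assumes "open S" "\<And>i. i \<in> I \<Longrightarrow> higher_differentiable_on S (f i) k"
  shows "higher_differentiable_on S (\<lambda>x. \<Sum>i\<in>I. f i x) k"
  using assms(2)
  by (induction I rule: infinite_finite_induct)
     (auto intro: higher_differentiable_on_const higher_differentiable_on_add assms(1))

lemma higher_differentiable_on_bilinear:
  assumes "open S" "bounded_bilinear b"
    "higher_differentiable_on S f k" "higher_differentiable_on S g k"
  shows "higher_differentiable_on S (\<lambda>x. b (f x) (g x)) k"
  using assms(3,4)
proof (induction k arbitrary: f g)
  case 0
  then show ?case using bounded_bilinear.continuous_on[OF assms(2)] by auto
next
  case (Suc k)
  note fg = Suc.prems[THEN higher_differentiable_on_frechet]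
    Suc.prems[THEN higher_differentiable_on_SucD]
  show ?case
    by (rule higher_differentiable_on_SucI[OF assms(1),
          where f'="\<lambda>x v. b (f x) (frechet_derivative g (at x) v) + b (frechet_derivative f (at x) v) (g x)"])
       (use Suc.prems in \<open>auto intro!: bounded_bilinear.FDERIV[OF assms(2)] higher_differentiable_on_has_derivative
           higher_differentiable_on_add assms(1) Suc.IH fg
           simp del: higher_differentiable_on.simps\<close>)
qed

lemma higher_differentiable_on_linear_comp:
  assumes "open S" "linear L" "higher_differentiable_on S f k"
  shows "higher_differentiable_on S (\<lambda>x. L (f x)) k"
  using assms(3)
proof (induction k arbitrary: f)
  case 0
  then show ?case
    using linear_continuous_on_compose[OF _ assms(2)] by auto
next
  case (Suc k)
  show ?case
    by (rule higher_differentiable_on_SucI[OF assms(1),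
          where f'="\<lambda>x v. L (frechet_derivative f (at x) v)"])
       (use Suc in \<open>auto intro!: bounded_linear.has_derivative[OF linear_conv_bounded_linear[THEN iffD1, OF assms(2)]]
           higher_differentiable_on_has_derivative
           simp del: higher_differentiable_on.simps dest: higher_differentiable_on_frechet\<close>)
qed

lemmas higher_differentiable_on_inner = higher_differentiable_on_bilinear[OF _ bounded_bilinear_inner]
lemmas higher_differentiable_on_scaleR = higher_differentiable_on_bilinear[OF _ bounded_bilinear_scaleR]

lemma higher_differentiable_on_componentwise:
  assumes "open S" "\<And>b. b \<in> Basis \<Longrightarrow> higher_differentiable_on S (\<lambda>x. f x \<bullet> b) k"
  shows "higher_differentiable_on S f k"
proof -
  have "higher_differentiable_on S (\<lambda>x. \<Sum>b\<in>Basis. (f x \<bullet> b) *\<^sub>R b) k"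
    by (intro higher_differentiable_on_sum higher_differentiable_on_scaleR
        higher_differentiable_on_const assms)
  then show ?thesis by (simp add: euclidean_representation)
qed

lemma linear_Pair_fst: "linear (\<lambda>x. (x, 0))" and linear_Pair_snd: "linear (\<lambda>x. (0, x))"
  by (auto intro!: linearI simp: zero_prod_def)

lemma higher_differentiable_on_Pair:
  assumes "open S" "higher_differentiable_on S f k" "higher_differentiable_on S g k"
  shows "higher_differentiable_on S (\<lambda>x. (f x, g x)) k"
  using higher_differentiable_on_add[OF assms(1)
      higher_differentiable_on_linear_comp[OF assms(1) linear_Pair_fst assms(2)]
      higher_differentiable_on_linear_comp[OF assms(1) linear_Pair_snd assms(3)]]
  by simp

lemma linear_basis_expansion:
  fixes f :: "'a::euclidean_space \<Rightarrow> 'b::real_vector"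
  assumes "linear f"
  shows "f v = (\<Sum>b\<in>Basis. (v \<bullet> b) *\<^sub>R f b)"
proof -
  have "f v = f (\<Sum>b\<in>Basis. (v \<bullet> b) *\<^sub>R b)" by (simp add: euclidean_representation)
  then show ?thesis by (simp add: linear_sum[OF assms] linear_cmul[OF assms])
qed

text \<open>Expanding \<open>u x\<close> in the basis reduces the joint dependence on map and
  argument to the values of \<open>L x\<close> on fixed vectors, so smoothness into a space of
  operators never has to be formulated.\<close>

lemma higher_differentiable_on_linear_apply:
  assumes "open S" "\<And>x. x \<in> S \<Longrightarrow> linear (L x)"
    "\<And>v. higher_differentiable_on S (\<lambda>x. L x v) k" "higher_differentiable_on S u k"
  shows "higher_differentiable_on S (\<lambda>x. L x (u x)) k"
proof (rule higher_differentiable_on_cong[OF assms(1)])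
  show "higher_differentiable_on S (\<lambda>x. \<Sum>b\<in>Basis. (u x \<bullet> b) *\<^sub>R L x b) k"
    by (intro higher_differentiable_on_sum higher_differentiable_on_scaleR
        higher_differentiable_on_inner higher_differentiable_on_const assms)
qed (use linear_basis_expansion[OF assms(2)] in metis)

lemma higher_differentiable_on_compose:
  assumes S: "open S" and T: "open T" and "higher_differentiable_on S g k"
    "higher_differentiable_on T f k" and sub: "\<And>x. x \<in> S \<Longrightarrow> g x \<in> T"
  shows "higher_differentiable_on S (\<lambda>x. f (g x)) k"
  using assms(3,4)
proof (induction k arbitrary: f)
  case 0
  then show ?case
    using sub by (auto intro!: continuous_on_compose2[of T f S g])
next
  case (Suc k)
  have g: "higher_differentiable_on S g k" using Suc.prems(1) by (rule higher_differentiable_on_SucD)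
  note hd = higher_differentiable_on_has_derivative
  show ?case
  proof (rule higher_differentiable_on_SucI[OF S])
    show "((\<lambda>x. f (g x)) has_derivative (\<lambda>v. frechet_derivative f (at (g x)) (frechet_derivative g (at x) v))) (at x)"
      if "x \<in> S" for x
      using has_derivative_compose[OF hd[OF Suc.prems(1)] hd[OF Suc.prems(2)], of x] sub that by auto
    show "higher_differentiable_on S (\<lambda>x. frechet_derivative f (at (g x)) (frechet_derivative g (at x) v)) k" for v
    proof (rule higher_differentiable_on_linear_apply[OF S,
          where L="\<lambda>x. frechet_derivative f (at (g x))"])
      show "linear (frechet_derivative f (at (g x)))" if "x \<in> S" for x
        using hd[OF Suc.prems(2)] sub that by (auto intro: has_derivative_linear)
      show "higher_differentiable_on S (\<lambda>x. frechet_derivative f (at (g x)) v) k" for v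
        using Suc.IH[OF g higher_differentiable_on_frechet[OF Suc.prems(2)]] by blast
      show "higher_differentiable_on S (\<lambda>x. frechet_derivative g (at x) v) k"
        using higher_differentiable_on_frechet[OF Suc.prems(1)] by blast
    qed
  qed
qed

text \<open>Where \<open>p\<close> vanishes, the term of the product rule that differentiates
  \<open>m\<close> is multiplied by zero, so continuity of \<open>m\<close> suffices. This
  differentiates an inverse linear map that is so far only known to be continuous.\<close>

lemma has_derivative_scaleR_vanishing:
  fixes p :: "'a::real_normed_vector \<Rightarrow> real" and m :: "'a \<Rightarrow> 'b::real_normed_vector"
  assumes p: "(p has_derivative p') (at x)" and p0: "p x = 0" and m: "isCont m x"
  shows "((\<lambda>y. p y *\<^sub>R m y) has_derivative (\<lambda>h. p' h *\<^sub>R m x)) (at x)"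
proof -
  interpret p': bounded_linear p' using p by (rule has_derivative_bounded_linear)
  obtain K where K: "\<And>h. norm (p' h) \<le> norm h * K" using p'.bounded by blast
  have lim_p: "((\<lambda>h. norm (p (x + h) - p x - p' h) / norm h) \<longlongrightarrow> 0) (at 0)"
    using p by (simp add: has_derivative_at)
  have lim_m: "((\<lambda>h. m (x + h)) \<longlongrightarrow> m x) (at 0)"
    using m by (simp add: isCont_def LIM_offset_zero_iff)
  have bl: "bounded_linear (\<lambda>h. p' h *\<^sub>R m x)"
    by (rule bounded_linear_compose[OF bounded_linear_scaleR_left p'.bounded_linear_axioms])
  have "((\<lambda>h. norm (p (x + h) - p x - p' h) / norm h * norm (m (x + h)) + K * norm (m (x + h) - m x)) \<longlongrightarrow>
      0 * norm (m x) + K * norm (m x - m x)) (at 0)"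
    by (intro tendsto_intros lim_p lim_m)
  then have lim: "((\<lambda>h. norm (p (x + h) - p x - p' h) / norm h * norm (m (x + h)) + K * norm (m (x + h) - m x)) \<longlongrightarrow> 0) (at 0)"
    by simp
  have "((\<lambda>h. norm (p (x + h) *\<^sub>R m (x + h) - p x *\<^sub>R m x - p' h *\<^sub>R m x) / norm h) \<longlongrightarrow> 0) (at 0)"
  proof (rule Lim_null_comparison[OF _ lim], rule eventuallyI)
    fix h :: 'a
    have eq: "p (x + h) *\<^sub>R m (x + h) - p x *\<^sub>R m x - p' h *\<^sub>R m x
        = (p (x + h) - p x - p' h) *\<^sub>R m (x + h) + p' h *\<^sub>R (m (x + h) - m x)"
      by (simp add: p0 algebra_simps)
    have "norm (p (x + h) *\<^sub>R m (x + h) - p x *\<^sub>R m x - p' h *\<^sub>R m x)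
        \<le> norm (p (x + h) - p x - p' h) * norm (m (x + h)) + (norm h * K) * norm (m (x + h) - m x)"
      unfolding eq by (rule order_trans[OF norm_triangle_ineq])
        (use K[of h] in \<open>auto intro!: add_mono mult_right_mono\<close>)
    then have "norm (p (x + h) *\<^sub>R m (x + h) - p x *\<^sub>R m x - p' h *\<^sub>R m x) / norm h
        \<le> (norm (p (x + h) - p x - p' h) * norm (m (x + h)) + (norm h * K) * norm (m (x + h) - m x)) / norm h"
      by (rule divide_right_mono) simp
    also have "\<dots> \<le> norm (p (x + h) - p x - p' h) / norm h * norm (m (x + h)) + K * norm (m (x + h) - m x)"
    proof (cases "h = 0")
      case True
      then show ?thesis by (simp add: p0)
    qed (simp add: field_simps)
    finally show "norm (norm (p (x + h) *\<^sub>R m (x + h) - p x *\<^sub>R m x - p' h *\<^sub>R m x) / norm h)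
        \<le> norm (p (x + h) - p x - p' h) / norm h * norm (m (x + h)) + K * norm (m (x + h) - m x)"
      by simp
  qed
  then show ?thesis using bl by (simp add: has_derivative_at)
qed

text \<open>Near \<open>x0\<close> the maps \<open>L x\<close> are uniformly bounded below, because
  they are small perturbations of an invertible one. As \<open>L x\<close> sends
  \<open>J x v - J x0 v\<close> to \<open>v - L x (J x0 v)\<close>, which tends to \<open>0\<close>,
  the difference itself tends to \<open>0\<close>.\<close>

lemma inverse_linear_continuous:
  fixes L :: "'a::t2_space \<Rightarrow> 'b::euclidean_space \<Rightarrow> 'c::euclidean_space"
  assumes lin: "\<And>x. x \<in> S \<Longrightarrow> linear (L x)" "\<And>x. x \<in> S \<Longrightarrow> linear (J x)"
    and inv: "\<And>x w. x \<in> S \<Longrightarrow> J x (L x w) = w" "\<And>x w. x \<in> S \<Longrightarrow> L x (J x w) = w"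
    and S: "open S" and cont: "\<And>v. continuous_on S (\<lambda>x. L x v)"
  shows "continuous_on S (\<lambda>x. J x v)"
proof (rule continuous_at_imp_continuous_on, rule ballI)
  fix x0 assume x0: "x0 \<in> S"
  have S_ev: "\<forall>\<^sub>F x in at x0. x \<in> S" using S x0 by (rule eventually_at_in_open')
  have Lim: "((\<lambda>x. L x w) \<longlongrightarrow> L x0 w) (at x0)" for w
    using cont[of w] S x0 by (simp add: continuous_on_eq_continuous_at isCont_def)
  obtain c where c: "c > 0" "\<And>w. norm (J x0 w) \<le> c * norm w"
    using linear_bounded_pos[OF lin(2)[OF x0]] by auto
  have "((\<lambda>x. \<Sum>b\<in>Basis. norm (L x b - L x0 b)) \<longlongrightarrow> (\<Sum>b\<in>Basis. norm (L x0 b - L x0 b))) (at x0)"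
    by (intro tendsto_intros Lim)
  \<comment> \<open>With the perturbation below \<open>1 / (2 * c)\<close>, the error is at most
    half of \<open>norm w\<close> and can be absorbed on the left, at the price of doubling
    \<open>c\<close>.\<close>
  then have "\<forall>\<^sub>F x in at x0. (\<Sum>b\<in>Basis. norm (L x b - L x0 b)) < 1 / (2 * c)"
    by (rule order_tendstoD) (use c in simp)
  then have ev: "\<forall>\<^sub>F x in at x0. \<forall>w. norm w \<le> 2 * c * norm (L x w)"
    using S_ev
  proof eventually_elim
    case (elim x)
    show ?case
    proof
      fix w
      have "L x0 w - L x w = (\<Sum>b\<in>Basis. (w \<bullet> b) *\<^sub>R (L x0 b - L x b))"
        using linear_basis_expansion[OF lin(1)[OF x0], of w] linear_basis_expansion[OF lin(1)[OF elim(2)], of w]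
        by (simp add: sum_subtractf scaleR_diff_right)
      then have "norm (L x0 w - L x w) \<le> (\<Sum>b\<in>Basis. norm ((w \<bullet> b) *\<^sub>R (L x0 b - L x b)))"
        using norm_sum by metis
      also have "\<dots> \<le> (\<Sum>b\<in>Basis. norm w * norm (L x b - L x0 b))"
        by (intro sum_mono) (auto intro!: mult_right_mono Basis_le_norm simp: norm_minus_commute)
      also have "\<dots> = norm w * (\<Sum>b\<in>Basis. norm (L x b - L x0 b))"
        by (simp add: sum_distrib_left)
      also have "\<dots> \<le> norm w * (1 / (2 * c))"
        using elim(1) by (intro mult_left_mono) auto
      finally have 1: "norm (L x0 w - L x w) \<le> norm w * (1 / (2 * c))" .
      have "norm (L x0 w) \<le> norm (L x w) + norm (L x0 w - L x w)"
        by (metis add.commute diff_add_cancel norm_triangle_ineq)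
      with 1 have 2: "norm (L x0 w) \<le> norm (L x w) + norm w * (1 / (2 * c))" by linarith
      have "norm w = norm (J x0 (L x0 w))" using inv(1)[OF x0] by simp
      also have "\<dots> \<le> c * norm (L x0 w)" by (rule c)
      also have "\<dots> \<le> c * (norm (L x w) + norm w * (1 / (2 * c)))"
        using 2 c(1) by (intro mult_left_mono) auto
      also have "\<dots> = c * norm (L x w) + norm w / 2" using c(1) by (simp add: field_simps)
      finally show "norm w \<le> 2 * c * norm (L x w)" by linarith
    qed
  qed
  have "((\<lambda>x. 2 * c * norm (v - L x (J x0 v))) \<longlongrightarrow> 2 * c * norm (v - L x0 (J x0 v))) (at x0)"
    by (intro tendsto_intros Lim)
  then have lim: "((\<lambda>x. 2 * c * norm (v - L x (J x0 v))) \<longlongrightarrow> 0) (at x0)"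
    using inv(2)[OF x0] by simp
  have "((\<lambda>x. J x v - J x0 v) \<longlongrightarrow> 0) (at x0)"
  proof (rule Lim_null_comparison[OF _ lim])
    show "\<forall>\<^sub>F x in at x0. norm (J x v - J x0 v) \<le> 2 * c * norm (v - L x (J x0 v))"
      using ev S_ev
    proof eventually_elim
      case (elim x)
      have "L x (J x v - J x0 v) = v - L x (J x0 v)"
        using lin(1)[OF elim(2)] inv(2)[OF elim(2)] by (simp add: linear_diff)
      then show ?case using elim(1) by metis
    qed
  qed
  then show "isCont (\<lambda>x. J x v) x0"
    unfolding isCont_def by (subst (asm) LIM_zero_iff)
qed

text \<open>Differentiating \<open>L x (J x v) = v\<close> gives the derivative
  \<open>- J x (D x u (J x v))\<close>, with \<open>D\<close> the derivative of \<open>L\<close>. It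
  contains no derivative of \<open>J\<close>, so each order of smoothness of \<open>J\<close>
  produces the next one.\<close>

lemma higher_differentiable_on_inverse_linear:
  fixes L :: "'a::euclidean_space \<Rightarrow> 'b::euclidean_space \<Rightarrow> 'c::euclidean_space"
  assumes lin: "\<And>x. x \<in> S \<Longrightarrow> linear (L x)" "\<And>x. x \<in> S \<Longrightarrow> linear (J x)"
    and inv: "\<And>x w. x \<in> S \<Longrightarrow> J x (L x w) = w" "\<And>x w. x \<in> S \<Longrightarrow> L x (J x w) = w"
    and S: "open S" and "\<And>v. higher_differentiable_on S (\<lambda>x. L x v) k"
  shows "higher_differentiable_on S (\<lambda>x. J x v) k"
  using assms(6)
proof (induction k arbitrary: v)
  case 0
  then show ?case using inverse_linear_continuous[OF lin inv S] by simp
next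
  case (Suc k)
  have L: "higher_differentiable_on S (\<lambda>x. L x v) k" for v
    using Suc.prems by (rule higher_differentiable_on_SucD)
  have J: "higher_differentiable_on S (\<lambda>x. J x v) k" for v
    by (rule Suc.IH[OF L])
  have J_cont: "isCont (\<lambda>x. J x v) x" if "x \<in> S" for v x
    using higher_differentiable_on_continuous_on[OF J, of v] S that
    by (simp add: continuous_on_eq_continuous_at)
  define D where "D = (\<lambda>x u v. frechet_derivative (\<lambda>x. L x v) (at x) u)"
  have D: "((\<lambda>x. L x v) has_derivative (\<lambda>u. D x u v)) (at x)" if "x \<in> S" for x v
    unfolding D_def by (rule higher_differentiable_on_has_derivative[OF Suc.prems]) (use that in auto)
  have D_smooth: "higher_differentiable_on S (\<lambda>x. D x u v) k" for u v
    unfolding D_def by (rule higher_differentiable_on_frechet[OF Suc.prems])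
  \<comment> \<open>\<open>D x u v\<close> is built separately for each \<open>v\<close>, so its
    linearity in \<open>v\<close> is not automatic; it is inherited by differentiating the basis
    expansion of \<open>L x v\<close>.\<close>
  have D_eq: "D x u v = (\<Sum>b\<in>Basis. (v \<bullet> b) *\<^sub>R D x u b)" if x: "x \<in> S" for x u v
  proof -
    have "((\<lambda>x. \<Sum>b\<in>Basis. (v \<bullet> b) *\<^sub>R L x b) has_derivative (\<lambda>u. \<Sum>b\<in>Basis. (v \<bullet> b) *\<^sub>R D x u b)) (at x)"
      by (intro derivative_intros D x)
    then have "((\<lambda>x. L x v) has_derivative (\<lambda>u. \<Sum>b\<in>Basis. (v \<bullet> b) *\<^sub>R D x u b)) (at x)"
      by (rule has_derivative_transform_within_open[OF _ S x])
         (use linear_basis_expansion[OF lin(1)] in metis)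
    then show ?thesis using has_derivative_unique[OF D[OF x, of v]] by metis
  qed
  have D_lin: "linear (D x u)" if "x \<in> S" for x u
  proof (rule linearI)
    show "D x u (v + w) = D x u v + D x u w" for v w
      using D_eq[OF that, of u v] D_eq[OF that, of u w] D_eq[OF that, of u "v + w"]
      by (simp add: inner_add_left scaleR_add_left sum.distrib del: inner_Basis)
    show "D x u (r *\<^sub>R v) = r *\<^sub>R D x u v" for r v
      using D_eq[OF that, of u v] D_eq[OF that, of u "r *\<^sub>R v"]
      by (simp add: scaleR_sum_right)
  qed
  show ?case
  proof (rule higher_differentiable_on_SucI[OF S])
    show "higher_differentiable_on S (\<lambda>x. - J x (D x u (J x v))) k" for u
      by (rule higher_differentiable_on_linear_comp[OF S linear_uminus],
          rule higher_differentiable_on_linear_apply[OF S lin(2) J],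
          assumption, rule higher_differentiable_on_linear_apply[OF S D_lin D_smooth J])
  next
    fix x assume x: "x \<in> S"
    \<comment> \<open>Chosen so that \<open>J y (q y) = J y v - J x v\<close> while
      \<open>q x = 0\<close>: the product rule with a vanishing factor then asks only for continuity
      of \<open>J\<close>.\<close>
    define q where "q = (\<lambda>y. v - L y (J x v))"
    have q: "(q has_derivative (\<lambda>u. - D x u (J x v))) (at x)"
      unfolding q_def by (auto intro!: derivative_eq_intros D x)
    have q0: "q x = 0" by (simp add: q_def inv(2)[OF x])
    have "((\<lambda>y. \<Sum>b\<in>Basis. (q y \<bullet> b) *\<^sub>R J y b) has_derivative
        (\<lambda>u. \<Sum>b\<in>Basis. (- D x u (J x v) \<bullet> b) *\<^sub>R J x b)) (at x)"
      by (intro has_derivative_sum has_derivative_scaleR_vanishing J_cont x has_derivative_inner_left q)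
         (simp add: q0)
    then have "((\<lambda>y. \<Sum>b\<in>Basis. (q y \<bullet> b) *\<^sub>R J y b) has_derivative (\<lambda>u. - J x (D x u (J x v)))) (at x)"
      unfolding linear_basis_expansion[OF lin(2)[OF x], symmetric] linear_neg[OF lin(2)[OF x]] .
    then have "((\<lambda>y. (\<Sum>b\<in>Basis. (q y \<bullet> b) *\<^sub>R J y b) + J x v) has_derivative (\<lambda>u. - J x (D x u (J x v)))) (at x)"
      using has_derivative_add[OF _ has_derivative_const[of "J x v"]] by fastforce
    then show "((\<lambda>y. J y v) has_derivative (\<lambda>u. - J x (D x u (J x v)))) (at x)"
    proof (rule has_derivative_transform_within_open[OF _ S x])
      fix y assume y: "y \<in> S"
      have "(\<Sum>b\<in>Basis. (q y \<bullet> b) *\<^sub>R J y b) = J y (q y)"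
        using linear_basis_expansion[OF lin(2)[OF y]] by metis
      also have "\<dots> = J y v - J x v"
        by (simp add: q_def linear_diff[OF lin(2)[OF y]] inv(1)[OF y])
      finally show "(\<Sum>b\<in>Basis. (q y \<bullet> b) *\<^sub>R J y b) + J x v = J y v" by simp
    qed
  qed
qed

section \<open>Lipschitz and Taylor bounds on a smaller closed ball\<close>

lemma higher_differentiable_on_lipschitz:
  fixes F :: "'a::euclidean_space \<Rightarrow> 'b::euclidean_space"
  assumes F: "higher_differentiable_on (ball x \<epsilon>) F 1" and \<epsilon>: "0 < \<epsilon>"
  obtains L where "L-lipschitz_on (cball x (\<epsilon> / 2)) F"
proof -
  have sub: "cball x (\<epsilon> / 2) \<subseteq> ball x \<epsilon>" using \<epsilon> by auto
  let ?D = "\<lambda>y. frechet_derivative F (at y)"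
  have D: "(F has_derivative ?D y) (at y)" if "y \<in> cball x (\<epsilon> / 2)" for y
    by (rule higher_differentiable_on_has_derivative[OF F]) (use that sub in auto)
  have "continuous_on (ball x \<epsilon>) (\<lambda>y. ?D y b)" for b using F by simp
  then have "continuous_on (cball x (\<epsilon> / 2)) (\<lambda>y. \<Sum>b\<in>Basis. norm (?D y b))"
    by (intro continuous_intros continuous_on_subset[OF _ sub])
  then have "compact ((\<lambda>y. \<Sum>b\<in>Basis. norm (?D y b)) ` cball x (\<epsilon> / 2))"
    by (rule compact_continuous_image) simp
  then have "bounded ((\<lambda>y. \<Sum>b\<in>Basis. norm (?D y b)) ` cball x (\<epsilon> / 2))"
    by (rule compact_imp_bounded)
  then obtain C where "\<forall>t \<in> (\<lambda>y. \<Sum>b\<in>Basis. norm (?D y b)) ` cball x (\<epsilon> / 2). norm t \<le> C"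
    unfolding bounded_iff by blast
  then have C: "(\<Sum>b\<in>Basis. norm (?D y b)) \<le> C" if "y \<in> cball x (\<epsilon> / 2)" for y
    using that by force
  have C0: "0 \<le> C"
    using C[of x] \<epsilon> by (intro order_trans[OF _ C[of x]] sum_nonneg) auto
  have "C-lipschitz_on (cball x (\<epsilon> / 2)) F"
  proof (rule bounded_derivative_imp_lipschitz[OF _ convex_cball _ C0])
    show "(F has_derivative ?D y) (at y within cball x (\<epsilon> / 2))" if "y \<in> cball x (\<epsilon> / 2)" for y
      using D[OF that] by (rule has_derivative_at_withinI)
    show "onorm (?D y) \<le> C" if "y \<in> cball x (\<epsilon> / 2)" for y
      by (rule order_trans[OF onorm_componentwise C[OF that]])
         (rule has_derivative_bounded_linear[OF D[OF that]])
  qed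
  then show ?thesis by (rule that)
qed

text \<open>The mean value inequality is applied to \<open>F\<close> minus its linear part on the
  ball of radius \<open>norm (y - x)\<close>. There the derivative is at most \<open>K\<close> times
  this radius, where \<open>K\<close> adds up Lipschitz constants of the derivatives along the basis
  vectors.\<close>

lemma higher_differentiable_on_taylor:
  fixes F :: "'a::euclidean_space \<Rightarrow> 'b::euclidean_space"
  assumes F: "higher_differentiable_on (ball x \<epsilon>) F 2" and \<epsilon>: "0 < \<epsilon>"
  obtains K where "0 \<le> K"
    "\<And>y. norm (y - x) \<le> \<epsilon> / 2 \<Longrightarrow>
      norm (F y - F x - frechet_derivative F (at x) (y - x)) \<le> K * (norm (y - x))\<^sup>2"
proof -
  let ?D = "\<lambda>y. frechet_derivative F (at y)"
  have D: "(F has_derivative ?D y) (at y)" if "y \<in> cball x (\<epsilon> / 2)" for y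
    by (rule higher_differentiable_on_has_derivative[OF F]) (use that \<epsilon> in auto)
  have "higher_differentiable_on (ball x \<epsilon>) (\<lambda>y. ?D y b) 1" for b
    by (rule higher_differentiable_on_frechet) (use F in \<open>simp add: numeral_2_eq_2\<close>)
  then have "\<exists>L. L-lipschitz_on (cball x (\<epsilon> / 2)) (\<lambda>y. ?D y b)" for b
    using higher_differentiable_on_lipschitz[OF _ \<epsilon>] by metis
  then obtain L where L: "\<And>b. (L b)-lipschitz_on (cball x (\<epsilon> / 2)) (\<lambda>y. ?D y b)" by metis
  define K where "K = (\<Sum>b\<in>Basis. L b)"
  have K: "0 \<le> K" unfolding K_def using L lipschitz_on_nonneg by (intro sum_nonneg) blast
  have x_in: "x \<in> cball x (\<epsilon> / 2)" using \<epsilon> by simp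
  show ?thesis
  proof (rule that[OF K])
    fix y assume y: "norm (y - x) \<le> \<epsilon> / 2"
    define r where "r = norm (y - x)"
    have sub: "cball x r \<subseteq> cball x (\<epsilon> / 2)" using y by (auto simp: r_def)
    have der: "((\<lambda>z. F z - ?D x z) has_derivative (\<lambda>v. ?D z v - ?D x v)) (at z)" if "z \<in> cball x r" for z
      by (rule has_derivative_diff[OF D linear_imp_has_derivative[OF has_derivative_linear[OF D[OF x_in]]]])
         (use that sub in auto)
    have "norm ((F y - ?D x y) - (F x - ?D x x)) \<le> K * r * norm (y - x)"
    proof (rule differentiable_bound[OF convex_cball])
      show "((\<lambda>z. F z - ?D x z) has_derivative (\<lambda>v. ?D z v - ?D x v)) (at z within cball x r)"
        if "z \<in> cball x r" for z
        using der[OF that] by (rule has_derivative_at_withinI)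
      show "onorm (\<lambda>v. ?D z v - ?D x v) \<le> K * r" if z: "z \<in> cball x r" for z
      proof -
        have "onorm (\<lambda>v. ?D z v - ?D x v) \<le> (\<Sum>b\<in>Basis. norm (?D z b - ?D x b))"
          by (rule onorm_componentwise[OF has_derivative_bounded_linear[OF der[OF z]]])
        also have "\<dots> \<le> (\<Sum>b\<in>Basis. L b * r)"
        proof (rule sum_mono)
          fix b :: 'a
          have "norm (?D z b - ?D x b) \<le> L b * dist z x"
            using lipschitz_onD[OF L, of z x b] z sub x_in by (auto simp: dist_norm)
          also have "\<dots> \<le> L b * r"
            using z lipschitz_on_nonneg[OF L] by (intro mult_left_mono) (auto simp: dist_commute)
          finally show "norm (?D z b - ?D x b) \<le> L b * r" .
        qed
        also have "\<dots> = K * r" by (simp add: K_def sum_distrib_right)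
        finally show ?thesis .
      qed
    qed (auto simp: r_def dist_norm norm_minus_commute)
    moreover have "(F y - ?D x y) - (F x - ?D x x) = F y - F x - ?D x (y - x)"
      using linear_diff[OF has_derivative_linear[OF D[OF x_in]]] by simp
    ultimately show "norm (F y - F x - ?D x (y - x)) \<le> K * (norm (y - x))\<^sup>2"
      by (simp add: r_def power2_eq_square)
  qed
qed

lemma higher_differentiable_on_jacobian:
  fixes F :: "real^'n \<Rightarrow> real^'m"
  assumes S: "open S" and F: "higher_differentiable_on S F (Suc k)"
  shows "higher_differentiable_on S (\<lambda>x. jacobian F (at x)) k"
proof (rule higher_differentiable_on_componentwise[OF S])
  fix b :: "real^'n^'m" assume "b \<in> Basis"
  then obtain i j where b: "b = axis i (axis j 1)" by (auto simp: Basis_vec_def)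
  have "(\<lambda>x. jacobian F (at x) \<bullet> b) = (\<lambda>x. frechet_derivative F (at x) (axis j 1) \<bullet> axis i 1)"
    by (simp add: b inner_axis jacobian_def matrix_def)
  then show "higher_differentiable_on S (\<lambda>x. jacobian F (at x) \<bullet> b) k"
    using higher_differentiable_on_inner[OF S higher_differentiable_on_frechet[OF F] higher_differentiable_on_const]
    by metis
qed

section \<open>Inverse and implicit functions\<close>

text \<open>Higher smoothness comes by bootstrapping: the derivative of \<open>g\<close> at
  \<open>y\<close> is the inverse of the derivative of \<open>f\<close> at \<open>g y\<close>, so
  order \<open>j\<close> of \<open>g\<close> gives order \<open>j\<close> of its derivative, hence
  order \<open>Suc j\<close> of \<open>g\<close>.\<close>

lemma inverse_function_higher_differentiable:
  fixes f :: "'a::euclidean_space \<Rightarrow> 'a"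
  assumes U: "open U" and f: "higher_differentiable_on U f (Suc k)" and x0: "x0 \<in> U"
    and inj: "\<And>v. frechet_derivative f (at x0) v = 0 \<Longrightarrow> v = 0"
  obtains V W g where "open V" "V \<subseteq> U" "x0 \<in> V" "open W" "f x0 \<in> W" "homeomorphism V W f g"
    "higher_differentiable_on W g (Suc k)"
    "\<And>y. y \<in> W \<Longrightarrow> (g has_derivative inv (frechet_derivative f (at (g y)))) (at y)"
    "\<And>x. x \<in> V \<Longrightarrow> bij (frechet_derivative f (at x))"
proof -
  define f' where "f' = (\<lambda>x. Blinfun (frechet_derivative f (at x)))"
  have der: "(f has_derivative frechet_derivative f (at x)) (at x)" if "x \<in> U" for x
    using higher_differentiable_on_has_derivative[OF f _ that] by simp
  have f'_apply: "blinfun_apply (f' x) = frechet_derivative f (at x)" if "x \<in> U" for x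
    unfolding f'_def by (rule bounded_linear_Blinfun_apply[OF has_derivative_bounded_linear[OF der[OF that]]])
  have cont: "continuous_on U f'"
  proof (rule continuous_on_blinfun_componentwise)
    fix i :: 'a
    have "continuous_on U (\<lambda>x. frechet_derivative f (at x) i)"
      by (rule higher_differentiable_on_continuous_on[OF higher_differentiable_on_frechet[OF f]])
    then show "continuous_on U (\<lambda>x. blinfun_apply (f' x) i)"
      by (simp add: f'_apply cong: continuous_on_cong)
  qed
  have lin0: "linear (frechet_derivative f (at x0))" using der[OF x0] by (rule has_derivative_linear)
  have "inj (frechet_derivative f (at x0))"
    using inj linear_injective_0[OF lin0] by blast
  then obtain J where J: "linear J" "J \<circ> frechet_derivative f (at x0) = id"
    using linear_injective_left_inverse[OF lin0] by blast
  have invf: "Blinfun J o\<^sub>L f' x0 = id_blinfun"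
    using J(2) linear_conv_bounded_linear[THEN iffD1, OF J(1)]
    by (intro blinfun_eqI) (simp add: f'_apply[OF x0] bounded_linear_Blinfun_apply fun_eq_iff)
  have der': "(f has_derivative blinfun_apply (f' x)) (at x)" if "x \<in> U" for x
    using der[OF that] f'_apply[OF that] by simp
  obtain V W g g' where
    V: "open V" "V \<subseteq> U" "x0 \<in> V" and W: "open W" "f x0 \<in> W" and hom: "homeomorphism V W f g"
    and g': "\<And>y. y \<in> W \<Longrightarrow> (g has_derivative g' y) (at y)"
      "\<And>y. y \<in> W \<Longrightarrow> g' y = inv (blinfun_apply (f' (g y)))"
      "\<And>y. y \<in> W \<Longrightarrow> bij (blinfun_apply (f' (g y)))"
    by (rule inverse_function_theorem[OF U der' cont x0 invf]) blast+
  have gV: "g y \<in> V" if "y \<in> W" for y using hom that by (auto simp: homeomorphism_def)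
  have bij: "bij (frechet_derivative f (at x))" if "x \<in> V" for x
  proof -
    have "f x \<in> W" "g (f x) = x" using hom that by (auto simp: homeomorphism_def)
    then show ?thesis using g'(3)[of "f x"] f'_apply[of x] V(2) that by auto
  qed
  have lin: "linear (frechet_derivative f (at x))" if "x \<in> V" for x
    using der V(2) that by (auto intro: has_derivative_linear)
  have inv_lin: "linear (inv (frechet_derivative f (at x)))" if "x \<in> V" for x
    using bij[OF that] lin[OF that]
    by (metis bij_is_inj inj_linear_imp_inv_linear)
  have der_g: "(g has_derivative inv (frechet_derivative f (at (g y)))) (at y)" if "y \<in> W" for y
    using g'[OF that] f'_apply[of "g y"] gV[OF that] V(2) by auto
  have "higher_differentiable_on W g j" if "j \<le> Suc k" for j
    using that
  proof (induction j)
    case 0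
    then show ?case using hom by (simp add: homeomorphism_def)
  next
    case (Suc j)
    then have IH: "higher_differentiable_on W g j" and j: "j \<le> k" by auto
    show ?case
    proof (rule higher_differentiable_on_SucI[OF W(1) der_g])
      show "higher_differentiable_on W (\<lambda>y. inv (frechet_derivative f (at (g y))) v) j" for v
      proof (rule higher_differentiable_on_inverse_linear[where L="\<lambda>y. frechet_derivative f (at (g y))"])
        show "higher_differentiable_on W (\<lambda>y. frechet_derivative f (at (g y)) v) j" for v
        proof (rule higher_differentiable_on_compose[OF W(1) U IH])
          show "higher_differentiable_on U (\<lambda>x. frechet_derivative f (at x) v) j"
            by (rule higher_differentiable_on_le[OF higher_differentiable_on_frechet[OF f] j])
        qed (use gV V(2) in auto)
      qed (use gV lin inv_lin bij W(1) in
          \<open>auto simp: bij_is_inj bij_is_surj surj_f_inv_f\<close>)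
    qed
  qed
  from this[of "Suc k"] show ?thesis
    using that V W hom der_g bij by blast
qed

text \<open>The inverse function theorem for the map
  \<open>(x, z) \<mapsto> (x, \<Psi> (x, z))\<close>: its derivative is injective exactly when the
  partial derivative in \<open>z\<close> is, and its inverse along \<open>(x, 0)\<close> traces the
  solutions.\<close>

lemma implicit_function_higher_differentiable:
  fixes \<Psi> :: "'a::euclidean_space \<times> 'b::euclidean_space \<Rightarrow> 'b"
  assumes U: "open U" and \<Psi>: "higher_differentiable_on U \<Psi> (Suc k)"
    and z0: "(x0, z0) \<in> U" "\<Psi> (x0, z0) = 0"
    and inj: "\<And>\<zeta>. frechet_derivative \<Psi> (at (x0, z0)) (0, \<zeta>) = 0 \<Longrightarrow> \<zeta> = 0"
  obtains \<epsilon> Z where "\<epsilon> > 0" "higher_differentiable_on (ball x0 \<epsilon>) Z (Suc k)" "Z x0 = z0"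
    "\<And>x. x \<in> ball x0 \<epsilon> \<Longrightarrow> (x, Z x) \<in> U \<and> \<Psi> (x, Z x) = 0"
proof -
  define \<Theta> where "\<Theta> = (\<lambda>p. (fst p, \<Psi> p))"
  have \<Theta>: "higher_differentiable_on U \<Theta> (Suc k)"
    unfolding \<Theta>_def by (rule higher_differentiable_on_Pair[OF U higher_differentiable_on_linear[OF U linear_fst] \<Psi>])
  have "(\<Psi> has_derivative frechet_derivative \<Psi> (at (x0, z0))) (at (x0, z0))"
    by (rule higher_differentiable_on_has_derivative[OF \<Psi> _ z0(1)]) simp
  then have "(\<Theta> has_derivative (\<lambda>v. (fst v, frechet_derivative \<Psi> (at (x0, z0)) v))) (at (x0, z0))"
    unfolding \<Theta>_def by (auto intro!: derivative_eq_intros)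
  from frechet_derivative_at[OF this]
  have D\<Theta>: "frechet_derivative \<Theta> (at (x0, z0)) = (\<lambda>v. (fst v, frechet_derivative \<Psi> (at (x0, z0)) v))" by simp
  have "v = 0" if "frechet_derivative \<Theta> (at (x0, z0)) v = 0" for v
    using that inj[of "snd v"] by (cases v) (auto simp: D\<Theta> zero_prod_def)
  from inverse_function_higher_differentiable[OF U \<Theta> z0(1) this] obtain V W g where
    V: "V \<subseteq> U" "(x0, z0) \<in> V" and W: "open W" "\<Theta> (x0, z0) \<in> W"
    and hom: "homeomorphism V W \<Theta> g" and g: "higher_differentiable_on W g (Suc k)"
    by metis
  have Wx0: "(x0, 0) \<in> W" using W(2) z0(2) by (simp add: \<Theta>_def)
  have "open ((\<lambda>x. (x, 0 :: 'b)) -` W)"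
    by (rule open_vimage[OF W(1)]) (auto intro: continuous_intros)
  then obtain \<epsilon> where \<epsilon>: "\<epsilon> > 0" "ball x0 \<epsilon> \<subseteq> (\<lambda>x. (x, 0 :: 'b)) -` W"
    using Wx0 unfolding open_contains_ball by (metis (no_types, lifting) vimageI)
  define Z where "Z = (\<lambda>x. snd (g (x, 0)))"
  show ?thesis
  proof (rule that[OF \<epsilon>(1), of Z])
    show "higher_differentiable_on (ball x0 \<epsilon>) Z (Suc k)"
      unfolding Z_def
    proof (rule higher_differentiable_on_linear_comp[OF open_ball linear_snd],
        rule higher_differentiable_on_compose[OF open_ball W(1) _ g])
      show "higher_differentiable_on (ball x0 \<epsilon>) (\<lambda>x. (x, 0 :: 'b)) (Suc k)"
        by (rule higher_differentiable_on_linear[OF open_ball linear_Pair_fst])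
    qed (use \<epsilon> in auto)
    show "Z x0 = z0"
    proof -
      have "g (\<Theta> (x0, z0)) = (x0, z0)" using hom V(2) by (auto simp: homeomorphism_def)
      then show ?thesis by (simp add: \<Theta>_def Z_def z0(2))
    qed
    show "(x, Z x) \<in> U \<and> \<Psi> (x, Z x) = 0" if "x \<in> ball x0 \<epsilon>" for x
    proof -
      have "(x, 0) \<in> W" using \<epsilon>(2) that by auto
      then have 1: "g (x, 0) \<in> V" "\<Theta> (g (x, 0)) = (x, 0)" using hom by (auto simp: homeomorphism_def)
      then have "g (x, 0) = (x, Z x)" by (auto simp: \<Theta>_def Z_def prod_eq_iff)
      then show ?thesis using 1 V(1) by (auto simp: \<Theta>_def)
    qed
  qed
qed

section \<open>Subgradients of weakly convex functions\<close>

lemma epi_iff: "(x, t) \<in> epi \<phi> \<longleftrightarrow> \<phi> x \<le> ereal t"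
  by (simp add: epi_def)

lemma norm_sq_convex_combination:
  fixes x y c :: "'a::real_inner"
  shows "(norm ((1 - l) *\<^sub>R x + l *\<^sub>R y - c))\<^sup>2
    = (1 - l) * (norm (x - c))\<^sup>2 + l * (norm (y - c))\<^sup>2 - l * (1 - l) * (norm (x - y))\<^sup>2"
  unfolding power2_norm_eq_inner
  by (simp add: inner_add inner_diff algebra_simps inner_commute power2_eq_square)

lemma weighted_sum_add_square:
  fixes k :: real and x y :: "'a::real_inner"
  shows "(1 - l) * (s + k * (norm x)\<^sup>2) + l * (t + k * (norm y)\<^sup>2)
    = (1 - l) * s + l * t + k * (l * (1 - l) * (norm (x - y))\<^sup>2) + k * (norm ((1 - l) *\<^sub>R x + l *\<^sub>R y))\<^sup>2"
  unfolding norm_sq_convex_combination[of l x y 0, unfolded diff_zero] by (simp add: algebra_simps)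

text \<open>The shear \<open>(z, r) \<mapsto> (z, r + \<sigma> / 2 * (norm z)\<^sup>2)\<close>
  carries the epigraph into a convex one; undoing it leaves the defect
  \<open>\<sigma> / 2 * (l * (1 - l) * (norm (x - y))\<^sup>2)\<close>. Working with points of the
  epigraph keeps all arithmetic real.\<close>

lemma weakly_convex_epi:
  assumes wc: "weakly_convex \<sigma> \<phi>" and x: "(x, s) \<in> epi \<phi>" and y: "(y, t) \<in> epi \<phi>"
    and l: "0 \<le> l" "l \<le> 1"
  shows "((1 - l) *\<^sub>R x + l *\<^sub>R y, (1 - l) * s + l * t + \<sigma> / 2 * (l * (1 - l) * (norm (x - y))\<^sup>2)) \<in> epi \<phi>"
proof -
  let ?e = "epi (\<lambda>x. \<phi> x + ereal (\<sigma> / 2 * (norm x)\<^sup>2))"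
  have shift: "(z, r + \<sigma> / 2 * (norm z)\<^sup>2) \<in> ?e \<longleftrightarrow> (z, r) \<in> epi \<phi>" for z r
    by (cases "\<phi> z") (auto simp: epi_iff)
  have "convex ?e" using wc by (simp add: weakly_convex_def convex_fun_def)
  from convexD_alt[OF this shift[THEN iffD2, OF x] shift[THEN iffD2, OF y] l]
  have "((1 - l) *\<^sub>R x + l *\<^sub>R y, (1 - l) * (s + \<sigma> / 2 * (norm x)\<^sup>2) + l * (t + \<sigma> / 2 * (norm y)\<^sup>2)) \<in> ?e"
    by simp
  moreover have "(1 - l) * (s + \<sigma> / 2 * (norm x)\<^sup>2) + l * (t + \<sigma> / 2 * (norm y)\<^sup>2)
     = ((1 - l) * s + l * t + \<sigma> / 2 * (l * (1 - l) * (norm (x - y))\<^sup>2))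
       + \<sigma> / 2 * (norm ((1 - l) *\<^sub>R x + l *\<^sub>R y))\<^sup>2"
    by (rule weighted_sum_add_square)
  ultimately show ?thesis by (simp only: shift)
qed

text \<open>Normality is an infinitesimal condition at \<open>x\<close>. Weak convexity makes it
  global: the epigraph contains a slightly bent chord from \<open>(x, \<phi> x)\<close> to
  \<open>(y, t)\<close>, and the normal cone inequality along this chord, divided by the parameter,
  passes to the limit.\<close>

lemma subdiff_lower_bound:
  assumes wc: "weakly_convex \<sigma> \<phi>" and \<nu>: "\<nu> \<in> subdiff \<phi> x" and y: "(y, t) \<in> epi \<phi>"
  shows "real_of_ereal (\<phi> x) + \<nu> \<bullet> (y - x) - \<sigma> / 2 * (norm (y - x))\<^sup>2 \<le> t"
proof (cases "y = x")
  case True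
  have "\<bar>\<phi> x\<bar> \<noteq> \<infinity>" using \<nu> by (simp add: subdiff_def)
  with y True show ?thesis by (cases "\<phi> x") (auto simp: epi_iff)
next
  case False
  define c where "c = real_of_ereal (\<phi> x)"
  have fin: "\<phi> x = ereal c" using \<nu> unfolding c_def subdiff_def by (cases "\<phi> x") auto
  define D where "D = (norm (y - x))\<^sup>2"
  \<comment> \<open>\<open>p\<close> is the bent chord; \<open>A l\<close> and \<open>B l\<close>
    are numerator and denominator of the normal cone quotient at \<open>p l\<close>, both divided by
    \<open>l\<close>.\<close>
  define A where "A = (\<lambda>l. \<nu> \<bullet> (y - x) - (t - c + \<sigma> / 2 * (1 - l) * D))"
  define B where "B = (\<lambda>l. norm (y - x, t - c + \<sigma> / 2 * (1 - l) * D))"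
  define p where "p = (\<lambda>l. (x, c) + l *\<^sub>R (y - x, t - c + \<sigma> / 2 * (1 - l) * D))"
  have p_epi: "p l \<in> epi \<phi>" if "0 < l" "l < 1" for l
  proof -
    have "((1 - l) *\<^sub>R x + l *\<^sub>R y, (1 - l) * c + l * t + \<sigma> / 2 * (l * (1 - l) * (norm (x - y))\<^sup>2)) \<in> epi \<phi>"
      by (rule weakly_convex_epi[OF wc _ y]) (use that fin in \<open>auto simp: epi_iff\<close>)
    also have "((1 - l) *\<^sub>R x + l *\<^sub>R y, (1 - l) * c + l * t + \<sigma> / 2 * (l * (1 - l) * (norm (x - y))\<^sup>2)) = p l"
      by (simp add: p_def D_def field_simps norm_minus_commute)
    finally show ?thesis .
  qed
  have "Limsup (at (x, c) within epi \<phi>) (\<lambda>z. ereal (((\<nu>, -1) \<bullet> (z - (x, c))) / norm (z - (x, c)))) \<le> 0"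
    using \<nu> by (simp add: subdiff_def regular_normal_cone_def c_def)
  then have ev: "\<forall>\<^sub>F z in at (x, c) within epi \<phi>. ((\<nu>, -1) \<bullet> (z - (x, c))) / norm (z - (x, c)) < e" if "e > 0" for e
  proof -
    have "\<forall>\<^sub>F z in at (x, c) within epi \<phi>. ereal (((\<nu>, -1) \<bullet> (z - (x, c))) / norm (z - (x, c))) < ereal e"
      by (rule Limsup_lessD) (use \<open>Limsup _ _ \<le> 0\<close> that in \<open>auto intro: le_less_trans\<close>)
    then show ?thesis by simp
  qed
  have "(p \<longlongrightarrow> (x, c) + 0 *\<^sub>R (y - x, t - c + \<sigma> / 2 * (1 - 0) * D)) (at_right 0)"
    unfolding p_def by (intro tendsto_intros)
  then have p_lim: "(p \<longlongrightarrow> (x, c)) (at_right 0)" by (simp add: zero_prod_def)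
  have small: "\<forall>\<^sub>F l::real in at_right 0. 0 < l \<and> l < 1"
    by (intro eventually_conj eventually_at_right_less order_tendstoD(2)[OF tendsto_ident_at]) simp
  have p_flim: "filterlim p (at (x, c) within epi \<phi>) (at_right 0)"
  proof (rule filterlim_at[THEN iffD2])
    show "(\<forall>\<^sub>F l in at_right 0. p l \<in> epi \<phi> \<and> p l \<noteq> (x, c)) \<and> (p \<longlongrightarrow> (x, c)) (at_right 0)"
      using small p_lim by (auto elim!: eventually_mono simp: p_epi) (auto simp: p_def False)
  qed
  have le: "A 0 \<le> e * B 0" if "e > 0" for e
  proof (rule tendsto_le[OF trivial_limit_at_right_real])
    have "((\<lambda>l. e * norm (y - x, t - c + \<sigma> / 2 * (1 - l) * D)) \<longlongrightarrow> e * norm (y - x, t - c + \<sigma> / 2 * (1 - 0) * D)) (at_right 0)"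
      by (intro tendsto_intros)
    then show "((\<lambda>l. e * B l) \<longlongrightarrow> e * B 0) (at_right 0)" by (simp add: B_def)
    have "(A \<longlongrightarrow> \<nu> \<bullet> (y - x) - (t - c + \<sigma> / 2 * (1 - 0) * D)) (at_right 0)"
      unfolding A_def by (intro tendsto_intros)
    then show "(A \<longlongrightarrow> A 0) (at_right 0)" by (simp add: A_def)
    show "\<forall>\<^sub>F l in at_right 0. A l \<le> e * B l"
      using filterlim_iff[THEN iffD1, OF p_flim, rule_format, OF ev[OF that]] small
    proof eventually_elim
      case (elim l)
      have B: "B l > 0" using False by (simp add: B_def zero_prod_def)
      have "(\<nu>, - 1) \<bullet> (p l - (x, c)) = l * A l" "norm (p l - (x, c)) = l * B l"
        using elim(2) unfolding p_def add_diff_cancel_left' inner_scaleR_right norm_scaleR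
        by (simp_all add: A_def B_def)
      with elim B have "A l < e * B l" by (simp add: divide_less_eq)
      then show ?case by simp
    qed
  qed
  have "A 0 \<le> 0"
  proof (rule ccontr)
    assume n: "\<not> A 0 \<le> 0"
    have B: "B 0 > 0" using False by (simp add: B_def zero_prod_def)
    from le[of "A 0 / (2 * B 0)"] n B show False by simp
  qed
  then show ?thesis by (simp add: A_def c_def D_def)
qed

text \<open>A quadratic error is negligible against the distance to the base point, so a quadratic
  minorant touching \<open>\<phi>\<close> at \<open>x\<close> yields a regular normal. The constant
  may exceed the modulus of weak convexity, which is convenient for producing subgradients.\<close>

lemma subdiffI:
  assumes \<sigma>: "0 \<le> \<sigma>" and fin: "\<bar>\<phi> x\<bar> \<noteq> \<infinity>"
    and le: "\<And>y t. (y, t) \<in> epi \<phi> \<Longrightarrow> real_of_ereal (\<phi> x) + \<nu> \<bullet> (y - x) - \<sigma> / 2 * (norm (y - x))\<^sup>2 \<le> t"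
  shows "\<nu> \<in> subdiff \<phi> x"
proof -
  define c where "c = real_of_ereal (\<phi> x)"
  have c: "\<phi> x = ereal c" using fin unfolding c_def by (cases "\<phi> x") auto
  have "Limsup (at (x, c) within epi \<phi>) (\<lambda>z. ereal (((\<nu>, -1) \<bullet> (z - (x, c))) / norm (z - (x, c)))) \<le> 0"
  proof (rule ereal_le_epsilon2)
    fix e :: real assume e: "e > 0"
    \<comment> \<open>The summand \<open>1\<close> keeps the divisor positive when
      \<open>\<sigma> = 0\<close>, and \<open>\<sigma> * d \<le> e\<close> still holds.\<close>
    define d where "d = e / (\<sigma> + 1)"
    have d: "d > 0" "\<sigma> * d \<le> e" using e \<sigma> by (auto simp: d_def field_simps)
    have "Limsup (at (x, c) within epi \<phi>) (\<lambda>z. ereal (((\<nu>, -1) \<bullet> (z - (x, c))) / norm (z - (x, c)))) \<le> ereal e"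
    proof (rule Limsup_bounded)
      show "\<forall>\<^sub>F z in at (x, c) within epi \<phi>. ereal (((\<nu>, -1) \<bullet> (z - (x, c))) / norm (z - (x, c))) \<le> ereal e"
        unfolding eventually_at
      proof (intro exI[of _ d] conjI ballI impI d(1))
        fix z assume z: "z \<in> epi \<phi>" "z \<noteq> (x, c) \<and> dist z (x, c) < d"
        obtain y t where [simp]: "z = (y, t)" by (cases z)
        define N where "N = norm (z - (x, c))"
        have N: "0 < N" "N < d" using z by (auto simp: N_def dist_norm zero_prod_def)
        have yN: "norm (y - x) \<le> N" using norm_fst_le[of "y - x" "t - c"] by (simp add: N_def)
        have "(\<nu>, -1) \<bullet> (z - (x, c)) \<le> \<sigma> / 2 * (norm (y - x))\<^sup>2"
          using le[of y t] z(1) by (simp add: c_def)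
        also have "\<dots> \<le> \<sigma> / 2 * N\<^sup>2"
          using \<sigma> yN by (intro mult_left_mono power_mono) auto
        also have "\<dots> \<le> e * N"
        proof -
          have "\<sigma> / 2 * N \<le> \<sigma> * d"
            using \<sigma> N by (intro mult_mono) auto
          then have "\<sigma> / 2 * N \<le> e" using d(2) by linarith
          then have "\<sigma> / 2 * N * N \<le> e * N" using N by (intro mult_right_mono) auto
          then show ?thesis by (simp add: power2_eq_square)
        qed
        finally have "((\<nu>, -1) \<bullet> (z - (x, c))) / N \<le> e"
          using N(1) by (simp only: pos_divide_le_eq)
        then show "ereal (((\<nu>, -1) \<bullet> (z - (x, c))) / norm (z - (x, c))) \<le> ereal e"
          by (simp only: N_def ereal_less_eq)
      qed
    qed
    then show "Limsup (at (x, c) within epi \<phi>) (\<lambda>z. ereal (((\<nu>, -1) \<bullet> (z - (x, c))) / norm (z - (x, c)))) \<le> 0 + ereal e"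
      by simp
  qed
  then show ?thesis
    using fin c by (simp add: subdiff_def regular_normal_cone_def c_def[symmetric] epi_iff)
qed

lemma subdiff_iff:
  assumes "0 \<le> \<sigma>" "weakly_convex \<sigma> \<phi>"
  shows "\<nu> \<in> subdiff \<phi> x \<longleftrightarrow> \<bar>\<phi> x\<bar> \<noteq> \<infinity> \<and>
    (\<forall>y t. (y, t) \<in> epi \<phi> \<longrightarrow> real_of_ereal (\<phi> x) + \<nu> \<bullet> (y - x) - \<sigma> / 2 * (norm (y - x))\<^sup>2 \<le> t)"
proof
  assume \<nu>: "\<nu> \<in> subdiff \<phi> x"
  then have "\<bar>\<phi> x\<bar> \<noteq> \<infinity>" by (simp add: subdiff_def)
  then show "\<bar>\<phi> x\<bar> \<noteq> \<infinity> \<and>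
    (\<forall>y t. (y, t) \<in> epi \<phi> \<longrightarrow> real_of_ereal (\<phi> x) + \<nu> \<bullet> (y - x) - \<sigma> / 2 * (norm (y - x))\<^sup>2 \<le> t)"
    using subdiff_lower_bound[OF assms(2) \<nu>] by blast
next
  assume *: "\<bar>\<phi> x\<bar> \<noteq> \<infinity> \<and>
    (\<forall>y t. (y, t) \<in> epi \<phi> \<longrightarrow> real_of_ereal (\<phi> x) + \<nu> \<bullet> (y - x) - \<sigma> / 2 * (norm (y - x))\<^sup>2 \<le> t)"
  show "\<nu> \<in> subdiff \<phi> x"
    using *[THEN conjunct1] *[THEN conjunct2, rule_format] by (rule subdiffI[OF assms(1)])
qed

lemma convex_subdiff:
  assumes "0 \<le> \<sigma>" "weakly_convex \<sigma> \<phi>"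
  shows "convex (subdiff \<phi> x)"
proof (rule convexI)
  fix \<nu> \<mu> and u v :: real
  assume \<nu>: "\<nu> \<in> subdiff \<phi> x" "\<mu> \<in> subdiff \<phi> x" and uv: "0 \<le> u" "0 \<le> v" "u + v = 1"
  show "u *\<^sub>R \<nu> + v *\<^sub>R \<mu> \<in> subdiff \<phi> x"
  proof (rule subdiffI[OF assms(1)])
    show "\<bar>\<phi> x\<bar> \<noteq> \<infinity>" using \<nu> by (simp add: subdiff_def)
    fix y t assume y: "(y, t) \<in> epi \<phi>"
    let ?r = "real_of_ereal (\<phi> x) - \<sigma> / 2 * (norm (y - x))\<^sup>2"
    have "u * (?r + \<nu> \<bullet> (y - x)) + v * (?r + \<mu> \<bullet> (y - x)) \<le> u * t + v * t"
      using subdiff_lower_bound[OF assms(2) \<nu>(1) y] subdiff_lower_bound[OF assms(2) \<nu>(2) y] uv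
      by (intro add_mono mult_left_mono) auto
    also have "u * t + v * t = t" using uv by (simp add: distrib_right[symmetric])
    also have "u * (?r + \<nu> \<bullet> (y - x)) + v * (?r + \<mu> \<bullet> (y - x))
       = (u + v) * ?r + (u *\<^sub>R \<nu> + v *\<^sub>R \<mu>) \<bullet> (y - x)"
      by (simp add: inner_add_left algebra_simps)
    finally show "real_of_ereal (\<phi> x) + (u *\<^sub>R \<nu> + v *\<^sub>R \<mu>) \<bullet> (y - x) - \<sigma> / 2 * (norm (y - x))\<^sup>2 \<le> t"
      using uv by simp
  qed
qed

lemma closed_subdiff:
  assumes "0 \<le> \<sigma>" "weakly_convex \<sigma> \<phi>"
  shows "closed (subdiff \<phi> x)"
proof (cases "\<bar>\<phi> x\<bar> = \<infinity>")
  case True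
  then show ?thesis by (simp add: subdiff_def)
next
  case False
  then have "subdiff \<phi> x = (\<Inter>p\<in>epi \<phi>. {\<nu>. \<nu> \<bullet> (fst p - x) \<le> snd p - real_of_ereal (\<phi> x) + \<sigma> / 2 * (norm (fst p - x))\<^sup>2})"
    by (fastforce simp: set_eq_iff subdiff_iff[OF assms])
  then show ?thesis
    by (auto intro!: closed_INT closed_Collect_le continuous_intros)
qed

text \<open>The two quadratic minorants are evaluated at each other's base point and added. This is
  the only source of the curvature bounds below.\<close>

lemma subdiff_hypomonotone:
  assumes wc: "weakly_convex \<sigma> \<phi>" and \<nu>: "\<nu> \<in> subdiff \<phi> x" and \<mu>: "\<mu> \<in> subdiff \<phi> y"
  shows "- \<sigma> * (norm (x - y))\<^sup>2 \<le> (\<nu> - \<mu>) \<bullet> (x - y)"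
proof -
  have fin: "(x, real_of_ereal (\<phi> x)) \<in> epi \<phi>" "(y, real_of_ereal (\<phi> y)) \<in> epi \<phi>"
    using \<nu> \<mu> by (auto simp: subdiff_def epi_iff ereal_real)
  from subdiff_lower_bound[OF wc \<nu> fin(2)] subdiff_lower_bound[OF wc \<mu> fin(1)]
  show ?thesis by (simp add: inner_diff algebra_simps norm_minus_commute)
qed

text \<open>One half of the duality between subderivative and subdifferential. If
  \<open>(u, a)\<close> lay outside the closed cone of directions into the convexified epigraph, a
  separating hyperplane would give a subgradient whose value at \<open>u\<close> differs from
  \<open>a\<close>. Hence the cone contains points arbitrarily close to \<open>(u, a)\<close>, and
  these bound the difference quotients.\<close>

lemma subderivative_le:
  assumes \<sigma>: "0 \<le> \<sigma>" and wc: "weakly_convex \<sigma> \<phi>" and ne: "subdiff \<phi> x \<noteq> {}"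
    and const: "\<And>\<nu>. \<nu> \<in> subdiff \<phi> x \<Longrightarrow> \<nu> \<bullet> u = a"
  shows "subderivative \<phi> x u \<le> ereal a"
proof (rule ccontr)
  assume n: "\<not> subderivative \<phi> x u \<le> ereal a"
  obtain \<nu>0 where \<nu>0: "\<nu>0 \<in> subdiff \<phi> x" using ne by auto
  define c where "c = real_of_ereal (\<phi> x)"
  have c: "\<phi> x = ereal c" using \<nu>0 unfolding c_def subdiff_def by (cases "\<phi> x") auto
  \<comment> \<open>The epigraph shifted to the origin and sheared by the quadratic: it is convex,
    and subgradients of \<open>\<phi>\<close> become linear minorants through the origin.\<close>
  define K0 where "K0 = (\<lambda>(y, t). (y - x, t - c + \<sigma> / 2 * (norm (y - x))\<^sup>2)) ` epi \<phi>"
  have K0_iff: "(d, \<tau>) \<in> K0 \<longleftrightarrow> (x + d, \<tau> + c - \<sigma> / 2 * (norm d)\<^sup>2) \<in> epi \<phi>" for d \<tau>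
    unfolding K0_def by (force simp: image_iff)
  have subdiff_K0: "\<nu> \<in> subdiff \<phi> x \<longleftrightarrow> (\<forall>d \<tau>. (d, \<tau>) \<in> K0 \<longrightarrow> \<nu> \<bullet> d \<le> \<tau>)" for \<nu>
    unfolding subdiff_iff[OF \<sigma> wc] K0_def by (fastforce simp: c)
  have convK0: "convex K0"
    unfolding convex_alt
  proof (intro ballI allI impI)
    fix p q :: "'a \<times> real" and l :: real assume pq: "p \<in> K0" "q \<in> K0" and l: "0 \<le> l \<and> l \<le> 1"
    obtain d1 t1 d2 t2 where [simp]: "p = (d1, t1)" "q = (d2, t2)" by (cases p, cases q)
    have comb: "(1 - l) *\<^sub>R (x + d1) + l *\<^sub>R (x + d2) = x + ((1 - l) *\<^sub>R d1 + l *\<^sub>R d2)"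
      by (simp add: algebra_simps)
    have "(x + ((1 - l) *\<^sub>R d1 + l *\<^sub>R d2),
      (1 - l) * (t1 + c - \<sigma> / 2 * (norm d1)\<^sup>2) + l * (t2 + c - \<sigma> / 2 * (norm d2)\<^sup>2)
        + \<sigma> / 2 * (l * (1 - l) * (norm (x + d1 - (x + d2)))\<^sup>2)) \<in> epi \<phi>"
      using weakly_convex_epi[OF wc, of "x + d1" _ "x + d2" _ l] pq l unfolding comb
      by (auto simp: K0_iff)
    also have "(1 - l) * (t1 + c - \<sigma> / 2 * (norm d1)\<^sup>2) + l * (t2 + c - \<sigma> / 2 * (norm d2)\<^sup>2)
        + \<sigma> / 2 * (l * (1 - l) * (norm (x + d1 - (x + d2)))\<^sup>2)
        = ((1 - l) * t1 + l * t2) + c - \<sigma> / 2 * (norm ((1 - l) *\<^sub>R d1 + l *\<^sub>R d2))\<^sup>2"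
      using weighted_sum_add_square[of l "t1 + c - \<sigma> / 2 * (norm d1)\<^sup>2" "\<sigma> / 2" d1 "t2 + c - \<sigma> / 2 * (norm d2)\<^sup>2" d2]
      by (simp add: algebra_simps)
    finally show "(1 - l) *\<^sub>R p + l *\<^sub>R q \<in> K0" by (simp add: K0_iff)
  qed
  define K where "K = closure (cone hull K0)"
  have K00: "(0, 0) \<in> K0" "(0, 1) \<in> K0" by (auto simp: K0_iff epi_iff c)
  have K: "closed K" "convex K" unfolding K_def
    by (auto intro: convex_closure convex_cone_hull convK0)
  have K_scale: "r *\<^sub>R k \<in> K" if "k \<in> K0" "r \<ge> 0" for k r
    unfolding K_def using that by (auto intro!: closure_subset[THEN subsetD] mem_cone_hull)
  have "(u, a) \<in> K"
  proof (rule ccontr)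
    assume "(u, a) \<notin> K"
    from separating_hyperplane_closed_point[OF K(2,1) this] obtain pq b where
      sep: "pq \<bullet> (u, a) < b" "\<And>k. k \<in> K \<Longrightarrow> b < pq \<bullet> k" by blast
    obtain p q where [simp]: "pq = (p, q)" by (cases pq)
    have b: "b < 0" using sep(2)[OF K_scale[OF K00(1), of 0]] by (simp add: zero_prod_def[symmetric])
    \<comment> \<open>Otherwise a positive multiple of \<open>k\<close> would reach the value
      \<open>b\<close> exactly, although all of the cone lies strictly above
      \<open>b\<close>.\<close>
    have pos: "pq \<bullet> k \<ge> 0" if k: "k \<in> K0" for k
    proof (rule ccontr)
      assume neg: "\<not> pq \<bullet> k \<ge> 0"
      have "b < pq \<bullet> ((b / (pq \<bullet> k)) *\<^sub>R k)"
        using b neg by (intro sep(2) K_scale k) (auto simp: divide_nonpos_neg)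
      also have "\<dots> = b" unfolding inner_scaleR_right using neg by (simp del: \<open>pq = (p, q)\<close>)
      finally show False by simp
    qed
    have q: "q \<ge> 0" using pos[OF K00(2)] by simp
    show False
    proof (cases "q = 0")
      case True
      \<comment> \<open>A vertical hyperplane supplies a direction along which the subdifferential
        recedes: subtracting \<open>p\<close> from a subgradient gives another one, so constancy
        forces \<open>p \<bullet> u = 0\<close>.\<close>
      have "\<nu>0 - p \<in> subdiff \<phi> x"
        unfolding subdiff_K0
      proof (intro allI impI)
        fix d \<tau> assume d: "(d, \<tau>) \<in> K0"
        then have "\<nu>0 \<bullet> d \<le> \<tau>" using \<nu>0 subdiff_K0 by blast
        with pos[OF d] True show "(\<nu>0 - p) \<bullet> d \<le> \<tau>" by (simp add: inner_diff_left)
      qed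
      with const[of "\<nu>0 - p"] const[OF \<nu>0] have "p \<bullet> u = 0" by (simp add: inner_diff_left)
      with sep(1) b True show False by simp
    next
      case False
      with q have q: "q > 0" by simp
      have "- (p /\<^sub>R q) \<in> subdiff \<phi> x"
        unfolding subdiff_K0
      proof (intro allI impI)
        fix d \<tau> assume d: "(d, \<tau>) \<in> K0"
        show "- (p /\<^sub>R q) \<bullet> d \<le> \<tau>" using pos[OF d] q by (simp add: field_simps)
      qed
      from const[OF this] q have "p \<bullet> u + q * a = 0" by (simp add: field_simps)
      with sep(1) b show False by simp
    qed
  qed
  obtain C where C: "ereal a < ereal C" "ereal C < subderivative \<phi> x u"
    using n ereal_dense2[of "ereal a" "subderivative \<phi> x u"] by (auto simp: not_le)
  have "\<forall>\<^sub>F z in at_right 0 \<times>\<^sub>F nhds u. ereal C < (case z of (\<tau>, \<nu>) \<Rightarrow> (\<phi> (x + \<tau> *\<^sub>R \<nu>) - \<phi> x) / ereal \<tau>)"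
    using C(2) unfolding subderivative_def by (rule less_LiminfD)
  then obtain P Q where P: "\<forall>\<^sub>F \<tau> in at_right (0::real). P \<tau>" and Q: "\<forall>\<^sub>F \<nu> in nhds u. Q \<nu>"
    and PQ: "\<And>\<tau> \<nu>. P \<tau> \<Longrightarrow> Q \<nu> \<Longrightarrow> ereal C < (\<phi> (x + \<tau> *\<^sub>R \<nu>) - \<phi> x) / ereal \<tau>"
    unfolding eventually_prod_filter by auto
  obtain \<delta> where \<delta>: "\<delta> > 0" "\<And>\<nu>. dist \<nu> u < \<delta> \<Longrightarrow> Q \<nu>"
    using Q by (auto simp: eventually_nhds_metric)
  \<comment> \<open>The second bound \<open>C - a\<close> makes the slope \<open>r * \<tau>'\<close>
    of the approximating ray smaller than \<open>C\<close>.\<close>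
  obtain k where k: "k \<in> cone hull K0" "dist k (u, a) < min \<delta> (C - a)"
    using \<open>(u, a) \<in> K\<close> \<delta>(1) C(1) unfolding K_def closure_approachable
    by (metis diff_gt_0_iff_gt ereal_less_eq(3) less_ereal.simps(1) min_less_iff_conj)
  obtain r d \<tau>' where r: "r \<ge> 0" "(d, \<tau>') \<in> K0" "k = (r *\<^sub>R d, r * \<tau>')"
    using k(1) unfolding cone_hull_expl by auto
  have near: "dist (r *\<^sub>R d) u < \<delta>" "r * \<tau>' < C"
    using k(2) dist_fst_le[of k "(u, a)"] dist_snd_le[of k "(u, a)"] by (auto simp: r(3) dist_real_def)
  have "((\<lambda>\<tau>. \<tau> * r) \<longlongrightarrow> 0 * r) (at_right 0)" by (intro tendsto_intros)
  then have "\<forall>\<^sub>F \<tau> in at_right (0::real). \<tau> * r < 1"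
    by (rule order_tendstoD(2)) simp
  then have "\<forall>\<^sub>F \<tau> in at_right (0::real). P \<tau> \<and> 0 < \<tau> \<and> \<tau> * r < 1"
    using P eventually_at_right_less[of 0] by eventually_elim auto
  then obtain \<tau> where \<tau>: "P \<tau>" "0 < \<tau>" "\<tau> * r < 1"
    using eventually_happens'[OF trivial_limit_at_right_real] by blast
  \<comment> \<open>The point at parameter \<open>\<tau>\<close> on the ray divides the segment from
    \<open>x\<close> to \<open>x + d\<close> in ratio \<open>\<tau> * r\<close>; this is why
    \<open>\<tau>\<close> was taken with \<open>\<tau> * r < 1\<close>.\<close>
  let ?l = "\<tau> * r"
  have "((1 - ?l) *\<^sub>R x + ?l *\<^sub>R (x + d),
     (1 - ?l) * c + ?l * (\<tau>' + c - \<sigma> / 2 * (norm d)\<^sup>2) + \<sigma> / 2 * (?l * (1 - ?l) * (norm (x - (x + d)))\<^sup>2)) \<in> epi \<phi>"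
    by (rule weakly_convex_epi[OF wc]) (use r(1,2) \<tau> in \<open>auto simp: K0_iff epi_iff c\<close>)
  then have "\<phi> (x + \<tau> *\<^sub>R (r *\<^sub>R d)) \<le> ereal (c + ?l * \<tau>' - \<sigma> / 2 * ?l\<^sup>2 * (norm d)\<^sup>2)"
    by (simp add: epi_iff algebra_simps power2_eq_square)
  also have "\<dots> \<le> ereal (c + \<tau> * (r * \<tau>'))" using \<sigma> by simp
  finally have "(\<phi> (x + \<tau> *\<^sub>R (r *\<^sub>R d)) - \<phi> x) / ereal \<tau> \<le> ereal (r * \<tau>')"
    using \<tau>(2) unfolding c by (cases "\<phi> (x + \<tau> *\<^sub>R (r *\<^sub>R d))") (auto simp: field_simps)
  then have "ereal C < ereal (r * \<tau>')"
    by (rule less_le_trans[OF PQ[OF \<tau>(1) \<delta>(2)[OF near(1)]]])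
  then show False using near(2) by simp
qed

lemma clarke_subdiff_eq_subdiff: "regular_at \<phi> x \<Longrightarrow> clarke_subdiff \<phi> x = subdiff \<phi> x"
  by (simp add: regular_at_def clarke_subdiff_def subdiff_def Let_def)

lemma weakly_convex_0_convex_on:
  fixes f :: "'a::euclidean_space \<Rightarrow> real"
  assumes "convex_on UNIV f"
  shows "weakly_convex 0 (\<lambda>x. ereal (f x))"
  unfolding weakly_convex_def convex_fun_def
proof (rule convexI)
  fix p q :: "'a \<times> real" and u v :: real
  assume pq: "p \<in> epi (\<lambda>x. ereal (f x) + ereal (0 / 2 * (norm x)\<^sup>2))"
    "q \<in> epi (\<lambda>x. ereal (f x) + ereal (0 / 2 * (norm x)\<^sup>2))" and uv: "0 \<le> u" "0 \<le> v" "u + v = 1"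
  have "f (u *\<^sub>R fst p + v *\<^sub>R fst q) \<le> u * f (fst p) + v * f (fst q)"
    using convex_onD[OF assms, of v "fst p" "fst q"] uv by (simp add: eq_diff_eq[symmetric])
  also have "\<dots> \<le> u * snd p + v * snd q"
    using pq uv by (intro add_mono mult_left_mono) (auto simp: epi_def)
  finally show "u *\<^sub>R p + v *\<^sub>R q \<in> epi (\<lambda>x. ereal (f x) + ereal (0 / 2 * (norm x)\<^sup>2))"
    by (cases p, cases q) (simp add: epi_iff)
qed

section \<open>Active manifolds\<close>

text \<open>The \<open>n - r\<close> equations of a manifold are merged into one map \<open>G\<close> into the whole space, with
  values in the normal space, so that no type of dimension \<open>n - r\<close> is needed; \<open>P\<close> is the
  orthogonal projection onto the tangent space \<open>T\<close>.\<close>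

locale manifold_equation =
  fixes p :: nat and M T :: "'a::euclidean_space set" and x :: 'a and G P :: "'a \<Rightarrow> 'a" and \<epsilon> :: real
  assumes p: "1 \<le> p"
    and T: "subspace T"
    and G_smooth: "higher_differentiable_on UNIV G p"
    and G_normal: "\<And>y t. t \<in> T \<Longrightarrow> G y \<bullet> t = 0"
    and P_linear: "linear P"
    and P_tangent: "\<And>z. P z \<in> T"
    and P_eq_0: "\<And>z. P z = 0 \<longleftrightarrow> (\<forall>t\<in>T. z \<bullet> t = 0)"
    and \<epsilon>: "0 < \<epsilon>"
    and M_eq: "\<And>y. y \<in> ball x \<epsilon> \<Longrightarrow> y \<in> M \<longleftrightarrow> G y = 0"
    and x_M: "x \<in> M"
    and T_eq: "T = {v. frechet_derivative G (at x) v = 0}"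

lemma manifold_equation_exists:
  assumes "smooth_manifold_at p r M x" and p: "1 \<le> p"
  obtains G P \<epsilon> where "manifold_equation p M (tangent_space p M x) x G P \<epsilon>"
proof -
  let ?K = "\<lambda>r G. {v. \<forall>i < DIM('a) - r. frechet_derivative (G i) (at x) v = 0}"
  have "\<exists>T r G. local_equations p r M x G \<and> T = ?K r G"
    using assms by (auto simp: smooth_manifold_at_def)
  \<comment> \<open>\<open>tangent_space\<close> is a choice. From here on the equations are those
    belonging to the chosen kernel, not those supplied with the hypothesis on
    \<open>r\<close>.\<close>
  from someI_ex[OF this] obtain s g where g: "local_equations p s M x g"
    and T: "tangent_space p M x = ?K s g"
    unfolding tangent_space_def by blast
  define n where "n = DIM('a) - s"
  define T where "T = tangent_space p M x"
  have g_smooth: "higher_differentiable_on UNIV (g i) p" if "i < n" for i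
    using g that by (auto simp: local_equations_def n_def)
  have g_der: "(g i has_derivative frechet_derivative (g i) (at y)) (at y)" if "i < n" for i y
    by (rule higher_differentiable_on_has_derivative[OF g_smooth[OF that] p]) simp
  have indep: "c i = 0" if "\<And>v. (\<Sum>i<n. c i * frechet_derivative (g i) (at x) v) = 0" "i < n" for c :: "nat \<Rightarrow> real" and i
    using g that unfolding local_equations_def n_def by blast
  obtain \<epsilon> where \<epsilon>: "\<epsilon> > 0" "M \<inter> ball x \<epsilon> = {y \<in> ball x \<epsilon>. \<forall>i<n. g i y = 0}"
    using g unfolding local_equations_def n_def by blast
  \<comment> \<open>\<open>a i\<close> is the gradient of \<open>g i\<close> at \<open>x\<close>;
    full row rank becomes linear independence of these vectors.\<close>
  define a where "a = (\<lambda>i. \<Sum>b\<in>Basis. frechet_derivative (g i) (at x) b *\<^sub>R b)"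
  have a: "frechet_derivative (g i) (at x) v = a i \<bullet> v" if "i < n" for i v
    unfolding linear_basis_expansion[OF has_derivative_linear[OF g_der[OF that, of x]], of v]
    by (simp add: a_def inner_sum_left mult.commute inner_commute[of v])
  have T_iff: "v \<in> T \<longleftrightarrow> (\<forall>i<n. a i \<bullet> v = 0)" for v
    using T a by (auto simp: T_def n_def)
  have subT: "subspace T"
    by (auto simp: subspace_def T_iff inner_add_right)
  have indep_a: "c i = 0" if "(\<Sum>i<n. c i *\<^sub>R a i) = 0" "i < n" for c :: "nat \<Rightarrow> real" and i
  proof (rule indep[OF _ that(2)])
    fix v
    have "(\<Sum>i<n. c i * frechet_derivative (g i) (at x) v) = (\<Sum>i<n. c i *\<^sub>R a i) \<bullet> v"
      by (simp add: inner_sum_left a)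
    then show "(\<Sum>i<n. c i * frechet_derivative (g i) (at x) v) = 0" using that(1) by simp
  qed
  \<comment> \<open>With coefficient vectors frozen at \<open>x\<close>, the values of
    \<open>G\<close> stay in one fixed normal space for every \<open>y\<close>; independence of the
    \<open>a i\<close> lets \<open>G y = 0\<close> recover all scalar equations.\<close>
  define G where "G = (\<lambda>y. \<Sum>i<n. g i y *\<^sub>R a i)"
  have DG: "(G has_derivative (\<lambda>v. \<Sum>i<n. frechet_derivative (g i) (at y) v *\<^sub>R a i)) (at y)" for y
    unfolding G_def by (auto intro!: derivative_eq_intros g_der)
  obtain B where B: "B \<subseteq> T" "pairwise orthogonal B" "\<And>b. b \<in> B \<Longrightarrow> norm b = 1"
    "independent B" "span B = T"
    using orthonormal_basis_subspace[OF subT] by metis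
  have finB: "finite B" using B(4) by (rule independent_imp_finite)
  define P where "P = (\<lambda>z. \<Sum>b\<in>B. (z \<bullet> b) *\<^sub>R b)"
  have P_inner: "P z \<bullet> b = z \<bullet> b" if "b \<in> B" for z b
  proof -
    have "P z \<bullet> b = (\<Sum>c\<in>B. if c = b then z \<bullet> b else 0)"
      unfolding P_def inner_sum_left
    proof (rule sum.cong)
      fix c assume c: "c \<in> B"
      show "((z \<bullet> c) *\<^sub>R c) \<bullet> b = (if c = b then z \<bullet> b else 0)"
        using B(2,3) c that by (auto simp: pairwise_def orthogonal_def dot_square_norm)
    qed simp
    then show ?thesis using finB that by simp
  qed
  have P_eq_0: "P z = 0 \<longleftrightarrow> (\<forall>t\<in>T. z \<bullet> t = 0)" for z
  proof
    assume z: "P z = 0"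
    have "B \<subseteq> {t. z \<bullet> t = 0}" using P_inner[of _ z] z by auto
    moreover have "subspace {t. z \<bullet> t = 0}" by (auto simp: subspace_def inner_add_right)
    ultimately have "span B \<subseteq> {t. z \<bullet> t = 0}" by (rule span_minimal)
    then show "\<forall>t\<in>T. z \<bullet> t = 0" using B(5) by auto
  next
    assume "\<forall>t\<in>T. z \<bullet> t = 0"
    then show "P z = 0" using B(1) by (auto simp: P_def intro!: sum.neutral)
  qed
  have "manifold_equation p M T x G P \<epsilon>"
  proof (rule manifold_equation.intro)
    show "1 \<le> p" "subspace T" "0 < \<epsilon>" by fact+
    show "higher_differentiable_on UNIV G p"
      unfolding G_def
      by (intro higher_differentiable_on_sum higher_differentiable_on_scaleR
          higher_differentiable_on_const g_smooth) auto
    show "G y \<bullet> t = 0" if "t \<in> T" for y t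
      using that by (auto simp: G_def inner_sum_left T_iff intro!: sum.neutral)
    show "linear P"
      unfolding P_def by (auto intro!: linearI simp: inner_add_left scaleR_add_left sum.distrib scaleR_sum_right)
    show "P z \<in> T" for z
      unfolding P_def using B(1) by (intro subspace_sum[OF subT] subspace_scale[OF subT]) auto
    show "P z = 0 \<longleftrightarrow> (\<forall>t\<in>T. z \<bullet> t = 0)" for z by (rule P_eq_0)
    show "y \<in> M \<longleftrightarrow> G y = 0" if "y \<in> ball x \<epsilon>" for y
    proof -
      have "y \<in> M \<longleftrightarrow> (\<forall>i<n. g i y = 0)" using \<epsilon>(2) that by auto
      also have "\<dots> \<longleftrightarrow> G y = 0"
        using indep_a[of "\<lambda>i. g i y"] by (auto simp: G_def)
      finally show ?thesis .
    qed
    show "x \<in> M" using assms by (simp add: smooth_manifold_at_def)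
    show "T = {v. frechet_derivative G (at x) v = 0}"
    proof (rule set_eqI)
      fix v
      have "frechet_derivative G (at x) v = (\<Sum>i<n. (a i \<bullet> v) *\<^sub>R a i)"
        by (simp add: frechet_derivative_at[OF DG, symmetric] a)
      then show "v \<in> T \<longleftrightarrow> v \<in> {v. frechet_derivative G (at x) v = 0}"
        using indep_a[of "\<lambda>i. a i \<bullet> v"] by (auto simp: T_iff)
    qed
  qed
  then show ?thesis using that unfolding T_def by blast
qed

section \<open>Straightening the manifold: tangent vectors and curves\<close>

context manifold_equation
begin

lemma normal_tangent_0: "z \<in> T \<Longrightarrow> (\<And>t. t \<in> T \<Longrightarrow> z \<bullet> t = 0) \<Longrightarrow> z = 0"
  by (metis inner_eq_zero_iff)

text \<open>The device that lets a single equation in the whole space encode one equation in the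
  normal space together with one in the tangent space.\<close>

lemma normal_add_tangent_0:
  assumes "\<And>t. t \<in> T \<Longrightarrow> z \<bullet> t = 0" "w \<in> T" "z + w = 0"
  shows "z = 0" "w = 0"
proof -
  have "w = 0"
  proof (rule normal_tangent_0[OF assms(2)])
    fix t assume "t \<in> T"
    then show "w \<bullet> t = 0" using assms(1,3) by (metis add_0 inner_add_left inner_zero_left)
  qed
  then show "z = 0" "w = 0" using assms(3) by auto
qed

abbreviation "DG y \<equiv> frechet_derivative G (at y)"

lemma DG: "(G has_derivative DG y) (at y)"
  by (rule higher_differentiable_on_has_derivative[OF G_smooth p]) simp

lemma DG_linear: "linear (DG y)"
  using DG by (rule has_derivative_linear)

lemma DG_normal: "t \<in> T \<Longrightarrow> DG y v \<bullet> t = 0"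
proof -
  assume t: "t \<in> T"
  have "((\<lambda>z. G z \<bullet> t) has_derivative (\<lambda>v. DG y v \<bullet> t)) (at y)"
    by (auto intro!: derivative_eq_intros DG)
  moreover have "((\<lambda>z. G z \<bullet> t) has_derivative (\<lambda>v. 0)) (at y)"
    using G_normal[OF t] by simp
  ultimately show ?thesis by (metis has_derivative_unique)
qed

text \<open>A chart of the ambient space that flattens \<open>M\<close>: on \<open>M\<close> near
  \<open>x\<close> it reduces to \<open>P\<close>, and its derivative at \<open>x\<close> is
  injective.\<close>

definition "\<Gamma> z = G z + P z"

lemma \<Gamma>_smooth: "higher_differentiable_on UNIV \<Gamma> p"
  unfolding \<Gamma>_def
  by (intro higher_differentiable_on_add G_smooth higher_differentiable_on_linear P_linear) auto

lemma D\<Gamma>: "frechet_derivative \<Gamma> (at y) = (\<lambda>v. DG y v + P v)"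
proof -
  have "(\<Gamma> has_derivative (\<lambda>v. DG y v + P v)) (at y)"
    unfolding \<Gamma>_def by (intro has_derivative_add DG linear_imp_has_derivative P_linear)
  then show ?thesis by (rule frechet_derivative_at[symmetric])
qed

lemma D\<Gamma>_inj: "DG x v + P v = 0 \<Longrightarrow> v = 0"
proof -
  assume v: "DG x v + P v = 0"
  have 0: "DG x v = 0" "P v = 0"
    using normal_add_tangent_0[OF DG_normal P_tangent v] by auto
  show "v = 0" by (rule normal_tangent_0) (use 0 T_eq P_eq_0 in auto)
qed

text \<open>Both constructions use the local inverse of \<open>\<Gamma>\<close>. A vector whose
  image under the derivative of \<open>\<Gamma>\<close> is tangent lies in the kernel of
  \<open>DG y\<close>, and a straight line in a tangent direction pulls back to a curve in
  \<open>M\<close>.\<close>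

lemma tangent_transport:
  obtains V \<tau> where "open V" "x \<in> V" "V \<subseteq> ball x \<epsilon>"
    "\<And>y t. y \<in> V \<Longrightarrow> t \<in> T \<Longrightarrow> DG y (\<tau> t y) = 0"
    "\<And>t. t \<in> T \<Longrightarrow> \<tau> t x = t"
    "\<And>t. continuous_on V (\<tau> t)"
    "\<And>y t. y \<in> V \<Longrightarrow> y \<in> M \<Longrightarrow> DG y t = 0 \<Longrightarrow> \<exists>z. z 0 = y \<and> (z has_vector_derivative t) (at 0) \<and>
        (\<forall>\<^sub>F s in at 0. z s \<in> M)"
proof -
  obtain k where k: "p = Suc k" using p by (cases p) auto
  obtain V W \<gamma> where V: "open V" "x \<in> V" and W: "open W" and hom: "homeomorphism V W \<Gamma> \<gamma>"
    and \<gamma>: "higher_differentiable_on W \<gamma> p"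
      "\<And>y. y \<in> W \<Longrightarrow> (\<gamma> has_derivative inv (frechet_derivative \<Gamma> (at (\<gamma> y)))) (at y)"
      "\<And>x. x \<in> V \<Longrightarrow> bij (frechet_derivative \<Gamma> (at x))"
  proof (rule inverse_function_higher_differentiable[OF open_UNIV \<Gamma>_smooth[unfolded k] UNIV_I, of x])
    show "v = 0" if "frechet_derivative \<Gamma> (at x) v = 0" for v
      using D\<Gamma>_inj[of v] that by (simp add: D\<Gamma>)
  qed (use k in blast)
  have \<Gamma>W: "\<Gamma> y \<in> W" "\<gamma> (\<Gamma> y) = y" if "y \<in> V" for y using hom that by (auto simp: homeomorphism_def)
  have \<gamma>V: "\<gamma> w \<in> V" "\<Gamma> (\<gamma> w) = w" if "w \<in> W" for w using hom that by (auto simp: homeomorphism_def)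
  have D\<gamma>: "(\<gamma> has_derivative inv (\<lambda>v. DG y v + P v)) (at (\<Gamma> y))" if "y \<in> V" for y
    using \<gamma>(2)[OF \<Gamma>W(1)[OF that]] by (simp add: \<Gamma>W[OF that] D\<Gamma>)
  have bij: "bij (\<lambda>v. DG y v + P v)" if "y \<in> V" for y using \<gamma>(3)[OF that] by (simp add: D\<Gamma>)
  \<comment> \<open>\<open>\<tau> t y\<close> is the vector whose image under the derivative of
    \<open>\<Gamma>\<close> at \<open>y\<close> is \<open>P t\<close>. The normal part of that image
    is zero, which makes it tangent at \<open>y\<close>, and it depends continuously on
    \<open>y\<close> as a derivative of \<open>\<gamma>\<close>.\<close>
  define \<tau> where "\<tau> = (\<lambda>t y. inv (\<lambda>v. DG y v + P v) (P t))"
  have \<tau>: "DG y (\<tau> t y) + P (\<tau> t y) = P t" if "y \<in> V" for y t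
    unfolding \<tau>_def using bij[OF that] by (auto dest!: bij_is_surj intro: surj_f_inv_f[of "\<lambda>v. DG y v + P v"])
  show ?thesis
  proof (rule that[of "V \<inter> ball x \<epsilon>" \<tau>])
    show "DG y (\<tau> t y) = 0" if "y \<in> V \<inter> ball x \<epsilon>" "t \<in> T" for y t
    proof -
      have "DG y (\<tau> t y) + (P (\<tau> t y) - P t) = 0" using \<tau>[of y t] that by (simp add: add_diff_eq)
      then show ?thesis
        using normal_add_tangent_0[OF DG_normal subspace_diff[OF T P_tangent P_tangent]] by blast
    qed
    show "\<tau> t x = t" if "t \<in> T" for t
    proof -
      have "DG x t = 0" using that T_eq by blast
      then have "(\<lambda>v. DG x v + P v) t = P t" by simp
      then show ?thesis using bij[OF V(2)] \<tau>[OF V(2), of t]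
        unfolding bij_def inj_def by metis
    qed
    show "continuous_on (V \<inter> ball x \<epsilon>) (\<tau> t)" for t
    proof -
      have c: "continuous_on W (\<lambda>w. frechet_derivative \<gamma> (at w) (P t))"
        by (rule higher_differentiable_on_continuous_on[OF higher_differentiable_on_frechet[OF \<gamma>(1)[unfolded k]]])
      have "continuous_on V (\<lambda>y. frechet_derivative \<gamma> (at (\<Gamma> y)) (P t))"
        by (rule continuous_on_compose2[OF c]) (use hom in \<open>auto simp: homeomorphism_def\<close>)
      moreover have "frechet_derivative \<gamma> (at (\<Gamma> y)) (P t) = \<tau> t y" if "y \<in> V" for y
        unfolding \<tau>_def using frechet_derivative_at[OF D\<gamma>[OF that]] by metis
      ultimately have "continuous_on V (\<tau> t)" by (simp cong: continuous_on_cong)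
      then show ?thesis by (rule continuous_on_subset) auto
    qed
    show "\<exists>z. z 0 = y \<and> (z has_vector_derivative t) (at 0) \<and> (\<forall>\<^sub>F s in at 0. z s \<in> M)"
      if y: "y \<in> V \<inter> ball x \<epsilon>" "y \<in> M" and t: "DG y t = 0" for y t
    proof (intro exI conjI)
      have yV: "y \<in> V" using y by simp
      \<comment> \<open>\<open>\<Gamma> y\<close> has no normal component because
        \<open>y \<in> M\<close>, and \<open>P t\<close> has none either; hence the whole line stays
        in \<open>T\<close>.\<close>
      define l where "l = (\<lambda>s::real. \<Gamma> y + s *\<^sub>R P t)"
      define z where "z = (\<lambda>s. \<gamma> (l s))"
      show z0: "z 0 = y" by (simp add: z_def l_def \<Gamma>W yV)
      have "(l has_derivative (\<lambda>s. s *\<^sub>R P t)) (at 0)"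
        unfolding l_def by (auto intro!: derivative_eq_intros)
      moreover have l0: "l 0 = \<Gamma> y" by (simp add: l_def)
      ultimately have zder: "(z has_derivative (\<lambda>s. inv (\<lambda>v. DG y v + P v) (s *\<^sub>R P t))) (at 0)"
        unfolding z_def using has_derivative_compose[of l _ 0 UNIV \<gamma>] D\<gamma>[OF yV] by simp
      have lin: "linear (inv (\<lambda>v. DG y v + P v))" using D\<gamma>[OF yV] by (rule has_derivative_linear)
      have "inv (\<lambda>v. DG y v + P v) (P t) = t"
        using inv_f_eq[OF bij_is_inj[OF bij[OF yV]], of t "P t"] t by simp
      then show zvd: "(z has_vector_derivative t) (at 0)"
        using zder by (simp add: has_vector_derivative_def linear_cmul[OF lin])
      have cz: "isCont z 0" using zder by (rule has_derivative_continuous)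
      have cl: "isCont l 0" unfolding l_def by (intro continuous_intros)
      have "\<forall>\<^sub>F s in at 0. z s \<in> ball x \<epsilon>"
        using cz y(1) z0 unfolding isCont_def by (intro topological_tendstoD[of z "z 0"]) auto
      moreover have "\<forall>\<^sub>F s in at 0. l s \<in> W"
        using cl \<Gamma>W(1)[OF yV] W l0 unfolding isCont_def by (intro topological_tendstoD[of l "l 0"]) auto
      ultimately show "\<forall>\<^sub>F s in at 0. z s \<in> M"
      proof eventually_elim
        case (elim s)
        have "\<Gamma> (z s) = l s" unfolding z_def by (rule \<gamma>V(2)[OF elim(2)])
        moreover have "G y = 0" using y M_eq by auto
        ultimately have "G (z s) + (P (z s) - (P y + s *\<^sub>R P t)) = 0"
          by (simp add: \<Gamma>_def l_def add_diff_eq)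
        then have "G (z s) = 0"
          by (rule normal_add_tangent_0(1)[rotated -1])
            (auto intro!: G_normal subspace_diff[OF T] subspace_add[OF T] subspace_scale[OF T] P_tangent)
        then show ?case using M_eq elim(1) by auto
      qed
    qed
  qed (use V \<epsilon> in auto)
qed

end

lemma vector_derivative_difference_quotient:
  fixes f :: "real \<Rightarrow> 'a::real_normed_vector"
  assumes "(f has_vector_derivative d) (at 0)"
  shows "((\<lambda>s. (f s - f 0) /\<^sub>R s) \<longlongrightarrow> d) (at 0)"
proof -
  have "((\<lambda>s. norm (f s - f 0 - s *\<^sub>R d) / norm s) \<longlongrightarrow> 0) (at 0)"
    using assms by (simp add: has_vector_derivative_def has_derivative_at)
  moreover have "\<forall>\<^sub>F s in at 0. norm (f s - f 0 - s *\<^sub>R d) / norm s = norm ((f s - f 0) /\<^sub>R s - d)"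
  proof (rule eventually_mono[OF eventually_neq_at_within[of 0]])
    fix s :: real assume "s \<noteq> 0"
    then have "(f s - f 0) /\<^sub>R s - d = (f s - f 0 - s *\<^sub>R d) /\<^sub>R s"
      by (simp add: scaleR_diff_right)
    then show "norm (f s - f 0 - s *\<^sub>R d) / norm s = norm ((f s - f 0) /\<^sub>R s - d)"
      by (simp add: divide_inverse mult.commute)
  qed
  ultimately have "((\<lambda>s. norm ((f s - f 0) /\<^sub>R s - d)) \<longlongrightarrow> 0) (at 0)"
    by (rule Lim_transform_eventually)
  then have "((\<lambda>s. (f s - f 0) /\<^sub>R s - d) \<longlongrightarrow> 0) (at 0)"
    by (rule tendsto_norm_zero_cancel)
  then show ?thesis by (rule LIM_zero_cancel)
qed

lemma inner_basis_sum:
  "(\<Sum>b\<in>Basis. c b *\<^sub>R b) \<bullet> t = (\<Sum>b\<in>Basis. (t \<bullet> b) * c b)"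
  by (simp add: inner_sum_left inner_commute[of t] mult.commute)

section \<open>Subgradients along an active manifold\<close>

locale active_point = manifold_equation 3 M T x G P \<epsilon>
  for M T :: "'a::euclidean_space set" and x :: 'a and G P :: "'a \<Rightarrow> 'a" and \<epsilon> :: real +
  fixes \<phi> :: "'a \<Rightarrow> ereal" and \<psi> :: "'a \<Rightarrow> real" and \<sigma> :: real and v :: 'a
  assumes \<sigma>: "0 \<le> \<sigma>" and weakly_convex: "weakly_convex \<sigma> \<phi>"
    and v: "v \<in> rel_interior (subdiff \<phi> x)"
    and \<psi>_smooth: "higher_differentiable_on (ball x \<epsilon>) \<psi> 3"
    and \<phi>_eq: "\<And>y. y \<in> M \<Longrightarrow> y \<in> ball x \<epsilon> \<Longrightarrow> \<phi> y = ereal (\<psi> y)"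
    and regular: "\<And>y. y \<in> M \<Longrightarrow> y \<in> ball x \<epsilon> \<Longrightarrow> regular_at \<phi> y \<and> subdiff \<phi> y \<noteq> {}"
    and sharp: "\<And>u. (\<And>t. t \<in> T \<Longrightarrow> u \<bullet> t = 0) \<Longrightarrow> u \<noteq> 0 \<Longrightarrow>
      - subderivative \<phi> x u < subderivative \<phi> x (- u)"
    and continuous: "setvalued_continuous_at (clarke_subdiff \<phi>) M x"
begin

lemma x_ball: "x \<in> ball x \<epsilon>"
  using \<epsilon> by simp

lemma v_subdiff: "v \<in> subdiff \<phi> x"
  using v rel_interior_subset by blast

abbreviation "D\<psi> y \<equiv> frechet_derivative \<psi> (at y)"

lemma D\<psi>: "y \<in> ball x \<epsilon> \<Longrightarrow> (\<psi> has_derivative D\<psi> y) (at y)"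
  by (rule higher_differentiable_on_has_derivative[OF \<psi>_smooth]) auto

text \<open>Along the curve, \<open>\<psi>\<close> minus the quadratic minorant given by
  \<open>\<nu>\<close> is minimal at parameter \<open>0\<close>, so its derivative there vanishes.
  All subgradients thus share their tangential part.\<close>

lemma subdiff_tangent:
  assumes y: "y \<in> M" "y \<in> ball x \<epsilon>" and \<nu>: "\<nu> \<in> subdiff \<phi> y"
    and z: "z 0 = y" "(z has_vector_derivative t) (at 0)" "\<forall>\<^sub>F s in at 0. z s \<in> M"
  shows "\<nu> \<bullet> t = D\<psi> y t"
proof -
  define h where "h = (\<lambda>s. \<psi> (z s) - \<nu> \<bullet> (z s - y) + \<sigma> / 2 * ((z s - y) \<bullet> (z s - y)))"
  have zd: "(z has_derivative (\<lambda>s. s *\<^sub>R t)) (at 0)"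
    using z(2) by (simp add: has_vector_derivative_def)
  have "((\<lambda>s. \<psi> (z s)) has_derivative (\<lambda>s. D\<psi> y (s *\<^sub>R t))) (at 0)"
    using has_derivative_compose[OF zd, of \<psi> "D\<psi> y"] D\<psi>[OF y(2)] z(1) by simp
  then have hd: "(h has_derivative (\<lambda>s. D\<psi> y (s *\<^sub>R t) - \<nu> \<bullet> (s *\<^sub>R t))) (at 0)"
    unfolding h_def using z(1) by (auto intro!: derivative_eq_intros zd)
  have "isCont z 0" using zd by (rule has_derivative_continuous)
  then have "\<forall>\<^sub>F s in at 0. z s \<in> ball x \<epsilon>"
    using y(2) z(1) unfolding isCont_def by (intro topological_tendstoD[of z "z 0"]) auto
  with z(3) have "\<forall>\<^sub>F s in at 0. h 0 \<le> h s"
  proof eventually_elim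
    case (elim s)
    have "(z s, \<psi> (z s)) \<in> epi \<phi>" using \<phi>_eq[OF elim] by (simp add: epi_iff)
    from subdiff_lower_bound[OF weakly_convex \<nu> this] show ?case
      using \<phi>_eq[OF y] z(1) by (simp add: h_def power2_norm_eq_inner)
  qed
  then obtain d where d: "d > 0" "\<And>s. dist s 0 < d \<Longrightarrow> h 0 \<le> h s"
    unfolding eventually_at by (metis UNIV_I order_refl)
  have "(\<lambda>s. D\<psi> y (s *\<^sub>R t) - \<nu> \<bullet> (s *\<^sub>R t)) = (\<lambda>s. 0)"
    by (rule differential_zero_maxmin[of 0 "ball 0 d", OF _ _ hd]) (use d in \<open>auto simp: dist_commute\<close>)
  from fun_cong[OF this, of 1] show ?thesis by simp
qed

text \<open>The gradient in \<open>y\<close> of the Lagrangian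
  \<open>\<psi> y + G y \<bullet> l\<close>, at \<open>q = (y, l)\<close>, assembled from its
  components.\<close>

definition s :: "'a \<times> 'a \<Rightarrow> 'a" where
  "s q = (\<Sum>b\<in>Basis. (D\<psi> (fst q) b + DG (fst q) b \<bullet> snd q) *\<^sub>R b)"

text \<open>Membership in \<open>M\<close> and the normalization \<open>P l = 0\<close> in one
  equation: \<open>G\<close> has normal values and \<open>P\<close> tangent ones. Requiring
  \<open>l\<close> to be normal makes the multiplier unique and the system square.\<close>

definition e :: "'a \<times> 'a \<Rightarrow> 'a" where
  "e q = G (fst q) + P (snd q)"

lemma DG_adjoint: "(\<Sum>b\<in>Basis. (DG y b \<bullet> l) *\<^sub>R b) \<bullet> t = DG y t \<bullet> l"
  unfolding linear_basis_expansion[OF DG_linear, of y t] inner_basis_sum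
  by (simp add: inner_sum_left)

lemma s_inner: "y \<in> ball x \<epsilon> \<Longrightarrow> s (y, l) \<bullet> t = D\<psi> y t + DG y t \<bullet> l"
proof -
  assume y: "y \<in> ball x \<epsilon>"
  have "s (y, l) = (\<Sum>b\<in>Basis. D\<psi> y b *\<^sub>R b) + (\<Sum>b\<in>Basis. (DG y b \<bullet> l) *\<^sub>R b)"
    by (simp add: s_def scaleR_add_left sum.distrib)
  moreover have "(\<Sum>b\<in>Basis. D\<psi> y b *\<^sub>R b) \<bullet> t = D\<psi> y t"
    unfolding linear_basis_expansion[OF has_derivative_linear[OF D\<psi>[OF y]], of t] inner_basis_sum
    by simp
  ultimately show ?thesis using DG_adjoint by (simp add: inner_add_left)
qed

lemma open_dom: "open (fst -` ball x \<epsilon> :: ('a \<times> 'a) set)"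
  by (intro open_vimage continuous_intros) auto

lemma s_smooth: "higher_differentiable_on (fst -` ball x \<epsilon>) s 2"
proof -
  note lin = higher_differentiable_on_linear[OF open_dom]
  have "higher_differentiable_on (fst -` ball x \<epsilon> :: ('a \<times> 'a) set) (\<lambda>q. D\<psi> (fst q) b) 2" for b
    by (rule higher_differentiable_on_compose[OF open_dom open_ball lin[OF linear_fst]
          higher_differentiable_on_frechet]) (use \<psi>_smooth in \<open>auto simp: eval_nat_numeral\<close>)
  note 1 = this
  have 2: "higher_differentiable_on (fst -` ball x \<epsilon> :: ('a \<times> 'a) set) (\<lambda>q. DG (fst q) b) 2" for b
    by (rule higher_differentiable_on_compose[OF open_dom open_UNIV lin[OF linear_fst]
          higher_differentiable_on_frechet]) (use G_smooth in \<open>auto simp: eval_nat_numeral\<close>)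
  show ?thesis
    unfolding s_def
    by (intro higher_differentiable_on_sum higher_differentiable_on_scaleR higher_differentiable_on_add
        higher_differentiable_on_inner higher_differentiable_on_const lin[OF linear_snd] open_dom 1 2)
qed

lemma e_smooth: "higher_differentiable_on (fst -` ball x \<epsilon>) e 2"
  unfolding e_def
proof (intro higher_differentiable_on_add open_dom)
  note lin = higher_differentiable_on_linear[OF open_dom]
  show "higher_differentiable_on (fst -` ball x \<epsilon> :: ('a \<times> 'a) set) (\<lambda>q. G (fst q)) 2"
    by (rule higher_differentiable_on_compose[OF open_dom open_UNIV lin[OF linear_fst]
          higher_differentiable_on_le[OF G_smooth]]) auto
  show "higher_differentiable_on (fst -` ball x \<epsilon> :: ('a \<times> 'a) set) (\<lambda>q. P (snd q)) 2"
    using lin[OF linear_compose[OF linear_snd P_linear]] by (simp add: o_def)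
qed

lemma e_eq_0: "e (y, l) = 0 \<longleftrightarrow> G y = 0 \<and> P l = 0"
  using normal_add_tangent_0[OF G_normal P_tangent, of y l] by (auto simp: e_def)

text \<open>\<open>DG x + P\<close> is surjective. A normal \<open>l\<close> is therefore in the
  range of \<open>DG x\<close>, and being orthogonal to that range it is orthogonal to
  itself.\<close>

lemma multiplier_unique:
  assumes "\<And>t. DG x t \<bullet> l = 0" "P l = 0"
  shows "l = 0"
proof -
  have lin: "linear (\<lambda>v. DG x v + P v)"
    by (intro linear_compose_add DG_linear P_linear)
  have "inj (\<lambda>v. DG x v + P v)"
    unfolding linear_injective_0[OF lin] by (intro allI impI, rule D\<Gamma>_inj)
  then have "surj (\<lambda>v. DG x v + P v)"
    by (rule linear_injective_imp_surjective[OF lin _ refl])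
  from surjD[OF this, of l] obtain u where "l = DG x u + P u" by blast
  then have "DG x u - l + P u = 0" by simp
  from normal_add_tangent_0(1)[OF _ P_tangent this] have "DG x u - l = 0"
    using P_eq_0 assms(2) DG_normal by (simp add: inner_diff_left)
  with assms(1)[of u] show ?thesis by simp
qed

text \<open>By \<open>subdiff_tangent\<close>, \<open>v\<close> and the gradient of
  \<open>\<psi>\<close> differ by a normal vector. The adjoint of \<open>DG x\<close> plus
  \<open>P\<close> is injective, hence onto; the tangent part of the solution then vanishes.\<close>

lemma multiplier_exists: obtains l where "s (x, l) = v" "P l = 0"
proof -
  define A where "A = (\<lambda>l. \<Sum>b\<in>Basis. (DG x b \<bullet> l) *\<^sub>R b)"
  have A: "A l \<bullet> t = DG x t \<bullet> l" for l t unfolding A_def by (rule DG_adjoint)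
  have A_normal: "A l \<bullet> t = 0" if "t \<in> T" for l t using that T_eq by (auto simp: A)
  have lin: "linear (\<lambda>l. A l + P l)"
    unfolding A_def
    by (intro linear_compose_add P_linear)
       (auto intro!: linearI simp: inner_add_right scaleR_add_left sum.distrib scaleR_sum_right)
  have inj: "l = 0" if "A l + P l = 0" for l
  proof (rule multiplier_unique)
    have "A l = 0" "P l = 0" using normal_add_tangent_0[OF A_normal P_tangent that] by auto
    then show "DG x t \<bullet> l = 0" "P l = 0" for t using A[of l t] by auto
  qed
  have "inj (\<lambda>l. A l + P l)"
    unfolding linear_injective_0[OF lin] by (intro allI impI, rule inj)
  then have "surj (\<lambda>l. A l + P l)"
    by (rule linear_injective_imp_surjective[OF lin _ refl])
  from surjD[OF this, of "v - s (x, 0)"] obtain l where l: "v - s (x, 0) = A l + P l" by blast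
  have normal: "(v - s (x, 0)) \<bullet> t = 0" if t: "t \<in> T" for t
  proof -
    obtain V \<tau> where V: "x \<in> V"
      "\<And>y t. y \<in> V \<Longrightarrow> y \<in> M \<Longrightarrow> DG y t = 0 \<Longrightarrow> \<exists>z. z 0 = y \<and> (z has_vector_derivative t) (at 0) \<and>
        (\<forall>\<^sub>F s in at 0. z s \<in> M)"
      by (rule tangent_transport) blast
    have "DG x t = 0" using t T_eq by blast
    with V x_M subdiff_tangent[OF x_M x_ball v_subdiff] have "v \<bullet> t = D\<psi> x t" by metis
    then show ?thesis by (simp add: inner_diff_left s_inner[OF x_ball])
  qed
  have "A l - (v - s (x, 0)) + P l = 0" using l by simp
  from normal_add_tangent_0[OF _ P_tangent this]
  have 0: "A l - (v - s (x, 0)) = 0" "P l = 0"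
    using A_normal normal by (auto simp: inner_diff_left)
  have "s (x, l) = s (x, 0) + A l"
    by (simp add: s_def A_def scaleR_add_left sum.distrib)
  with 0 that[of l] show ?thesis by simp
qed

text \<open>If all subgradients agreed on \<open>u\<close>, the subderivatives at \<open>u\<close>
  and \<open>- u\<close> would be at most \<open>v \<bullet> u\<close> and
  \<open>- (v \<bullet> u)\<close>, so their sum could not be positive, contrary to
  sharpness.\<close>

lemma subdiff_not_constant:
  assumes "\<And>t. t \<in> T \<Longrightarrow> u \<bullet> t = 0" "u \<noteq> 0"
  obtains \<nu> where "\<nu> \<in> subdiff \<phi> x" "\<nu> \<bullet> u \<noteq> v \<bullet> u"
proof (rule ccontr)
  assume "\<not> thesis"
  with that have const: "\<nu> \<bullet> u = v \<bullet> u" if "\<nu> \<in> subdiff \<phi> x" for \<nu> using that by blast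
  have ne: "subdiff \<phi> x \<noteq> {}" using v_subdiff by blast
  have "subderivative \<phi> x u \<le> ereal (v \<bullet> u)"
    by (rule subderivative_le[OF \<sigma> weakly_convex ne const])
  moreover have "subderivative \<phi> x (- u) \<le> ereal (- (v \<bullet> u))"
    by (rule subderivative_le[OF \<sigma> weakly_convex ne]) (simp only: inner_minus_right const)
  ultimately show False
    using sharp[OF assms]
    by (cases "subderivative \<phi> x u"; cases "subderivative \<phi> x (- u)") auto
qed

text \<open>Weak convexity makes the sets \<open>subdiff \<phi> (Y i)\<close> closed and convex, so
  closest points give unit separating directions, and compactness of the sphere gives a limit
  direction. Regularity turns the assumed continuity of \<open>clarke_subdiff\<close> into a
  statement about \<open>subdiff\<close>.\<close>

lemma subgradient_on_graph:
  assumes l: "s (x, l) = v" "P l = 0"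
  obtains \<delta> where "0 < \<delta>"
    "\<And>y k. dist y x < \<delta> \<Longrightarrow> dist k l < \<delta> \<Longrightarrow> e (y, k) = 0 \<Longrightarrow> s (y, k) \<in> subdiff \<phi> y"
proof (rule ccontr)
  assume n: "\<not> thesis"
  obtain V \<tau> where V: "open V" "x \<in> V" "V \<subseteq> ball x \<epsilon>"
    and \<tau>: "\<And>y t. y \<in> V \<Longrightarrow> t \<in> T \<Longrightarrow> DG y (\<tau> t y) = 0" "\<And>t. t \<in> T \<Longrightarrow> \<tau> t x = t"
      "\<And>t. continuous_on V (\<tau> t)"
    and curve: "\<And>y t. y \<in> V \<Longrightarrow> y \<in> M \<Longrightarrow> DG y t = 0 \<Longrightarrow>
      \<exists>z. z 0 = y \<and> (z has_vector_derivative t) (at 0) \<and> (\<forall>\<^sub>F s in at 0. z s \<in> M)"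
    by (rule tangent_transport) blast
  obtain d where d: "d > 0" "ball x d \<subseteq> V" using V(1,2) by (auto simp: open_contains_ball)
  have "\<exists>y k. dist y x < d / Suc i \<and> dist k l < d / Suc i \<and> e (y, k) = 0 \<and> s (y, k) \<notin> subdiff \<phi> y" for i
    using n that[of "d / Suc i"] d(1) by (metis divide_pos_pos of_nat_0_less_iff zero_less_Suc)
  then obtain Y K where YK: "\<And>i. dist (Y i) x < d / Suc i" "\<And>i. dist (K i) l < d / Suc i"
    "\<And>i. e (Y i, K i) = 0" "\<And>i. s (Y i, K i) \<notin> subdiff \<phi> (Y i)"
    by metis
  have YV: "Y i \<in> V" for i
  proof -
    have "d / Suc i \<le> d" using d(1) by (simp add: divide_le_eq_1 field_simps)
    then have "dist x (Y i) < d" using YK(1)[of i] by (simp add: dist_commute)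
    then show ?thesis using d(2) by auto
  qed
  have Yball: "Y i \<in> ball x \<epsilon>" for i using YV V(3) by blast
  have YM: "Y i \<in> M" for i using YK(3)[of i] M_eq[OF Yball] by (simp add: e_eq_0)
  have lim0: "(\<lambda>i. d / Suc i) \<longlonglongrightarrow> 0"
    by (rule lim_const_over_n[THEN LIMSEQ_Suc])
  have Y: "Y \<longlonglongrightarrow> x"
    by (rule metric_tendsto_imp_tendsto[OF lim0]) (use YK(1) d(1) in \<open>auto intro!: always_eventually simp: less_imp_le\<close>)
  have K: "K \<longlonglongrightarrow> l"
    by (rule metric_tendsto_imp_tendsto[OF lim0]) (use YK(2) d(1) in \<open>auto intro!: always_eventually simp: less_imp_le\<close>)
  define S where "S = (\<lambda>i. s (Y i, K i))"
  have "(\<lambda>i. s (Y i, K i)) \<longlonglongrightarrow> s (x, l)"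
    by (rule continuous_on_tendsto_compose[OF higher_differentiable_on_continuous_on[OF s_smooth] tendsto_Pair[OF Y K]])
       (use Yball x_ball in auto)
  then have S: "S \<longlonglongrightarrow> v" by (simp add: S_def l)
  define C where "C = (\<lambda>i. closest_point (subdiff \<phi> (Y i)) (S i))"
  have conv: "convex (subdiff \<phi> (Y i))" "closed (subdiff \<phi> (Y i))" "subdiff \<phi> (Y i) \<noteq> {}" for i
    using convex_subdiff[OF \<sigma> weakly_convex] closed_subdiff[OF \<sigma> weakly_convex] regular[OF YM Yball] by auto
  have C: "C i \<in> subdiff \<phi> (Y i)" for i
    unfolding C_def by (rule closest_point_in_set[OF conv(2,3)])
  have C_ne: "S i - C i \<noteq> 0" for i using C[of i] YK(4)[of i] by (auto simp: S_def)
  define u where "u = (\<lambda>i. (S i - C i) /\<^sub>R norm (S i - C i))"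
  have u_norm: "norm (u i) = 1" for i using C_ne[of i] by (simp add: u_def)
  have u_sep: "u i \<bullet> (z - S i) \<le> 0" if z: "z \<in> subdiff \<phi> (Y i)" for i z
  proof -
    have "(S i - C i) \<bullet> (z - C i) \<le> 0"
      unfolding C_def by (rule closest_point_dot[OF conv(1,2) z])
    moreover have "(S i - C i) \<bullet> (S i - C i) \<ge> 0" by simp
    ultimately have "(S i - C i) \<bullet> (z - S i) \<le> 0" by (simp add: inner_diff_right)
    then show ?thesis by (simp add: u_def mult_nonneg_nonpos)
  qed
  \<comment> \<open>The Lagrangian gradient and the closest subgradient both act on tangent vectors
    as the derivative of \<open>\<psi>\<close>; the separating direction is therefore normal at
    \<open>Y i\<close>.\<close>
  have u_tangent: "u i \<bullet> \<tau> t (Y i) = 0" if t: "t \<in> T" for i t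
  proof -
    have 0: "DG (Y i) (\<tau> t (Y i)) = 0" by (rule \<tau>(1)[OF YV t])
    have "C i \<bullet> \<tau> t (Y i) = D\<psi> (Y i) (\<tau> t (Y i))"
      using curve[OF YV YM 0] subdiff_tangent[OF YM Yball C] by metis
    then have "(S i - C i) \<bullet> \<tau> t (Y i) = 0"
      by (simp add: S_def inner_diff_left s_inner[OF Yball] 0)
    then show ?thesis by (simp add: u_def)
  qed
  have "seq_compact (sphere (0 :: 'a) 1)" by (rule compact_imp_seq_compact) simp
  then obtain u0 \<rho> where u0: "u0 \<in> sphere 0 1" and \<rho>: "strict_mono \<rho>" and lim: "(u \<circ> \<rho>) \<longlonglongrightarrow> u0"
    by (rule seq_compactE[of _ u]) (use u_norm in auto)
  have u0_ne: "u0 \<noteq> 0" using u0 by auto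
  have u0_normal: "u0 \<bullet> t = 0" if t: "t \<in> T" for t
  proof -
    have "(\<lambda>i. \<tau> t (Y i)) \<longlonglongrightarrow> \<tau> t x"
      by (rule continuous_on_tendsto_compose[OF \<tau>(3) Y]) (use V YV in auto)
    then have "(\<lambda>i. \<tau> t (Y (\<rho> i))) \<longlonglongrightarrow> t"
      using LIMSEQ_subseq_LIMSEQ[OF _ \<rho>] \<tau>(2)[OF t] by (fastforce simp: o_def)
    from tendsto_inner[OF lim this] have "(\<lambda>i. 0) \<longlonglongrightarrow> u0 \<bullet> t"
      using u_tangent[OF t] by (simp add: o_def)
    then show ?thesis by (simp add: LIMSEQ_const_iff)
  qed
  \<comment> \<open>Inner semicontinuity: each subgradient at \<open>x\<close> is a limit of
    subgradients at the points \<open>Y i\<close>, where the separation holds.\<close>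
  have sep: "u0 \<bullet> (z - v) \<le> 0" if z: "z \<in> subdiff \<phi> x" for z
  proof -
    have "z \<in> clarke_subdiff \<phi> x"
      using z clarke_subdiff_eq_subdiff regular[OF x_M x_ball] by blast
    then obtain Z where Z: "Z \<longlonglongrightarrow> z" "\<forall>\<^sub>F i in sequentially. Z i \<in> clarke_subdiff \<phi> (Y i)"
      using continuous YM Y unfolding setvalued_continuous_at_def by blast
    have "\<forall>\<^sub>F i in sequentially. u i \<bullet> (Z i - S i) \<le> 0"
      using Z(2)
    proof eventually_elim
      case (elim i)
      then show ?case using u_sep clarke_subdiff_eq_subdiff regular[OF YM Yball] by blast
    qed
    then have ev: "\<forall>\<^sub>F i in sequentially. u (\<rho> i) \<bullet> (Z (\<rho> i) - S (\<rho> i)) \<le> 0"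
      by (rule eventually_subseq[OF \<rho>])
    have "(\<lambda>i. u (\<rho> i) \<bullet> (Z (\<rho> i) - S (\<rho> i))) \<longlonglongrightarrow> u0 \<bullet> (z - v)"
      using LIMSEQ_subseq_LIMSEQ[OF Z(1) \<rho>] LIMSEQ_subseq_LIMSEQ[OF S \<rho>] lim
      by (auto intro!: tendsto_intros simp: o_def)
    from tendsto_upperbound[OF this ev] show ?thesis by simp
  qed
  obtain \<nu> where \<nu>: "\<nu> \<in> subdiff \<phi> x" "\<nu> \<bullet> u0 \<noteq> v \<bullet> u0"
    using subdiff_not_constant[OF u0_normal u0_ne] by blast
  have "u0 \<bullet> (\<nu> - v) < 0"
    using sep[OF \<nu>(1)] \<nu>(2) by (auto simp: inner_diff_right inner_commute)
  \<comment> \<open>The segment from \<open>\<nu>\<close> to \<open>v\<close> can be prolonged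
    beyond \<open>v\<close> inside the subdifferential. At the prolonged point \<open>u0\<close>
    would exceed its value at \<open>v\<close>, against \<open>sep\<close>.\<close>
  obtain m where m: "m > 1" "(1 - m) *\<^sub>R \<nu> + m *\<^sub>R v \<in> subdiff \<phi> x"
    using convex_rel_interior_if2[OF convex_subdiff[OF \<sigma> weakly_convex] v] \<nu>(1) hull_inc by metis
  from sep[OF m(2)] have "(1 - m) * (u0 \<bullet> (\<nu> - v)) \<le> 0"
    by (simp add: inner_diff_right inner_add_right algebra_simps)
  moreover have "(1 - m) * (u0 \<bullet> (\<nu> - v)) > 0"
    using m(1) \<open>u0 \<bullet> (\<nu> - v) < 0\<close> by (intro mult_neg_neg) auto
  ultimately show False by simp
qed

end

section \<open>Linearization of the chart at the base point\<close>

context active_point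
begin

lemma De: "frechet_derivative e (at (x, l)) = (\<lambda>q. DG x (fst q) + P (snd q))"
proof -
  have "((\<lambda>q. G (fst q)) has_derivative (\<lambda>q. DG x (fst q))) (at (x, l))"
    by (rule has_derivative_compose[OF linear_imp_has_derivative[OF linear_fst]]) (simp add: DG)
  moreover have "((\<lambda>q. P (snd q)) has_derivative (\<lambda>q. P (snd q))) (at (x, l))"
    by (rule linear_imp_has_derivative) (use linear_compose[OF linear_snd P_linear] in \<open>simp add: o_def\<close>)
  ultimately have "(e has_derivative (\<lambda>q. DG x (fst q) + P (snd q))) (at (x, l))"
    unfolding e_def by (rule has_derivative_add)
  then show ?thesis by (rule frechet_derivative_at[symmetric])
qed

lemma De_eq_0:
  assumes "frechet_derivative e (at (x, l)) (u, k) = 0"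
  shows "u \<in> T" "DG x u = 0" "P k = 0"
  using normal_add_tangent_0[OF DG_normal P_tangent, of x u k] assms T_eq by (auto simp: De)

lemma s_has_derivative: "(s has_derivative frechet_derivative s (at (x, l))) (at (x, l))"
  by (rule higher_differentiable_on_has_derivative[OF s_smooth]) (use x_ball in auto)

text \<open>\<open>s\<close> is affine in the multiplier, so this partial derivative is the adjoint
  of \<open>DG x\<close>.\<close>

lemma Ds_multiplier: "frechet_derivative s (at (x, l)) (0, k) \<bullet> t = DG x t \<bullet> k"
proof -
  let ?c = "\<lambda>r::real. (x, l + r *\<^sub>R k)"
  have c: "(?c has_derivative (\<lambda>r. (0, r *\<^sub>R k))) (at 0)"
    by (auto intro!: derivative_eq_intros)
  have "((\<lambda>r. s (?c r) \<bullet> t) has_derivative (\<lambda>r. frechet_derivative s (at (x, l)) (0, r *\<^sub>R k) \<bullet> t)) (at 0)"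
    by (rule has_derivative_inner_left, rule has_derivative_compose[OF c]) (simp add: s_has_derivative)
  moreover have "((\<lambda>r. s (?c r) \<bullet> t) has_derivative (\<lambda>r. r * (DG x t \<bullet> k))) (at 0)"
    unfolding s_inner[OF x_ball] by (auto intro!: derivative_eq_intros simp: inner_add_right)
  ultimately have "(\<lambda>r. frechet_derivative s (at (x, l)) (0, r *\<^sub>R k) \<bullet> t) = (\<lambda>r. r * (DG x t \<bullet> k))"
    by (rule has_derivative_unique)
  from fun_cong[OF this, of 1] show ?thesis by simp
qed

text \<open>A kernel vector of the linearized equations is the velocity of a curve
  \<open>(z r, K r)\<close> on which \<open>e\<close> vanishes, so \<open>s\<close> takes
  subgradient values there. The hypomonotonicity inequality against \<open>v\<close> is divided by
  \<open>r\<^sup>2\<close> and the limit is taken.\<close>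

lemma Ds_curvature:
  assumes l: "s (x, l) = v" "P l = 0" and uk: "frechet_derivative e (at (x, l)) (u, k) = 0"
  shows "- \<sigma> * (norm u)\<^sup>2 \<le> frechet_derivative s (at (x, l)) (u, k) \<bullet> u"
proof -
  note uk' = De_eq_0[OF uk]
  obtain V \<tau> where V: "x \<in> V"
    "\<And>y t. y \<in> V \<Longrightarrow> y \<in> M \<Longrightarrow> DG y t = 0 \<Longrightarrow> \<exists>z. z 0 = y \<and> (z has_vector_derivative t) (at 0) \<and>
      (\<forall>\<^sub>F s in at 0. z s \<in> M)"
    by (rule tangent_transport) blast
  obtain z where z: "z 0 = x" "(z has_vector_derivative u) (at 0)" "\<forall>\<^sub>F r in at 0. z r \<in> M"
    using V(2)[OF V(1) x_M uk'(2)] by blast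
  have zd: "(z has_derivative (\<lambda>r. r *\<^sub>R u)) (at 0)"
    using z(2) by (simp add: has_vector_derivative_def)
  have z_lim: "(z \<longlongrightarrow> x) (at 0)"
    using has_derivative_continuous[OF zd] z(1) by (simp add: isCont_def)
  \<comment> \<open>\<open>P\<close> annihilates both \<open>l\<close> and \<open>k\<close>, so a
    straight line of multipliers keeps the normalization exactly.\<close>
  define K where "K = (\<lambda>r::real. l + r *\<^sub>R k)"
  have "(K \<longlongrightarrow> l + 0 *\<^sub>R k) (at 0)" unfolding K_def by (intro tendsto_intros)
  then have K_lim: "(K \<longlongrightarrow> l) (at 0)" by simp
  have c: "((\<lambda>r. (z r, K r)) has_derivative (\<lambda>r. (r *\<^sub>R u, r *\<^sub>R k))) (at 0)"
    unfolding K_def by (auto intro!: derivative_eq_intros zd)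
  let ?D = "frechet_derivative s (at (x, l))"
  have "((\<lambda>r. s (z r, K r)) has_derivative (\<lambda>r. ?D (r *\<^sub>R u, r *\<^sub>R k))) (at 0)"
    by (rule has_derivative_compose[OF c]) (simp add: z(1) K_def s_has_derivative)
  moreover have "?D (r *\<^sub>R u, r *\<^sub>R k) = r *\<^sub>R ?D (u, k)" for r
    using linear_cmul[OF has_derivative_linear[OF s_has_derivative], of l r "(u, k)"] by simp
  ultimately have sd: "((\<lambda>r. s (z r, K r)) has_vector_derivative ?D (u, k)) (at 0)"
    by (simp add: has_vector_derivative_def)
  have s0: "s (z 0, K 0) = v" by (simp add: z(1) K_def l)
  obtain \<delta> where \<delta>: "0 < \<delta>"
    "\<And>y k. dist y x < \<delta> \<Longrightarrow> dist k l < \<delta> \<Longrightarrow> e (y, k) = 0 \<Longrightarrow> s (y, k) \<in> subdiff \<phi> y"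
    using subgradient_on_graph[OF l] by blast
  have "\<forall>\<^sub>F r in at 0. z r \<in> ball x \<epsilon>"
    by (rule topological_tendstoD[OF z_lim]) (use x_ball in auto)
  with tendstoD[OF z_lim \<delta>(1)] tendstoD[OF K_lim \<delta>(1)] z(3) eventually_neq_at_within[of 0]
  have "\<forall>\<^sub>F r in at 0. - \<sigma> * (norm ((z r - z 0) /\<^sub>R r))\<^sup>2
      \<le> ((s (z r, K r) - s (z 0, K 0)) /\<^sub>R r) \<bullet> ((z r - z 0) /\<^sub>R r)"
  proof eventually_elim
    case (elim r)
    have "P (K r) = 0"
      using uk'(3) l(2) by (simp add: K_def linear_add[OF P_linear] linear_cmul[OF P_linear])
    then have "s (z r, K r) \<in> subdiff \<phi> (z r)"
      using elim M_eq by (intro \<delta>(2)) (auto simp: e_eq_0)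
    from subdiff_hypomonotone[OF weakly_convex this v_subdiff]
    have "- \<sigma> * (norm (z r - x))\<^sup>2 \<le> (s (z r, K r) - v) \<bullet> (z r - x)" .
    then have "(- \<sigma> * (norm (z r - x))\<^sup>2) / r\<^sup>2 \<le> ((s (z r, K r) - v) \<bullet> (z r - x)) / r\<^sup>2"
      by (rule divide_right_mono) simp
    moreover have "(norm ((z r - x) /\<^sub>R r))\<^sup>2 = (norm (z r - x))\<^sup>2 / r\<^sup>2"
      by (simp add: power_mult_distrib power_inverse divide_inverse mult.commute)
    moreover have "((s (z r, K r) - v) /\<^sub>R r) \<bullet> ((z r - x) /\<^sub>R r) = ((s (z r, K r) - v) \<bullet> (z r - x)) / r\<^sup>2"
      by (simp add: power2_eq_square divide_inverse mult_ac)
    ultimately show ?case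
      unfolding s0 unfolding z(1) by simp
  qed
  moreover have "((\<lambda>r. - \<sigma> * (norm ((z r - z 0) /\<^sub>R r))\<^sup>2) \<longlongrightarrow> - \<sigma> * (norm u)\<^sup>2) (at 0)"
    by (intro tendsto_intros vector_derivative_difference_quotient z(2))
  moreover have "((\<lambda>r. ((s (z r, K r) - s (z 0, K 0)) /\<^sub>R r) \<bullet> ((z r - z 0) /\<^sub>R r)) \<longlongrightarrow> ?D (u, k) \<bullet> u) (at 0)"
    by (intro tendsto_intros vector_derivative_difference_quotient z(2)
        vector_derivative_difference_quotient[OF sd])
  ultimately show ?thesis
    by (intro tendsto_le[OF at_neq_bot])
qed

end

text \<open>Near \<open>(x, v)\<close> the graph of the subdifferential contains the points \<open>(y, s (y, l))\<close> with
  \<open>e (y, l) = 0\<close>; here \<open>l\<close> is a multiplier of the equations of the active manifold.\<close>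

locale subdifferential_chart =
  fixes \<phi> :: "'a::euclidean_space \<Rightarrow> ereal" and \<sigma> :: real and T :: "'a set" and x v :: 'a
    and s e :: "'a \<times> 'a \<Rightarrow> 'a" and l :: 'a and \<delta> :: real
  assumes \<delta>: "0 < \<delta>"
    and s_smooth: "higher_differentiable_on (fst -` ball x \<delta>) s 2"
    and e_smooth: "higher_differentiable_on (fst -` ball x \<delta>) e 2"
    and base: "s (x, l) = v" "e (x, l) = 0"
    and graph: "\<And>y k. dist y x < \<delta> \<Longrightarrow> dist k l < \<delta> \<Longrightarrow> e (y, k) = 0 \<Longrightarrow> s (y, k) \<in> subdiff \<phi> y"
    and tangent: "\<And>u k. frechet_derivative e (at (x, l)) (u, k) = 0 \<Longrightarrow> u \<in> T"
    and curvature: "\<And>u k. frechet_derivative e (at (x, l)) (u, k) = 0 \<Longrightarrow>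
      - \<sigma> * (norm u)\<^sup>2 \<le> frechet_derivative s (at (x, l)) (u, k) \<bullet> u"
    and normal: "\<And>k t. t \<in> T \<Longrightarrow> frechet_derivative s (at (x, l)) (0, k) \<bullet> t = 0"
    and multiplier: "\<And>k. frechet_derivative e (at (x, l)) (0, k) = 0 \<Longrightarrow>
      frechet_derivative s (at (x, l)) (0, k) = 0 \<Longrightarrow> k = 0"

lemma (in manifold_equation) shrink:
  assumes "0 < \<epsilon>'" "\<epsilon>' \<le> \<epsilon>"
  shows "manifold_equation p M T x G P \<epsilon>'"
  by (rule manifold_equation.intro)
     (use assms p T G_smooth G_normal P_linear P_tangent P_eq_0 M_eq x_M T_eq in auto)

text \<open>Collects the preceding facts into an interface that serves \<open>g\<close> with its own
  modulus and \<open>f\<close> with modulus \<open>0\<close>; the radius is shrunk so that all local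
  conditions hold on one ball.\<close>

lemma active_manifold_subdifferential_chart:
  assumes \<sigma>: "0 \<le> \<sigma>" and wc: "weakly_convex \<sigma> \<phi>" and active: "active_manifold 3 \<phi> M x"
    and v: "v \<in> rel_interior (subdiff \<phi> x)"
  obtains s e l \<delta> where "subdifferential_chart \<phi> \<sigma> (tangent_space 3 M x) x v s e l \<delta>"
proof -
  obtain r where r: "smooth_manifold_at 3 r M x" using active by (auto simp: active_manifold_def)
  obtain \<epsilon>1 \<psi> where \<psi>: "\<epsilon>1 > 0" "higher_differentiable_on (ball x \<epsilon>1) \<psi> 3"
    "\<And>y. y \<in> M \<Longrightarrow> y \<in> ball x \<epsilon>1 \<Longrightarrow> \<phi> y = ereal (\<psi> y)"
    using active unfolding active_manifold_def smooth_restriction_at_def by blast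
  obtain \<epsilon>2 where \<epsilon>2: "\<epsilon>2 > 0" "\<And>y. y \<in> M \<Longrightarrow> y \<in> ball x \<epsilon>2 \<Longrightarrow> regular_at \<phi> y \<and> subdiff \<phi> y \<noteq> {}"
    using active unfolding active_manifold_def by blast
  define T where "T = tangent_space 3 M x"
  obtain G P \<epsilon>3 where m: "manifold_equation 3 M T x G P \<epsilon>3"
    using manifold_equation_exists[OF r] unfolding T_def by auto
  define \<epsilon> where "\<epsilon> = min \<epsilon>1 (min \<epsilon>2 \<epsilon>3)"
  have \<epsilon>: "0 < \<epsilon>" using \<psi>(1) \<epsilon>2(1) manifold_equation.\<epsilon>[OF m] by (simp add: \<epsilon>_def)
  interpret active_point M T x G P \<epsilon> \<phi> \<psi> \<sigma> v
  proof (rule active_point.intro)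
    show "manifold_equation 3 M T x G P \<epsilon>"
      by (rule manifold_equation.shrink[OF m \<epsilon>]) (simp add: \<epsilon>_def)
    show "active_point_axioms M T x \<epsilon> \<phi> \<psi> \<sigma> v"
    proof (rule active_point_axioms.intro[OF \<sigma> wc v])
      show "higher_differentiable_on (ball x \<epsilon>) \<psi> 3"
        by (rule higher_differentiable_on_subset[OF \<psi>(2)]) (auto simp: \<epsilon>_def)
      show "- subderivative \<phi> x u < subderivative \<phi> x (- u)"
        if "\<And>t. t \<in> T \<Longrightarrow> u \<bullet> t = 0" "u \<noteq> 0" for u
      proof -
        have "u \<in> normal_space 3 M x"
          using that(1) by (auto simp: normal_space_def orthogonal_comp_def orthogonal_def T_def inner_commute)
        then show ?thesis using active that(2) by (auto simp: active_manifold_def)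
      qed
      show "setvalued_continuous_at (clarke_subdiff \<phi>) M x"
        using active by (simp add: active_manifold_def)
    qed (use \<psi>(3) \<epsilon>2(2) in \<open>auto simp: \<epsilon>_def\<close>)
  qed
  obtain l where l: "s (x, l) = v" "P l = 0" using multiplier_exists by blast
  obtain \<delta>0 where \<delta>0: "0 < \<delta>0"
    "\<And>y k. dist y x < \<delta>0 \<Longrightarrow> dist k l < \<delta>0 \<Longrightarrow> e (y, k) = 0 \<Longrightarrow> s (y, k) \<in> subdiff \<phi> y"
    using subgradient_on_graph[OF l] by blast
  have sub: "fst -` ball x (min \<delta>0 \<epsilon>) \<subseteq> fst -` ball x \<epsilon>" by auto
  have "subdifferential_chart \<phi> \<sigma> T x v s e l (min \<delta>0 \<epsilon>)"
  proof
    show "0 < min \<delta>0 \<epsilon>" using \<delta>0(1) \<epsilon> by simp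
    show "higher_differentiable_on (fst -` ball x (min \<delta>0 \<epsilon>)) s 2"
      "higher_differentiable_on (fst -` ball x (min \<delta>0 \<epsilon>)) e 2"
      using higher_differentiable_on_subset[OF s_smooth sub] higher_differentiable_on_subset[OF e_smooth sub] .
    show "s (x, l) = v" by fact
    show "e (x, l) = 0" using x_M M_eq[OF x_ball] l(2) by (simp add: e_eq_0)
    show "s (y, k) \<in> subdiff \<phi> y" if "dist y x < min \<delta>0 \<epsilon>" "dist k l < min \<delta>0 \<epsilon>" "e (y, k) = 0" for y k
      using that by (intro \<delta>0(2)) auto
    show "u \<in> T" if "frechet_derivative e (at (x, l)) (u, k) = 0" for u k
      by (rule De_eq_0(1)[OF that])
    show "- \<sigma> * (norm u)\<^sup>2 \<le> frechet_derivative s (at (x, l)) (u, k) \<bullet> u"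
      if "frechet_derivative e (at (x, l)) (u, k) = 0" for u k
      by (rule Ds_curvature[OF l that])
    show "frechet_derivative s (at (x, l)) (0, k) \<bullet> t = 0" if "t \<in> T" for k t
      using that T_eq by (auto simp: Ds_multiplier)
    show "k = 0" if "frechet_derivative e (at (x, l)) (0, k) = 0" "frechet_derivative s (at (x, l)) (0, k) = 0" for k
      using multiplier_unique De_eq_0(3)[OF that(1)] Ds_multiplier[of l k] that(2) by (metis inner_zero_left)
  qed
  then show ?thesis using that unfolding T_def by blast
qed

section \<open>The prox-linear subproblem\<close>

text \<open>Lowering each height by \<open>a y\<close> brings the point into a convex epigraph;
  convexity of \<open>a\<close> pays for the return.\<close>

lemma weakly_convex_add_convex:
  fixes a :: "'a::euclidean_space \<Rightarrow> real"
  assumes a: "convex_on UNIV a" and wc: "weakly_convex \<sigma> g"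
  shows "weakly_convex \<sigma> (\<lambda>x. ereal (a x) + g x)"
  unfolding weakly_convex_def convex_fun_def convex_alt
proof (intro ballI allI impI)
  let ?G = "\<lambda>x. g x + ereal (\<sigma> / 2 * (norm x)\<^sup>2)"
  let ?E = "epi (\<lambda>x. ereal (a x) + g x + ereal (\<sigma> / 2 * (norm x)\<^sup>2))"
  have shift: "(y, t) \<in> ?E \<longleftrightarrow> (y, t - a y) \<in> epi ?G" for y t
    by (cases "g y") (auto simp: epi_iff)
  fix p q :: "'a \<times> real" and l :: real
  assume pq: "p \<in> ?E" "q \<in> ?E" and l: "0 \<le> l \<and> l \<le> 1"
  obtain y1 t1 y2 t2 where [simp]: "p = (y1, t1)" "q = (y2, t2)" by (cases p, cases q)
  let ?y = "(1 - l) *\<^sub>R y1 + l *\<^sub>R y2"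
  have "convex (epi ?G)" using wc by (simp add: weakly_convex_def convex_fun_def)
  moreover have "(y1, t1) \<in> ?E" "(y2, t2) \<in> ?E" using pq by simp_all
  then have "(y1, t1 - a y1) \<in> epi ?G" "(y2, t2 - a y2) \<in> epi ?G"
    by (blast intro: shift[THEN iffD1])+
  ultimately have "(1 - l) *\<^sub>R (y1, t1 - a y1) + l *\<^sub>R (y2, t2 - a y2) \<in> epi ?G"
    using l by (intro convexD_alt) blast+
  then have "?G ?y \<le> ereal ((1 - l) * (t1 - a y1) + l * (t2 - a y2))" by (simp add: epi_iff)
  also have "\<dots> \<le> ereal ((1 - l) * t1 + l * t2 - a ?y)"
    using convex_onD[OF a, of l y1 y2] l by (simp add: algebra_simps)
  finally have "(?y, (1 - l) * t1 + l * t2) \<in> ?E"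
    by (intro shift[THEN iffD2]) (simp only: epi_iff)
  then show "(1 - l) *\<^sub>R p + l *\<^sub>R q \<in> ?E" by simp
qed

lemma convex_on_affine:
  fixes f :: "'b::real_vector \<Rightarrow> real" and A :: "'a::real_vector \<Rightarrow> 'b"
  assumes f: "convex_on UNIV f" and A: "linear A"
  shows "convex_on UNIV (\<lambda>y. f (c + A (y - x)))"
proof (intro convex_onI)
  fix t :: real and y z assume t: "0 < t" "t < 1"
  have "c + A ((1 - t) *\<^sub>R y + t *\<^sub>R z - x) = (1 - t) *\<^sub>R (c + A (y - x)) + t *\<^sub>R (c + A (z - x))"
    by (simp add: linear_add[OF A] linear_diff[OF A] linear_cmul[OF A] algebra_simps)
  then show "f (c + A ((1 - t) *\<^sub>R y + t *\<^sub>R z - x)) \<le> (1 - t) * f (c + A (y - x)) + t * f (c + A (z - x))"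
    using convex_onD[OF f, of t "c + A (y - x)" "c + A (z - x)"] t by simp
qed simp

lemma convex_on_norm_sq:
  fixes x :: "'a::real_inner"
  assumes "0 \<le> k"
  shows "convex_on UNIV (\<lambda>y. k * (norm (y - x))\<^sup>2)"
proof (intro convex_onI)
  fix t :: real and y z :: 'a assume t: "0 < t" "t < 1"
  have "k * (norm ((1 - t) *\<^sub>R y + t *\<^sub>R z - x))\<^sup>2
     = (1 - t) * (k * (norm (y - x))\<^sup>2) + t * (k * (norm (z - x))\<^sup>2) - k * (t * (1 - t) * (norm (y - z))\<^sup>2)"
    unfolding norm_sq_convex_combination by (simp add: algebra_simps)
  also have "\<dots> \<le> (1 - t) * (k * (norm (y - x))\<^sup>2) + t * (k * (norm (z - x))\<^sup>2)"
    using t assms by simp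
  finally show "k * (norm ((1 - t) *\<^sub>R y + t *\<^sub>R z - x))\<^sup>2 \<le> (1 - t) * (k * (norm (y - x))\<^sup>2) + t * (k * (norm (z - x))\<^sup>2)" .
qed simp

text \<open>A smaller epigraph has a larger regular normal cone.\<close>

lemma subdiff_mono:
  assumes \<nu>: "\<nu> \<in> subdiff \<phi> x" and le: "\<And>y. \<phi> y \<le> \<psi> y" and eq: "\<phi> x = \<psi> x"
  shows "\<nu> \<in> subdiff \<psi> x"
proof -
  have sub: "epi \<psi> \<subseteq> epi \<phi>" using le by (auto simp: epi_def intro: order_trans)
  have fin: "\<bar>\<psi> x\<bar> \<noteq> \<infinity>" using \<nu> eq by (simp add: subdiff_def)
  let ?z = "(x, real_of_ereal (\<psi> x))"
  let ?q = "\<lambda>y. ereal (((\<nu>, -1) \<bullet> (y - ?z)) / norm (y - ?z))"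
  have "Limsup (at ?z within epi \<psi>) ?q \<le> Limsup (at ?z within epi \<phi>) ?q"
    unfolding Limsup_def by (rule INF_superset_mono) (auto intro: filter_leD[OF at_le[OF sub]])
  also have "\<dots> \<le> 0" using \<nu> eq by (simp add: subdiff_def regular_normal_cone_def)
  finally show ?thesis
    using fin by (simp add: subdiff_def regular_normal_cone_def epi_iff ereal_real)
qed

text \<open>The multiplier \<open>w\<close> is a subgradient at \<open>0\<close> of the convex value function
  \<open>z \<mapsto> inf\<^sub>y f (h x + A (y - x) + z) + g y + K / 2 * (norm (y - x))\<^sup>2\<close>.\<close>

lemma critical_point_multiplier:
  fixes f :: "'b::euclidean_space \<Rightarrow> real" and g :: "'a::euclidean_space \<Rightarrow> ereal" and h :: "'a \<Rightarrow> 'b"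
  assumes f: "convex_on UNIV f" and \<sigma>: "0 \<le> \<sigma>" and wc: "weakly_convex \<sigma> g" and A: "linear A"
    and \<eta>: "0 \<le> \<eta>" and model: "\<And>y. f (h y) \<le> f (h x + A (y - x)) + \<eta> / 2 * (norm (y - x))\<^sup>2"
    and crit: "0 \<in> subdiff (\<lambda>y. ereal (f (h y)) + g y) x"
  obtains w where "w \<in> subdiff (\<lambda>z. ereal (f z)) (h x)" "- adjoint A w \<in> subdiff g x"
proof -
  define c where "c = (\<lambda>y. h x + A (y - x))"
  have cx: "c x = h x" by (simp add: c_def linear_0[OF A])
  have "\<bar>ereal (f (h x)) + g x\<bar> \<noteq> \<infinity>" using crit by (simp add: subdiff_def)
  then have g_fin: "\<bar>g x\<bar> \<noteq> \<infinity>" by (cases "g x") auto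
  then obtain g0 where g0: "g x = ereal g0" by (cases "g x") auto
  define a where "a = (\<lambda>y. f (c y) + \<eta> / 2 * (norm (y - x))\<^sup>2)"
  have a: "convex_on UNIV a"
    unfolding a_def c_def
    by (rule convex_on_add[OF convex_on_affine[OF f A] convex_on_norm_sq]) (use \<eta> in simp)
  \<comment> \<open>\<open>\<sigma>\<close> compensates the weak convexity of \<open>g\<close> and
    makes \<open>C\<close> convex; \<open>\<eta>\<close> compensates the model error. The sum also
    absorbs both quadratic terms in \<open>lower\<close>.\<close>
  define K where "K = \<sigma> + \<eta>"
  have K: "0 \<le> K" "\<sigma> \<le> K" using \<sigma> \<eta> by (auto simp: K_def)
  \<comment> \<open>Criticality passes to the majorant in which \<open>h\<close> is linearized,
    since both functions agree at \<open>x\<close>. For this majorant the subgradient inequality is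
    global.\<close>
  have zero: "0 \<in> subdiff (\<lambda>y. ereal (a y) + g y) x"
  proof (rule subdiff_mono[OF crit])
    show "ereal (f (h y)) + g y \<le> ereal (a y) + g y" for y
      using model[of y] by (intro add_right_mono) (simp add: a_def c_def)
  qed (simp add: a_def cx)
  have lower: "f (h x) + g0 - \<sigma> / 2 * (norm (y - x))\<^sup>2 \<le> a y + r" if "(y, r) \<in> epi g" for y r
  proof -
    have "(y, a y + r) \<in> epi (\<lambda>y. ereal (a y) + g y)"
      using that by (cases "g y") (auto simp: epi_iff)
    from subdiff_lower_bound[OF weakly_convex_add_convex[OF a wc] zero this]
    show ?thesis by (simp add: g0 a_def cx)
  qed
  define p0 where "p0 = f (h x) + g0"
  \<comment> \<open>A projection of a joint epigraph, so that no attainment of the infimum over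
    \<open>y\<close> has to be discussed.\<close>
  define C where "C = {(z, t). \<exists>y r. (y, r) \<in> epi g \<and> f (c y + z) + r + K / 2 * (norm (y - x))\<^sup>2 \<le> t}"
  have C_I: "(z, t) \<in> C" if "(y, r) \<in> epi g" "f (c y + z) + r + K / 2 * (norm (y - x))\<^sup>2 \<le> t" for z t y r
    using that by (auto simp: C_def)
  have convC: "convex C"
    unfolding convex_alt
  proof (intro ballI allI impI)
    fix p q :: "'b \<times> real" and l :: real
    assume pq: "p \<in> C" "q \<in> C" and l: "0 \<le> l \<and> l \<le> 1"
    obtain z1 t1 z2 t2 where [simp]: "p = (z1, t1)" "q = (z2, t2)" by (cases p, cases q)
    obtain y1 r1 y2 r2 where
      1: "(y1, r1) \<in> epi g" "f (c y1 + z1) + r1 + K / 2 * (norm (y1 - x))\<^sup>2 \<le> t1" and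
      2: "(y2, r2) \<in> epi g" "f (c y2 + z2) + r2 + K / 2 * (norm (y2 - x))\<^sup>2 \<le> t2"
      using pq by (auto simp: C_def)
    let ?y = "(1 - l) *\<^sub>R y1 + l *\<^sub>R y2" and ?z = "(1 - l) *\<^sub>R z1 + l *\<^sub>R z2"
    let ?D = "l * (1 - l) * (norm (y1 - y2))\<^sup>2"
    let ?r = "(1 - l) * r1 + l * r2 + \<sigma> / 2 * ?D"
    have epi: "(?y, ?r) \<in> epi g" using weakly_convex_epi[OF wc 1(1) 2(1)] l by simp
    have "c ?y + ?z = (1 - l) *\<^sub>R (c y1 + z1) + l *\<^sub>R (c y2 + z2)"
      by (simp add: c_def linear_add[OF A] linear_diff[OF A] linear_cmul[OF A] algebra_simps)
    then have f1: "f (c ?y + ?z) \<le> (1 - l) * f (c y1 + z1) + l * f (c y2 + z2)"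
      using convex_onD[OF f, of l "c y1 + z1" "c y2 + z2"] l by simp
    have n1: "k * (norm (?y - x))\<^sup>2 = (1 - l) * (k * (norm (y1 - x))\<^sup>2) + l * (k * (norm (y2 - x))\<^sup>2) - k * ?D" for k
      unfolding norm_sq_convex_combination by (simp add: algebra_simps)
    have D: "\<sigma> / 2 * ?D \<le> K / 2 * ?D" using K(2) l by (intro mult_right_mono) auto
    have "f (c ?y + ?z) + ?r + K / 2 * (norm (?y - x))\<^sup>2
       \<le> (1 - l) * (f (c y1 + z1) + r1 + K / 2 * (norm (y1 - x))\<^sup>2) + l * (f (c y2 + z2) + r2 + K / 2 * (norm (y2 - x))\<^sup>2)"
      using f1 n1[of "K / 2"] D unfolding distrib_left by linarith
    also have "\<dots> \<le> (1 - l) * t1 + l * t2"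
      using 1(2) 2(2) l by (intro add_mono mult_left_mono) auto
    finally show "(1 - l) *\<^sub>R p + l *\<^sub>R q \<in> C" using C_I[OF epi] by simp
  qed
  have C0: "p0 \<le> t" if t: "(0, t) \<in> C" for t
  proof -
    obtain y r where yr: "(y, r) \<in> epi g" "f (c y) + r + K / 2 * (norm (y - x))\<^sup>2 \<le> t"
      using t by (auto simp: C_def)
    from lower[OF yr(1)] yr(2) show ?thesis by (simp add: p0_def a_def K_def algebra_simps add_divide_distrib)
  qed
  have xC: "(z, f (h x + z) + g0) \<in> C" for z
    by (rule C_I[of x g0]) (simp_all add: epi_iff g0 cx)
  have disj: "({0} \<times> {..<p0}) \<inter> C = {}" using C0 by fastforce
  have conv0: "convex ({0 :: 'b} \<times> {..<p0})" by (intro convex_Times) auto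
  have ne: "{0 :: 'b} \<times> {..<p0} \<noteq> {}" "C \<noteq> {}" using xC by auto
  obtain qb b where qb: "qb \<noteq> 0" "\<forall>k\<in>{0} \<times> {..<p0}. qb \<bullet> k \<le> b" "\<forall>k\<in>C. b \<le> qb \<bullet> k"
    using separating_hyperplane_sets[OF conv0 convC ne disj] by blast
  then have sep: "qb \<noteq> 0" "\<And>t. t < p0 \<Longrightarrow> qb \<bullet> (0, t) \<le> b" "\<And>k. k \<in> C \<Longrightarrow> b \<le> qb \<bullet> k"
    by blast+
  obtain q \<beta> where [simp]: "qb = (q, \<beta>)" by (cases qb)
  \<comment> \<open>The ray contains \<open>(0, t)\<close> for arbitrarily small \<open>t\<close>,
    so a negative last component would make the functional unbounded above on it.\<close>
  have \<beta>0: "0 \<le> \<beta>"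
  proof (rule ccontr)
    assume n: "\<not> 0 \<le> \<beta>"
    have "b + 1 \<le> \<beta> * min (p0 - 1) ((b + 1) / \<beta>)"
      using n mult_left_mono_neg[of "min (p0 - 1) ((b + 1) / \<beta>)" "(b + 1) / \<beta>" \<beta>] by simp
    with sep(2)[of "min (p0 - 1) ((b + 1) / \<beta>)"] show False by (simp add: min_less_iff_disj)
  qed
  \<comment> \<open>No constraint qualification enters: \<open>f\<close> is finite everywhere, so
    \<open>C\<close> has points over every \<open>z\<close>, and \<open>z = - q\<close> rules out a
    vertical hyperplane.\<close>
  have "\<beta> \<noteq> 0"
  proof
    assume \<beta>: "\<beta> = 0"
    have "0 \<le> b" using sep(2)[of "p0 - 1"] \<beta> by simp
    moreover have "b \<le> q \<bullet> (- q)" using sep(3)[OF xC[of "- q"]] \<beta> by simp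
    ultimately have "q \<bullet> q \<le> 0" by simp
    then have "q = 0" by (metis inner_gt_zero_iff not_less)
    with sep(1) \<beta> show False by (simp add: zero_prod_def)
  qed
  with \<beta>0 have \<beta>: "0 < \<beta>" by simp
  have b: "\<beta> * p0 \<le> b"
  proof (rule field_le_epsilon)
    fix e :: real assume "0 < e"
    then show "\<beta> * p0 \<le> b + e" using sep(2)[of "p0 - e / \<beta>"] \<beta> by (simp add: algebra_simps)
  qed
  define w where "w = - (q /\<^sub>R \<beta>)"
  have w: "p0 + w \<bullet> z \<le> t" if "(z, t) \<in> C" for z t
  proof -
    have "\<beta> * p0 \<le> q \<bullet> z + \<beta> * t" using sep(3)[OF that] b by simp
    moreover have "\<beta> * (w \<bullet> z) = - (q \<bullet> z)" using \<beta> by (simp add: w_def)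
    ultimately have "\<beta> * (p0 + w \<bullet> z) \<le> \<beta> * t" by (simp add: distrib_left)
    then show ?thesis using \<beta> by simp
  qed
  show ?thesis
  proof (rule that[of w])
    show "w \<in> subdiff (\<lambda>z. ereal (f z)) (h x)"
    proof (rule subdiffI[of 0])
      fix u t assume "(u, t) \<in> epi (\<lambda>z. ereal (f z))"
      then have "f u \<le> t" by (simp add: epi_iff)
      with w[OF xC[of "u - h x"]]
      show "real_of_ereal (ereal (f (h x))) + w \<bullet> (u - h x) - 0 / 2 * (norm (u - h x))\<^sup>2 \<le> t"
        by (simp add: p0_def)
    qed auto
    show "- adjoint A w \<in> subdiff g x"
    proof (rule subdiffI[where \<phi>=g and x=x, OF K(1) g_fin])
      fix y r assume yr: "(y, r) \<in> epi g"
      \<comment> \<open>The perturbation \<open>- A (y - x)\<close> cancels the linear part of the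
        model, which leaves \<open>f\<close> at \<open>h x\<close> and isolates
        \<open>g\<close>.\<close>
      have "(- A (y - x), f (h x) + r + K / 2 * (norm (y - x))\<^sup>2) \<in> C"
        by (rule C_I[OF yr]) (simp add: c_def)
      from w[OF this] show "real_of_ereal (g x) + - adjoint A w \<bullet> (y - x) - K / 2 * (norm (y - x))\<^sup>2 \<le> r"
        using adjoint_works[OF A, of "y - x" w] by (simp add: g0 p0_def inner_commute)
    qed
  qed
qed

text \<open>Strong convexity (\<open>\<beta> \<sigma> < 1\<close>) turns the stationarity condition into unique minimality.\<close>

lemma prox_linear_arg_min:
  fixes f :: "'b::euclidean_space \<Rightarrow> real" and g :: "'a::euclidean_space \<Rightarrow> ereal" and A :: "'a \<Rightarrow> 'b"
  assumes f: "convex_on UNIV f" and wc: "weakly_convex \<sigma> g" and g: "\<And>y. g y \<noteq> -\<infinity>" and A: "linear A"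
    and \<beta>: "0 < \<beta>" "\<beta> * \<sigma> < 1"
    and w: "w \<in> subdiff (\<lambda>z. ereal (f z)) (c + A (y - x))" and v: "v \<in> subdiff g y"
    and stationary: "adjoint A w + v + (y - x) /\<^sub>R \<beta> = 0"
  shows "arg_min (\<lambda>z. ereal (f (c + A (z - x))) + g z + ereal (1 / (2 * \<beta>) * (norm (z - x))\<^sup>2)) (\<lambda>z. True) = y"
proof -
  let ?\<Phi> = "\<lambda>z. ereal (f (c + A (z - x))) + g z + ereal (1 / (2 * \<beta>) * (norm (z - x))\<^sup>2)"
  have "\<bar>g y\<bar> \<noteq> \<infinity>" using v by (simp add: subdiff_def)
  then obtain g0 where g0: "g y = ereal g0" by (cases "g y") auto
  have less: "?\<Phi> y < ?\<Phi> z" if ne: "z \<noteq> y" for z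
  proof (cases "g z")
    case (real r)
    have "g0 + v \<bullet> (z - y) - \<sigma> / 2 * (norm (z - y))\<^sup>2 \<le> r"
      using subdiff_lower_bound[OF wc v, of z r] real by (simp add: epi_iff g0)
    moreover have "f (c + A (y - x)) + w \<bullet> A (z - y) \<le> f (c + A (z - x))"
      using subdiff_lower_bound[OF weakly_convex_0_convex_on[OF f] w, of "c + A (z - x)" "f (c + A (z - x))"]
      by (simp add: epi_iff linear_diff[OF A, symmetric])
    moreover have "w \<bullet> A (z - y) + v \<bullet> (z - y) + (y - x) \<bullet> (z - y) / \<beta> = 0"
    proof -
      have "(adjoint A w + v + (y - x) /\<^sub>R \<beta>) \<bullet> (z - y) = 0" by (simp add: stationary)
      moreover have "adjoint A w \<bullet> (z - y) = w \<bullet> A (z - y)"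
        using adjoint_works[OF A, of "z - y" w] by (simp add: inner_commute)
      ultimately show ?thesis by (simp add: inner_add_left divide_inverse mult.commute)
    qed
    moreover have "1 / (2 * \<beta>) * (norm (z - x))\<^sup>2
        = 1 / (2 * \<beta>) * (norm (y - x))\<^sup>2 + (y - x) \<bullet> (z - y) / \<beta> + 1 / (2 * \<beta>) * (norm (z - y))\<^sup>2"
    proof -
      have "(norm (z - x))\<^sup>2 = (norm (y - x))\<^sup>2 + 2 * ((y - x) \<bullet> (z - y)) + (norm (z - y))\<^sup>2"
        unfolding power2_norm_eq_inner by (simp add: inner_diff inner_commute algebra_simps)
      then show ?thesis using \<beta> by (simp add: field_simps)
    qed
    moreover have "\<sigma> / 2 * (norm (z - y))\<^sup>2 < 1 / (2 * \<beta>) * (norm (z - y))\<^sup>2"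
      using \<beta> ne by (intro mult_strict_right_mono) (auto simp: field_simps)
    ultimately have "f (c + A (y - x)) + g0 + 1 / (2 * \<beta>) * (norm (y - x))\<^sup>2
      < f (c + A (z - x)) + r + 1 / (2 * \<beta>) * (norm (z - x))\<^sup>2" by linarith
    then show ?thesis by (simp only: g0 real plus_ereal.simps less_ereal.simps)
  qed (use g[of z] in \<open>auto simp: g0\<close>)
  show ?thesis
    unfolding arg_min_def
  proof (rule some_equality)
    show "is_arg_min ?\<Phi> (\<lambda>z. True) y"
      using less by (force simp: is_arg_min_def)
    show "z = y" if "is_arg_min ?\<Phi> (\<lambda>z. True) z" for z
      using less that by (auto simp: is_arg_min_def)
  qed
qed

lemma adjoint_basis_sum:
  fixes A :: "'a::euclidean_space \<Rightarrow> 'b::euclidean_space"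
  assumes "linear A"
  shows "adjoint A w = (\<Sum>b\<in>Basis. (w \<bullet> A b) *\<^sub>R b)"
proof -
  have "adjoint A w \<bullet> b = w \<bullet> A b" for b
    using adjoint_works[OF assms, of b w] by (simp add: inner_commute)
  then show ?thesis using euclidean_representation[of "adjoint A w"] by simp
qed

text \<open>The stationarity conditions of the prox-linear subproblem, with multipliers \<open>k\<close> and \<open>m\<close> of
  the two manifolds, are solved for \<open>(y, k, m)\<close> as functions of \<open>x\<close>.  Pairing a kernel vector
  \<open>(u, k, m)\<close> of the linearization with \<open>u\<close> gives \<open>u = 0\<close> by the curvature bounds, and then the
  transversality condition gives \<open>k = 0\<close> and \<open>m = 0\<close>.\<close>

lemma smooth_stationary_point:
  fixes h :: "'a::euclidean_space \<Rightarrow> 'b::euclidean_space"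
  defines "A \<equiv> \<lambda>x. frechet_derivative h (at x)"
  assumes cg: "subdifferential_chart g \<sigma> Tg xs v sg eg lg \<delta>g"
    and cf: "subdifferential_chart \<phi> 0 Tf (h xs) w sf ef lf \<delta>f"
    and wv: "adjoint (A xs) w + v = 0"
    and transversal: "\<And>z. \<exists>a\<in>Tg. \<exists>b\<in>Tf. z = A xs a + b"
    and h: "0 < \<epsilon>" "higher_differentiable_on (ball xs \<epsilon>) h 4"
    and \<beta>: "0 < \<beta>" "\<beta> * \<sigma> < 1"
  obtains \<rho> Y where "0 < \<rho>" "\<rho> \<le> \<epsilon>" "higher_differentiable_on (ball xs \<rho>) Y 2" "Y xs = xs"
    "\<And>x. x \<in> ball xs \<rho> \<Longrightarrow> \<exists>w\<in>subdiff \<phi> (h x + A x (Y x - x)). \<exists>v\<in>subdiff g (Y x).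
      adjoint (A x) w + v + (Y x - x) /\<^sub>R \<beta> = 0"
proof -
  interpret g: subdifferential_chart g \<sigma> Tg xs v sg eg lg \<delta>g by (rule cg)
  interpret f: subdifferential_chart \<phi> 0 Tf "h xs" w sf ef lf \<delta>f by (rule cf)
  have h_der: "(h has_derivative A x) (at x)" if "x \<in> ball xs \<epsilon>" for x
    unfolding A_def by (rule higher_differentiable_on_has_derivative[OF h(2)]) (use that in auto)
  have A_lin: "linear (A x)" if "x \<in> ball xs \<epsilon>" for x
    using h_der[OF that] by (rule has_derivative_linear)
  have A_smooth: "higher_differentiable_on (ball xs \<epsilon>) (\<lambda>x. A x b) 2" for b
    unfolding A_def
    by (rule higher_differentiable_on_frechet[OF higher_differentiable_on_le[OF h(2)]]) simp
  have h_smooth: "higher_differentiable_on (ball xs \<epsilon>) h 2"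
    by (rule higher_differentiable_on_le[OF h(2)]) simp
  have xs: "xs \<in> ball xs \<epsilon>" using h(1) by simp
  define U1 :: "('a \<times> 'a \<times> 'a \<times> 'b) set" where "U1 = fst -` ball xs \<epsilon>"
  have U1: "open U1" unfolding U1_def by (intro open_vimage continuous_intros) auto
  define c where "c = (\<lambda>p :: 'a \<times> 'a \<times> 'a \<times> 'b. h (fst p) + A (fst p) (fst (snd p) - fst p))"
  note lin1 = higher_differentiable_on_linear[OF U1]
  have fst1: "higher_differentiable_on U1 fst 2" by (rule lin1[OF linear_fst])
  have A1: "higher_differentiable_on U1 (\<lambda>p. A (fst p) b) 2" for b
    by (rule higher_differentiable_on_compose[OF U1 open_ball fst1 A_smooth]) (simp add: U1_def)
  have c_smooth: "higher_differentiable_on U1 c 2"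
    unfolding c_def
  proof (rule higher_differentiable_on_add[OF U1])
    show "higher_differentiable_on U1 (\<lambda>p. h (fst p)) 2"
      by (rule higher_differentiable_on_compose[OF U1 open_ball fst1 h_smooth]) (simp add: U1_def)
    show "higher_differentiable_on U1 (\<lambda>p. A (fst p) (fst (snd p) - fst p)) 2"
    proof (rule higher_differentiable_on_linear_apply[OF U1, where L="\<lambda>p. A (fst p)"])
      show "higher_differentiable_on U1 (\<lambda>p. fst (snd p) - fst p) 2"
        by (rule lin1) (auto intro!: linearI simp: algebra_simps)
    qed (use A_lin A1 in \<open>auto simp: U1_def\<close>)
  qed
  \<comment> \<open>The region where both charts may be evaluated: \<open>x\<close> near
    \<open>xs\<close>, the linearized value of \<open>h\<close> near \<open>h xs\<close>, and
    \<open>y\<close> near \<open>xs\<close>. The multipliers are unrestricted here.\<close>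
  define U where "U = (U1 \<inter> c -` ball (h xs) \<delta>f) \<inter> (fst \<circ> snd) -` ball xs \<delta>g"
  have U: "open U"
    unfolding U_def
    by (intro open_Int continuous_open_preimage[OF higher_differentiable_on_continuous_on[OF c_smooth] U1 open_ball]
        open_vimage[OF open_ball] continuous_intros) (auto simp: o_def intro!: continuous_intros)
  have U_sub: "U \<subseteq> U1" by (auto simp: U_def)
  note linU = higher_differentiable_on_linear[OF U]
  have cU: "higher_differentiable_on U c 2" by (rule higher_differentiable_on_subset[OF c_smooth U_sub])
  have fst_open: "open (fst -` ball z r :: ('a \<times> 'a) set)" "open (fst -` ball z' r :: ('b \<times> 'b) set)" for z z' r
    by (intro open_vimage continuous_intros; simp)+
  define pg where "pg = (\<lambda>p :: 'a \<times> 'a \<times> 'a \<times> 'b. (fst (snd p), fst (snd (snd p))))"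
  define pf where "pf = (\<lambda>p :: 'a \<times> 'a \<times> 'a \<times> 'b. (c p, snd (snd (snd p))))"
  have pg: "higher_differentiable_on U pg 2"
    unfolding pg_def by (rule linU) (auto intro!: linearI)
  have pf: "higher_differentiable_on U pf 2"
    unfolding pf_def
    by (rule higher_differentiable_on_Pair[OF U cU linU]) (auto intro!: linearI)
  have comp_g: "higher_differentiable_on U (\<lambda>p. F (pg p)) 2"
    if "higher_differentiable_on (fst -` ball xs \<delta>g) F 2" for F :: "'a \<times> 'a \<Rightarrow> 'a"
    by (rule higher_differentiable_on_compose[OF U fst_open(1) pg that]) (auto simp: U_def pg_def)
  have comp_f: "higher_differentiable_on U (\<lambda>p. F (pf p)) 2"
    if "higher_differentiable_on (fst -` ball (h xs) \<delta>f) F 2" for F :: "'b \<times> 'b \<Rightarrow> 'b"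
    by (rule higher_differentiable_on_compose[OF U fst_open(2) pf that]) (auto simp: U_def pf_def)
  \<comment> \<open>Stationarity of the subproblem together with the two chart equations. The
    adjoint is written out in the basis so that its smoothness in \<open>x\<close> follows from that
    of \<open>A x b\<close>.\<close>
  define \<Psi> where "\<Psi> = (\<lambda>p. ((\<Sum>b\<in>Basis. (sf (pf p) \<bullet> A (fst p) b) *\<^sub>R b) + sg (pg p) + (fst (snd p) - fst p) /\<^sub>R \<beta>,
     eg (pg p), ef (pf p)))"
  have \<Psi>_smooth: "higher_differentiable_on U \<Psi> (Suc 1)"
  proof -
    have "higher_differentiable_on U (\<lambda>p. A (fst p) b) 2" for b
      by (rule higher_differentiable_on_subset[OF A1 U_sub])
    moreover have "higher_differentiable_on U (\<lambda>p. fst (snd p) - fst p) 2"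
      by (rule linU) (auto intro!: linearI simp: algebra_simps)
    ultimately have "higher_differentiable_on U \<Psi> 2"
      unfolding \<Psi>_def
      by (intro higher_differentiable_on_Pair[OF U] higher_differentiable_on_add[OF U]
          higher_differentiable_on_sum[OF U] higher_differentiable_on_scaleR[OF U]
          higher_differentiable_on_inner[OF U] higher_differentiable_on_const
          comp_g[OF g.s_smooth] comp_g[OF g.e_smooth] comp_f[OF f.s_smooth] comp_f[OF f.e_smooth])
    then show ?thesis by (simp add: numeral_2_eq_2)
  qed
  define z0 where "z0 = (xs, lg, lf)"
  have c0: "c (xs, z0) = h xs"
    by (simp add: c_def z0_def linear_0[OF A_lin[OF xs]])
  have z0U: "(xs, z0) \<in> U"
    using c0 g.\<delta> f.\<delta> xs by (auto simp: U_def U1_def z0_def)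
  have pg0: "pg (xs, z0) = (xs, lg)" and pf0: "pf (xs, z0) = (h xs, lf)"
    by (auto simp: pg_def pf_def c0 z0_def[symmetric]) (auto simp: z0_def)
  have \<Psi>0: "\<Psi> (xs, z0) = 0"
    unfolding \<Psi>_def pg0 pf0 g.base f.base
    using wv adjoint_basis_sum[OF A_lin[OF xs], of w] by (simp add: z0_def zero_prod_def)
  have \<Psi>_der: "frechet_derivative \<Psi> (at (xs, z0)) (0, u, k, m) =
    (adjoint (A xs) (frechet_derivative sf (at (h xs, lf)) (A xs u, m))
       + frechet_derivative sg (at (xs, lg)) (u, k) + u /\<^sub>R \<beta>,
     frechet_derivative eg (at (xs, lg)) (u, k), frechet_derivative ef (at (h xs, lf)) (A xs u, m))" for u k m
  proof -
    let ?i = "\<lambda>z :: 'a \<times> 'a \<times> 'b. (xs, z)"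
    have i: "(?i has_derivative (\<lambda>z. (0, z))) (at z0)" by (auto intro!: derivative_eq_intros)
    have "(\<Psi> has_derivative frechet_derivative \<Psi> (at (xs, z0))) (at (xs, z0))"
      by (rule higher_differentiable_on_has_derivative[OF \<Psi>_smooth _ z0U]) simp
    from has_derivative_compose[OF i this]
    have 1: "((\<lambda>z. \<Psi> (xs, z)) has_derivative (\<lambda>z. frechet_derivative \<Psi> (at (xs, z0)) (0, z))) (at z0)" .
    have der_g: "((\<lambda>z. F (pg (xs, z))) has_derivative (\<lambda>z. frechet_derivative F (at (xs, lg)) (fst z, fst (snd z)))) (at z0)"
      if "higher_differentiable_on (fst -` ball xs \<delta>g) F 2" for F :: "'a \<times> 'a \<Rightarrow> 'a"
    proof (rule has_derivative_compose[where f="\<lambda>z. pg (xs, z)" and g=F])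
      show "((\<lambda>z. pg (xs, z)) has_derivative (\<lambda>z. (fst z, fst (snd z)))) (at z0)"
        unfolding pg_def by (auto intro!: derivative_eq_intros)
      show "(F has_derivative frechet_derivative F (at (xs, lg))) (at (pg (xs, z0)))"
        unfolding pg0 by (rule higher_differentiable_on_has_derivative[OF that]) (use g.\<delta> in auto)
    qed
    have A_der: "(A xs has_derivative A xs) (at z)" for z
      by (rule linear_imp_has_derivative[OF A_lin[OF xs]])
    have der_f: "((\<lambda>z. F (pf (xs, z))) has_derivative (\<lambda>z. frechet_derivative F (at (h xs, lf)) (A xs (fst z), snd (snd z)))) (at z0)"
      if "higher_differentiable_on (fst -` ball (h xs) \<delta>f) F 2" for F :: "'b \<times> 'b \<Rightarrow> 'b"
    proof (rule has_derivative_compose[where f="\<lambda>z. pf (xs, z)" and g=F])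
      have "((\<lambda>z :: 'a \<times> 'a \<times> 'b. A xs (fst z - xs)) has_derivative (\<lambda>z. A xs (fst z))) (at z0)"
        by (rule has_derivative_compose[OF _ A_der]) (auto intro!: derivative_eq_intros)
      then show "((\<lambda>z. pf (xs, z)) has_derivative (\<lambda>z. (A xs (fst z), snd (snd z)))) (at z0)"
        unfolding pf_def c_def by (auto intro!: derivative_eq_intros)
      show "(F has_derivative frechet_derivative F (at (h xs, lf))) (at (pf (xs, z0)))"
        unfolding pf0 by (rule higher_differentiable_on_has_derivative[OF that]) (use f.\<delta> in auto)
    qed
    have "((\<lambda>z. \<Psi> (xs, z)) has_derivative (\<lambda>z.
      ((\<Sum>b\<in>Basis. (frechet_derivative sf (at (h xs, lf)) (A xs (fst z), snd (snd z)) \<bullet> A xs b) *\<^sub>R b)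
        + frechet_derivative sg (at (xs, lg)) (fst z, fst (snd z)) + fst z /\<^sub>R \<beta>,
       frechet_derivative eg (at (xs, lg)) (fst z, fst (snd z)),
       frechet_derivative ef (at (h xs, lf)) (A xs (fst z), snd (snd z))))) (at z0)"
      unfolding \<Psi>_def
      by (auto intro!: derivative_eq_intros der_g[OF g.s_smooth] der_g[OF g.e_smooth] der_f[OF f.s_smooth] der_f[OF f.e_smooth])
    from fun_cong[OF has_derivative_unique[OF 1 this], of "(u, k, m)"]
    show ?thesis by (simp add: adjoint_basis_sum[OF A_lin[OF xs]])
  qed
  have inj: "\<zeta> = 0" if "frechet_derivative \<Psi> (at (xs, z0)) (0, \<zeta>) = 0" for \<zeta>
  proof -
    obtain u k m where [simp]: "\<zeta> = (u, k, m)" by (cases \<zeta>)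
    let ?q = "\<lambda>u. frechet_derivative sf (at (h xs, lf)) (A xs u, m)"
    let ?p = "\<lambda>u. frechet_derivative sg (at (xs, lg)) (u, k)"
    have eqs: "adjoint (A xs) (?q u) + ?p u + u /\<^sub>R \<beta> = 0"
      "frechet_derivative eg (at (xs, lg)) (u, k) = 0" "frechet_derivative ef (at (h xs, lf)) (A xs u, m) = 0"
      using that by (auto simp: \<Psi>_der zero_prod_def)
    have adj: "adjoint (A xs) y \<bullet> t = y \<bullet> A xs t" for y t
      using adjoint_works[OF A_lin[OF xs], of t y] by (simp add: inner_commute)
    have "(adjoint (A xs) (?q u) + ?p u + u /\<^sub>R \<beta>) \<bullet> u = 0" by (simp add: eqs)
    then have "?q u \<bullet> A xs u + ?p u \<bullet> u + (norm u)\<^sup>2 / \<beta> = 0"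
      by (simp add: inner_add_left adj power2_norm_eq_inner divide_inverse mult.commute)
    moreover have "0 \<le> ?q u \<bullet> A xs u" using f.curvature[OF eqs(3)] by simp
    moreover have "- \<sigma> * (norm u)\<^sup>2 \<le> ?p u \<bullet> u" by (rule g.curvature[OF eqs(2)])
    ultimately have "(norm u)\<^sup>2 / \<beta> \<le> \<sigma> * (norm u)\<^sup>2" by linarith
    then have "(norm u)\<^sup>2 \<le> (\<beta> * \<sigma>) * (norm u)\<^sup>2" using \<beta>(1) by (simp add: divide_le_eq mult_ac)
    then have "(1 - \<beta> * \<sigma>) * (norm u)\<^sup>2 \<le> 0" by (simp add: algebra_simps)
    then have "(norm u)\<^sup>2 \<le> 0" using \<beta>(2) by (simp add: mult_le_0_iff)
    then have u: "u = 0" by simp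
    have A0: "A xs 0 = 0" by (rule linear_0[OF A_lin[OF xs]])
    have pq: "adjoint (A xs) (?q 0) + ?p 0 = 0" using eqs(1) u by simp
    \<comment> \<open>Normality of the \<open>g\<close> chart annihilates \<open>?p 0\<close> on
      \<open>Tg\<close>, so the stationarity equation passes this to \<open>?q 0\<close> on the
      image of \<open>Tg\<close>; the \<open>f\<close> chart handles \<open>Tf\<close>. By
      transversality these directions span everything.\<close>
    have "?q 0 \<bullet> z = 0" for z
    proof -
      obtain a b where ab: "a \<in> Tg" "b \<in> Tf" "z = A xs a + b" using transversal by blast
      have "(adjoint (A xs) (?q 0) + ?p 0) \<bullet> a = 0" by (simp add: pq)
      then have "?q 0 \<bullet> A xs a = 0" using g.normal[OF ab(1)] by (simp add: inner_add_left adj)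
      moreover have "?q 0 \<bullet> b = 0" using f.normal[OF ab(2)] by (simp add: A0)
      ultimately show ?thesis by (simp add: ab(3) inner_add_right)
    qed
    then have q0: "?q 0 = 0" by (metis inner_eq_zero_iff)
    have "adjoint (A xs) 0 = 0" by (rule linear_0[OF adjoint_linear[OF A_lin[OF xs]]])
    then have p0: "?p 0 = 0" using pq by (simp only: q0 add_0)
    have "k = 0" using g.multiplier[of k] eqs(2) p0 u by simp
    moreover have "m = 0" using f.multiplier[of m] eqs(3) q0 u by (simp add: A0)
    ultimately show ?thesis by (simp add: u zero_prod_def)
  qed
  obtain \<rho>0 Z where Z: "0 < \<rho>0" "higher_differentiable_on (ball xs \<rho>0) Z (Suc 1)" "Z xs = z0"
    "\<And>x. x \<in> ball xs \<rho>0 \<Longrightarrow> (x, Z x) \<in> U \<and> \<Psi> (x, Z x) = 0"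
    using implicit_function_higher_differentiable[OF U \<Psi>_smooth z0U \<Psi>0 inj] by blast
  \<comment> \<open>\<open>graph\<close> requires multipliers close to \<open>lg\<close> and
    \<open>lf\<close>, which membership in \<open>U\<close> does not ensure; continuity of
    \<open>Z\<close> does so on a smaller ball.\<close>
  have "isCont Z xs"
    using higher_differentiable_on_continuous_on[OF Z(2)] Z(1) by (simp add: continuous_on_eq_continuous_at)
  then have Z_lim: "(Z \<longlongrightarrow> z0) (at xs)" using Z(3) by (simp add: isCont_def)
  have lim_k: "((\<lambda>x. fst (snd (Z x))) \<longlongrightarrow> lg) (at xs)"
    using tendsto_fst[OF tendsto_snd[OF Z_lim]] by (simp add: z0_def)
  have lim_m: "((\<lambda>x. snd (snd (Z x))) \<longlongrightarrow> lf) (at xs)"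
    using tendsto_snd[OF tendsto_snd[OF Z_lim]] by (simp add: z0_def)
  obtain d1 where d1: "d1 > 0" "\<And>x. x \<noteq> xs \<Longrightarrow> dist x xs < d1 \<Longrightarrow> dist (fst (snd (Z x))) lg < \<delta>g"
    using tendstoD[OF lim_k g.\<delta>] by (auto simp: eventually_at)
  obtain d2 where d2: "d2 > 0" "\<And>x. x \<noteq> xs \<Longrightarrow> dist x xs < d2 \<Longrightarrow> dist (snd (snd (Z x))) lf < \<delta>f"
    using tendstoD[OF lim_m f.\<delta>] by (auto simp: eventually_at)
  define \<rho> where "\<rho> = min (min \<rho>0 \<epsilon>) (min d1 d2)"
  define Y where "Y = (\<lambda>x. fst (Z x))"
  show ?thesis
  proof (rule that[of \<rho> Y])
    show "0 < \<rho>" "\<rho> \<le> \<epsilon>" using Z(1) h(1) d1(1) d2(1) by (auto simp: \<rho>_def)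
    show "higher_differentiable_on (ball xs \<rho>) Y 2"
      unfolding Y_def
      by (rule higher_differentiable_on_linear_comp[OF open_ball linear_fst higher_differentiable_on_subset])
         (use Z(2) in \<open>auto simp: \<rho>_def numeral_2_eq_2\<close>)
    show "Y xs = xs" by (simp add: Y_def Z(3) z0_def)
    fix x assume x: "x \<in> ball xs \<rho>"
    obtain y k m where Zx: "Z x = (y, k, m)" by (cases "Z x")
    have Yx: "Y x = y" by (simp add: Y_def Zx)
    have xU: "(x, y, k, m) \<in> U" "\<Psi> (x, y, k, m) = 0" using Z(4)[of x] x by (auto simp: Zx \<rho>_def)
    have k: "dist k lg < \<delta>g"
      using d1(2)[of x] x Zx Z(3) g.\<delta> by (cases "x = xs") (auto simp: \<rho>_def dist_commute z0_def)
    have m: "dist m lf < \<delta>f"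
      using d2(2)[of x] x Zx Z(3) f.\<delta> by (cases "x = xs") (auto simp: \<rho>_def dist_commute z0_def)
    define cx where "cx = h x + A x (y - x)"
    have pg: "pg (x, y, k, m) = (y, k)" and pf: "pf (x, y, k, m) = (cx, m)"
      by (simp_all add: pg_def pf_def c_def cx_def)
    have y: "dist y xs < \<delta>g" and cx: "dist cx (h xs) < \<delta>f"
      using xU(1) by (auto simp: U_def c_def cx_def dist_commute)
    have e: "eg (y, k) = 0" "ef (cx, m) = 0"
      and s: "(\<Sum>b\<in>Basis. (sf (cx, m) \<bullet> A x b) *\<^sub>R b) + sg (y, k) + (y - x) /\<^sub>R \<beta> = 0"
      using xU(2) unfolding \<Psi>_def pg pf by (auto simp: zero_prod_def)
    have "x \<in> ball xs \<epsilon>" using x by (auto simp: \<rho>_def)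
    with s have "adjoint (A x) (sf (cx, m)) + sg (y, k) + (y - x) /\<^sub>R \<beta> = 0"
      by (simp add: adjoint_basis_sum[OF A_lin])
    with g.graph[OF y k e(1)] f.graph[OF cx m e(2)]
    show "\<exists>w\<in>subdiff \<phi> (h x + A x (Y x - x)). \<exists>v\<in>subdiff g (Y x).
      adjoint (A x) w + v + (Y x - x) /\<^sub>R \<beta> = 0"
      unfolding Yx cx_def by blast
  qed
qed

section \<open>Anderson acceleration\<close>

text \<open>With \<open>u\<close> the same combination of the points \<open>y i\<close>, the
  residual splits into \<open>H z - H u\<close>, contracted from \<open>z - u\<close>, which is the
  combined residual, and \<open>H u - z\<close>, which would vanish for affine \<open>H\<close>. The
  second part costs \<open>K * N\<^sup>2 * b\<^sup>2\<close> at \<open>u\<close> and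
  \<open>K * N * b\<^sup>2\<close> for the combined Taylor errors.\<close>

lemma anderson_step:
  fixes H B :: "'a::euclidean_space \<Rightarrow> 'a" and y :: "'i \<Rightarrow> 'a"
  assumes fixed: "H xs = xs" and B: "linear B" and \<gamma>: "0 < \<gamma>" "\<gamma> < 1"
    and contr: "\<And>x y. norm (x - xs) \<le> R \<Longrightarrow> norm (y - xs) \<le> R \<Longrightarrow> norm (H x - H y) \<le> \<gamma> * norm (x - y)"
    and taylor: "\<And>x. norm (x - xs) \<le> R \<Longrightarrow> norm (H x - xs - B (x - xs)) \<le> K * (norm (x - xs))\<^sup>2"
    and K: "0 \<le> K" and N: "1 \<le> N" and b: "0 \<le> b" "N * b \<le> R"
    and a: "(\<Sum>i\<in>I. a i) = 1" "(\<Sum>i\<in>I. \<bar>a i\<bar>) \<le> N"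
    and y: "\<And>i. i \<in> I \<Longrightarrow> norm (y i - xs) \<le> b"
    and z: "z = (\<Sum>i\<in>I. a i *\<^sub>R H (y i))"
  shows "norm (z - xs) \<le> R"
    "norm (H z - z) \<le> \<gamma> * norm (\<Sum>i\<in>I. a i *\<^sub>R (H (y i) - y i)) + (K * N\<^sup>2 + K * N) * b\<^sup>2"
proof -
  have b_R: "b \<le> R"
    using b N mult_right_mono[of 1 N b] by linarith
  have comb: "norm (\<Sum>i\<in>I. a i *\<^sub>R w i) \<le> N * c" if w: "\<And>i. i \<in> I \<Longrightarrow> norm (w i) \<le> c" and c: "0 \<le> c" for w :: "'i \<Rightarrow> 'a" and c
  proof -
    have "norm (\<Sum>i\<in>I. a i *\<^sub>R w i) \<le> (\<Sum>i\<in>I. \<bar>a i\<bar> * c)"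
      by (rule order_trans[OF norm_sum]) (auto intro!: sum_mono mult_left_mono w)
    also have "\<dots> = (\<Sum>i\<in>I. \<bar>a i\<bar>) * c" by (simp add: sum_distrib_right)
    also have "\<dots> \<le> N * c" using a(2) c by (intro mult_right_mono) auto
    finally show ?thesis .
  qed
  have affine: "(\<Sum>i\<in>I. a i *\<^sub>R w i) - xs = (\<Sum>i\<in>I. a i *\<^sub>R (w i - xs))" for w :: "'i \<Rightarrow> 'a"
    using a(1) by (simp add: scaleR_diff_right sum_subtractf scaleR_sum_left[symmetric])
  have yR: "norm (y i - xs) \<le> R" if "i \<in> I" for i using y[OF that] b_R by linarith
  have Hy: "norm (H (y i) - xs) \<le> b" if "i \<in> I" for i
  proof -
    have "norm (H (y i) - H xs) \<le> \<gamma> * norm (y i - xs)"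
      using yR[OF that] b b_R by (intro contr) auto
    also have "\<dots> \<le> 1 * norm (y i - xs)" using \<gamma> by (intro mult_right_mono) auto
    finally show ?thesis using y[OF that] by (simp add: fixed)
  qed
  show zR: "norm (z - xs) \<le> R"
    unfolding z affine using comb[of "\<lambda>i. H (y i) - xs" b] Hy b by fastforce
  \<comment> \<open>\<open>u\<close> need not be an iterate; \<open>N * b \<le> R\<close> keeps both
    \<open>u\<close> and \<open>z\<close> in the ball although coefficients may be negative.\<close>
  define u where "u = (\<Sum>i\<in>I. a i *\<^sub>R y i)"
  have u: "norm (u - xs) \<le> N * b"
    unfolding u_def affine using comb[of "\<lambda>i. y i - xs" b] y b by fastforce
  then have uR: "norm (u - xs) \<le> R" using b by linarith
  define \<Delta> where "\<Delta> = (\<lambda>x. H x - xs - B (x - xs))"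
  have "z - u = (\<Sum>i\<in>I. a i *\<^sub>R (H (y i) - y i))"
    by (simp add: z u_def scaleR_diff_right sum_subtractf)
  then have 1: "norm (H z - H u) \<le> \<gamma> * norm (\<Sum>i\<in>I. a i *\<^sub>R (H (y i) - y i))"
    using contr[OF zR uR] by simp
  have "z = (\<Sum>i\<in>I. a i *\<^sub>R (\<Delta> (y i) + B (y i - xs) + xs))"
    by (simp add: z \<Delta>_def)
  also have "\<dots> = (\<Sum>i\<in>I. a i *\<^sub>R \<Delta> (y i)) + (\<Sum>i\<in>I. a i *\<^sub>R B (y i - xs)) + (\<Sum>i\<in>I. a i) *\<^sub>R xs"
    by (simp add: scaleR_add_right sum.distrib scaleR_sum_left)
  also have "(\<Sum>i\<in>I. a i *\<^sub>R B (y i - xs)) = B (u - xs)"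
    unfolding u_def affine by (simp add: linear_sum[OF B] linear_cmul[OF B])
  finally have "H u - z = \<Delta> u - (\<Sum>i\<in>I. a i *\<^sub>R \<Delta> (y i))"
    using a(1) by (simp add: \<Delta>_def)
  then have "norm (H u - z) \<le> norm (\<Delta> u) + norm (\<Sum>i\<in>I. a i *\<^sub>R \<Delta> (y i))"
    using norm_triangle_ineq4 by metis
  moreover have "norm (\<Delta> u) \<le> K * (N * b)\<^sup>2"
    unfolding \<Delta>_def using u K
    by (intro order_trans[OF taylor[OF uR]] mult_left_mono power_mono) auto
  moreover have "norm (\<Sum>i\<in>I. a i *\<^sub>R \<Delta> (y i)) \<le> N * (K * b\<^sup>2)"
  proof (rule comb)
    show "norm (\<Delta> (y i)) \<le> K * b\<^sup>2" if "i \<in> I" for i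
      unfolding \<Delta>_def using y[OF that] K
      by (intro order_trans[OF taylor[OF yR[OF that]]] mult_left_mono power_mono) auto
  qed (use K in simp)
  ultimately have "norm (H u - z) \<le> (K * N\<^sup>2 + K * N) * b\<^sup>2"
    by (simp add: algebra_simps power_mult_distrib)
  moreover have "norm (H z - z) \<le> norm (H z - H u) + norm (H u - z)"
    by (metis diff_add_cancel add_diff_eq norm_triangle_ineq)
  ultimately show "norm (H z - z) \<le> \<gamma> * norm (\<Sum>i\<in>I. a i *\<^sub>R (H (y i) - y i)) + (K * N\<^sup>2 + K * N) * b\<^sup>2"
    using 1 by linarith
qed

text \<open>Strong induction on the residuals: errors in the current window are at most residuals
  divided by \<open>1 - \<gamma>\<close>, so the quadratic term of a step is a product of two old
  residual bounds, one of which is small by the choice of the start.\<close>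

lemma anderson_convergence:
  fixes H B :: "'a::euclidean_space \<Rightarrow> 'a" and m :: nat and M\<alpha> :: real
  assumes fixed: "H xs = xs" and B: "linear B" and \<gamma>: "0 < \<gamma>" "\<gamma> < 1" and R: "0 < R"
    and contr: "\<And>x y. norm (x - xs) \<le> R \<Longrightarrow> norm (y - xs) \<le> R \<Longrightarrow> norm (H x - H y) \<le> \<gamma> * norm (x - y)"
    and taylor: "\<And>x. norm (x - xs) \<le> R \<Longrightarrow> norm (H x - xs - B (x - xs)) \<le> K * (norm (x - xs))\<^sup>2"
    and K: "0 \<le> K"
  shows "\<exists>\<gamma>' \<in> {\<gamma><..<1}. \<exists>\<delta>>0. \<forall>x \<alpha>.
    anderson_iterates H m x \<alpha> \<longrightarrow>
    (\<forall>k. (\<Sum>i\<le>min m k. \<bar>\<alpha> k i\<bar>) \<le> M\<alpha>) \<longrightarrow>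
    norm (x 0 - xs) < \<delta> \<longrightarrow>
    x \<longlonglongrightarrow> xs \<and>
    (\<forall>k. norm (H (x k) - x k) \<le> \<gamma>' ^ k * norm (H (x 0) - x 0) \<and>
         norm (x k - xs) \<le> (1 + \<gamma>) / (1 - \<gamma>) * \<gamma>' ^ k * norm (x 0 - xs))"
proof -
  define \<gamma>' where "\<gamma>' = (1 + \<gamma>) / 2"
  have \<gamma>': "\<gamma> < \<gamma>'" "\<gamma>' < 1" "0 < \<gamma>'" using \<gamma> by (auto simp: \<gamma>'_def)
  define N where "N = max M\<alpha> 1"
  have N: "1 \<le> N" "M\<alpha> \<le> N" by (auto simp: N_def)
  define Q where "Q = K * N\<^sup>2 + K * N"
  have Q: "0 \<le> Q" using K N by (simp add: Q_def)
  \<comment> \<open>The slack for the quadratic term: \<open>\<gamma>' - \<gamma>\<close> is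
    available in each step, \<open>\<gamma>' ^ m\<close> compensates for the oldest point of the
    window, and \<open>(1 - \<gamma>)\<^sup>2\<close> comes from squaring the error bound.\<close>
  define S where "S = (\<gamma>' - \<gamma>) * \<gamma>' ^ m * (1 - \<gamma>)\<^sup>2"
  have S: "0 < S" using \<gamma> \<gamma>' by (simp add: S_def)
  \<comment> \<open>The first entry keeps the iterates and combinations within \<open>R\<close>, the
    second gives \<open>Q * q 0 \<le> S\<close>. The factors \<open>2\<close> stem from
    \<open>q 0 \<le> 2 * norm (x 0 - xs)\<close>; the summand \<open>1\<close> keeps the divisor
    positive.\<close>
  define \<delta> where "\<delta> = min (R * (1 - \<gamma>) / (2 * N)) (S / (2 * Q + 1))"
  have \<delta>: "0 < \<delta>" using R \<gamma> N Q S by (simp add: \<delta>_def)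
  have main: "x \<longlonglongrightarrow> xs \<and>
    (\<forall>k. norm (H (x k) - x k) \<le> \<gamma>' ^ k * norm (H (x 0) - x 0) \<and>
         norm (x k - xs) \<le> (1 + \<gamma>) / (1 - \<gamma>) * \<gamma>' ^ k * norm (x 0 - xs))"
    if iter: "anderson_iterates H m x \<alpha>" and M: "\<And>k. (\<Sum>i\<le>min m k. \<bar>\<alpha> k i\<bar>) \<le> M\<alpha>"
      and x0: "norm (x 0 - xs) < \<delta>" for x \<alpha>
  proof -
    define q where "q = (\<lambda>k. norm (H (x k) - x k))"
    have resid_le: "norm (H y - y) \<le> (1 + \<gamma>) * norm (y - xs)" if "norm (y - xs) \<le> R" for y
    proof -
      have "norm (H y - y) \<le> norm (H y - H xs) + norm (y - xs)"
        by (metis fixed norm_minus_commute norm_triangle_ineq4 diff_add_cancel diff_diff_eq2)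
      then show ?thesis using contr[OF that, of xs] R by (simp add: algebra_simps)
    qed
    have err_le: "norm (y - xs) \<le> norm (H y - y) / (1 - \<gamma>)" if "norm (y - xs) \<le> R" for y
    proof -
      have "norm (y - xs) \<le> norm (H y - y) + norm (H y - H xs)"
        by (metis fixed norm_minus_commute norm_triangle_ineq diff_add_cancel add_diff_eq)
      then have "norm (y - xs) * (1 - \<gamma>) \<le> norm (H y - y)"
        using contr[OF that, of xs] R by (simp add: algebra_simps)
      then show ?thesis using \<gamma> by (simp add: le_divide_eq)
    qed
    have x0R: "norm (x 0 - xs) \<le> R * (1 - \<gamma>) / (2 * N)" using x0 by (simp add: \<delta>_def)
    also have "\<dots> \<le> R"
    proof -
      have "R * (1 - \<gamma>) \<le> R * (2 * N)" using R \<gamma> N by (intro mult_left_mono) auto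
      then show ?thesis using N by (simp add: divide_le_eq)
    qed
    finally have x0R': "norm (x 0 - xs) \<le> R" .
    have q0: "q 0 \<le> (1 + \<gamma>) * norm (x 0 - xs)" unfolding q_def by (rule resid_le[OF x0R'])
    then have q0_2: "q 0 \<le> 2 * norm (x 0 - xs)"
      using \<gamma> mult_right_mono[of "1 + \<gamma>" 2 "norm (x 0 - xs)"] by auto
    have q_nonneg: "0 \<le> q k" for k by (simp add: q_def)
    have q0_R: "N * (q 0 / (1 - \<gamma>)) \<le> R"
    proof -
      have "q 0 \<le> R * (1 - \<gamma>) / N" using q0_2 x0R by simp
      then have "q 0 / (1 - \<gamma>) \<le> R * (1 - \<gamma>) / N / (1 - \<gamma>)"
        using \<gamma> by (intro divide_right_mono) auto
      also have "\<dots> = R / N" using \<gamma> by simp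
      finally show ?thesis using N by (simp add: field_simps)
    qed
    have q0_S: "Q * q 0 \<le> S"
    proof -
      have "Q * q 0 \<le> Q * (2 * \<delta>)" using q0_2 x0 Q by (intro mult_left_mono) auto
      also have "\<dots> \<le> (2 * Q + 1) * \<delta>" using \<delta> by (simp add: algebra_simps)
      also have "\<dots> \<le> (2 * Q + 1) * (S / (2 * Q + 1))" using Q by (intro mult_left_mono) (auto simp: \<delta>_def)
      also have "\<dots> = S" using Q by simp
      finally show ?thesis .
    qed
    have step: "norm (x j - xs) \<le> R \<and> q j \<le> \<gamma>' ^ j * q 0" for j
    proof (induction j rule: less_induct)
      case (less j)
      show ?case
      proof (cases j)
        case 0
        then show ?thesis using x0R' by simp
      next
        case (Suc k)
        define n where "n = min m k"
        let ?I = "{..n}"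
        define a where "a = \<alpha> k"
        define y where "y = (\<lambda>i. x (k - n + i))"
        have arg: "is_arg_min (\<lambda>a. (norm (\<Sum>i\<le>n. a i *\<^sub>R (H (y i) - y i)))\<^sup>2) (\<lambda>a. (\<Sum>i\<le>n. a i) = 1) a"
          and xk: "x j = (\<Sum>i\<le>n. a i *\<^sub>R H (y i))"
          using iter Suc unfolding anderson_iterates_def Let_def n_def a_def y_def by auto
        have a: "(\<Sum>i\<le>n. a i) = 1" "(\<Sum>i\<le>n. \<bar>a i\<bar>) \<le> N"
          using arg M[of k] N by (auto simp: is_arg_min_def n_def a_def)
        \<comment> \<open>Competitor with all weight on the newest iterate: by minimality the
          combined residual is at most \<open>q k\<close>.\<close>
        define c where "c = (\<lambda>i. if i = n then 1 else 0 :: real)"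
        have "(\<Sum>i\<le>n. c i) = 1" by (simp add: c_def)
        then have "(norm (\<Sum>i\<le>n. a i *\<^sub>R (H (y i) - y i)))\<^sup>2 \<le> (norm (\<Sum>i\<le>n. c i *\<^sub>R (H (y i) - y i)))\<^sup>2"
          using arg by (auto simp: is_arg_min_def not_less)
        also have "(\<Sum>i\<le>n. c i *\<^sub>R (H (y i) - y i)) = (\<Sum>i\<le>n. if i = n then H (y i) - y i else 0)"
          by (rule sum.cong) (auto simp: c_def)
        also have "\<dots> = H (x k) - x k" by (simp add: y_def n_def)
        finally have opt: "norm (\<Sum>i\<le>n. a i *\<^sub>R (H (y i) - y i)) \<le> q k"
          unfolding q_def by (rule power2_le_imp_le) simp
        \<comment> \<open>Truncated subtraction covers the initial phase \<open>k < m\<close>, where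
          the window reaches back to index \<open>0\<close>.\<close>
        define b where "b = \<gamma>' ^ (k - m) * (q 0 / (1 - \<gamma>))"
        have y_b: "norm (y i - xs) \<le> b" if "i \<in> ?I" for i
        proof -
          define l where "l = k - n + i"
          have l: "l < j" "k - m \<le> l" using that Suc by (auto simp: l_def n_def)
          have IH: "norm (x l - xs) \<le> R" "q l \<le> \<gamma>' ^ l * q 0" using less.IH[OF l(1)] by auto
          have "norm (x l - xs) \<le> q l / (1 - \<gamma>)" unfolding q_def by (rule err_le[OF IH(1)])
          also have "\<dots> \<le> (\<gamma>' ^ l * q 0) / (1 - \<gamma>)" using IH(2) \<gamma> by (intro divide_right_mono) auto
          also have "\<dots> \<le> (\<gamma>' ^ (k - m) * q 0) / (1 - \<gamma>)"
            using \<gamma> \<gamma>' l(2) q_nonneg by (intro divide_right_mono mult_right_mono power_decreasing) auto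
          finally show ?thesis by (simp add: b_def y_def l_def)
        qed
        have b_le: "b \<le> q 0 / (1 - \<gamma>)"
          unfolding b_def using \<gamma> \<gamma>' q_nonneg[of 0]
          by (intro mult_left_le_one_le) (auto simp: power_le_one)
        then have bR: "N * b \<le> R" using q0_R N mult_left_mono[OF b_le, of N] by linarith
        have b0: "0 \<le> b" using \<gamma> \<gamma>' q_nonneg[of 0] by (simp add: b_def)
        have est: "norm (x j - xs) \<le> R"
          "norm (H (x j) - x j) \<le> \<gamma> * norm (\<Sum>i\<le>n. a i *\<^sub>R (H (y i) - y i)) + (K * N\<^sup>2 + K * N) * b\<^sup>2"
          using anderson_step[OF fixed B \<gamma> contr taylor K N(1) b0 bR a y_b xk] by auto
        have "q j \<le> \<gamma> * q k + Q * b\<^sup>2"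
          using est(2) mult_left_mono[OF opt, of \<gamma>] \<gamma> unfolding q_def Q_def by linarith
        also have "\<dots> \<le> \<gamma> * (\<gamma>' ^ k * q 0) + (\<gamma>' - \<gamma>) * (\<gamma>' ^ k * q 0)"
        proof (rule add_mono)
          show "\<gamma> * q k \<le> \<gamma> * (\<gamma>' ^ k * q 0)"
            using less.IH[of k] Suc \<gamma> by (intro mult_left_mono) auto
          \<comment> \<open>One factor \<open>q 0\<close> is traded for the slack \<open>S\<close>;
            the other one remains, so the bound stays proportional to \<open>q 0\<close>.\<close>
          have "Q * b\<^sup>2 = Q * q 0 * (\<gamma>' ^ (2 * (k - m)) * q 0) / (1 - \<gamma>)\<^sup>2"
            by (simp add: b_def power_mult_distrib power_divide power2_eq_square[of "q 0"] power_even_eq)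
          also have "\<dots> \<le> S * (\<gamma>' ^ (2 * (k - m)) * q 0) / (1 - \<gamma>)\<^sup>2"
            using q0_S \<gamma>' q_nonneg[of 0] by (intro divide_right_mono mult_right_mono) auto
          also have "\<dots> = (\<gamma>' - \<gamma>) * (\<gamma>' ^ (m + 2 * (k - m)) * q 0)"
            using \<gamma> by (simp add: S_def power_add)
          \<comment> \<open>The exponent \<open>m + 2 * (k - m)\<close> is at least \<open>k\<close>
            both for \<open>k < m\<close>, where the difference is truncated to \<open>0\<close>,
            and for \<open>k \<ge> m\<close>, where it equals \<open>2 * k - m\<close>.\<close>
          also have "\<dots> \<le> (\<gamma>' - \<gamma>) * (\<gamma>' ^ k * q 0)"
            using \<gamma>' q_nonneg[of 0] by (intro mult_left_mono mult_right_mono power_decreasing) auto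
          finally show "Q * b\<^sup>2 \<le> (\<gamma>' - \<gamma>) * (\<gamma>' ^ k * q 0)" .
        qed
        also have "\<dots> = \<gamma>' ^ j * q 0" by (simp add: Suc algebra_simps)
        finally show ?thesis using est(1) by simp
      qed
    qed
    \<comment> \<open>The constant combines the two comparisons with the error: the final error is
      at most its residual over \<open>1 - \<gamma>\<close>, and the initial residual at most
      \<open>1 + \<gamma>\<close> times its error.\<close>
    have bound: "norm (x k - xs) \<le> (1 + \<gamma>) / (1 - \<gamma>) * \<gamma>' ^ k * norm (x 0 - xs)" for k
    proof -
      have "norm (x k - xs) \<le> q k / (1 - \<gamma>)" unfolding q_def using step by (intro err_le) auto
      also have "\<dots> \<le> (\<gamma>' ^ k * ((1 + \<gamma>) * norm (x 0 - xs))) / (1 - \<gamma>)"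
      proof (rule divide_right_mono)
        have "q k \<le> \<gamma>' ^ k * q 0" using step by blast
        also have "\<dots> \<le> \<gamma>' ^ k * ((1 + \<gamma>) * norm (x 0 - xs))"
          using q0 \<gamma>' by (intro mult_left_mono) auto
        finally show "q k \<le> \<gamma>' ^ k * ((1 + \<gamma>) * norm (x 0 - xs))" .
      qed (use \<gamma> in simp)
      finally show ?thesis by (simp add: mult_ac)
    qed
    have "(\<lambda>k. (1 + \<gamma>) / (1 - \<gamma>) * \<gamma>' ^ k * norm (x 0 - xs)) \<longlonglongrightarrow> (1 + \<gamma>) / (1 - \<gamma>) * 0 * norm (x 0 - xs)"
      using \<gamma>' by (intro tendsto_intros LIMSEQ_realpow_zero) auto
    then have lim: "(\<lambda>k. (1 + \<gamma>) / (1 - \<gamma>) * \<gamma>' ^ k * norm (x 0 - xs)) \<longlonglongrightarrow> 0" by simp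
    have "(\<lambda>k. x k - xs) \<longlonglongrightarrow> 0"
      by (rule Lim_null_comparison[OF always_eventually lim]) (intro allI bound)
    then have "x \<longlonglongrightarrow> xs" by (rule LIM_zero_cancel)
    then show ?thesis using step bound by (auto simp: q_def)
  qed
  show ?thesis
    using main \<delta> \<gamma>' by (intro bexI[of _ \<gamma>'] exI[of _ \<delta>]) auto
qed

section \<open>Smoothness and acceleration of the prox-linear map\<close>

theorem theorem3p2:
  fixes f :: "real^'d \<Rightarrow> real" and h :: "real^'n \<Rightarrow> real^'d" and g F :: "real^'n \<Rightarrow> ereal"
    and H :: "real^'n \<Rightarrow> real^'n"
    and \<sigma> \<eta> \<beta> :: real and xs :: "real^'n" and M :: "(real^'n) set"
  assumes F_eq: "F = (\<lambda>x. ereal (f (h x)) + g x)"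
    and F_closed: "closed_fun F"
    and F_level: "level_bounded F"
    and h_C2: "higher_differentiable_on UNIV h 2"
    and f_convex: "convex_on UNIV f"
    and g_range: "\<And>x. g x \<noteq> -\<infinity>"
    and g_closed: "closed_fun g"
    and \<sigma>_pos: "\<sigma> > 0"
    and g_weakly_convex: "weakly_convex \<sigma> g"
    and \<eta>_pos: "\<eta> > 0"
    and model: "\<And>x y. \<bar>f (h y) - f (h x + jacobian h (at x) *v (y - x))\<bar> \<le> \<eta> / 2 * (norm (y - x))\<^sup>2"
    and xs_critical: "critical_point F xs"
    and \<beta>_pos: "0 < \<beta>"
    and \<beta>_less: "\<beta> < min (1 / \<sigma>) (1 / \<eta>)"
    and H_eq: "H = (\<lambda>x. arg_min
        (\<lambda>y. ereal (f (h x + jacobian h (at x) *v (y - x))) + g y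
              + ereal (1 / (2 * \<beta>) * (norm (y - x))\<^sup>2))
        (\<lambda>y. True))"
    and M_active: "composite_active_manifold 3 f h g M xs"
    and h_C4: "\<exists>\<epsilon>>0. higher_differentiable_on (ball xs \<epsilon>) h 4"
  shows "(\<exists>\<epsilon>>0. higher_differentiable_on (ball xs \<epsilon>) H 2 \<and>
            (\<exists>L. L-lipschitz_on (ball xs \<epsilon>) H) \<and>
            (\<exists>L. L-lipschitz_on (ball xs \<epsilon>) (\<lambda>x. jacobian H (at x))))
       \<and> (\<forall>\<rho> \<gamma> M\<alpha> :: real. \<forall>m :: nat.
            \<rho> > 0 \<longrightarrow> 0 < \<gamma> \<longrightarrow> \<gamma> < 1 \<longrightarrow> m \<ge> 1 \<longrightarrow>
            (\<forall>x \<in> cball xs \<rho>. \<forall>y \<in> cball xs \<rho>. norm (H x - H y) \<le> \<gamma> * norm (x - y)) \<longrightarrow>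
            (\<exists>\<gamma>' \<in> {\<gamma><..<1}. \<exists>\<delta>>0. \<forall>x \<alpha>.
               anderson_iterates H m x \<alpha> \<longrightarrow>
               (\<forall>k. (\<Sum>i\<le>min m k. \<bar>\<alpha> k i\<bar>) \<le> M\<alpha>) \<longrightarrow>
               norm (x 0 - xs) < \<delta> \<longrightarrow>
               x \<longlonglongrightarrow> xs \<and>
               (\<forall>k. norm (H (x k) - x k) \<le> \<gamma>' ^ k * norm (H (x 0) - x 0) \<and>
                    norm (x k - xs) \<le> (1 + \<gamma>) / (1 - \<gamma>) * \<gamma>' ^ k * norm (x 0 - xs))))"
proof -
  define A where "A = (\<lambda>x. frechet_derivative h (at x))"
  have h_der: "(h has_derivative A x) (at x)" for x
    unfolding A_def by (rule higher_differentiable_on_has_derivative[OF h_C2]) auto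
  have A_lin: "linear (A x)" for x using h_der by (rule has_derivative_linear)
  have J: "jacobian h (at x) *v u = A x u" for x u
  proof -
    have "(h has_derivative (*v) (jacobian h (at x))) (at x)"
      using h_der jacobian_works[of h "at x"] by (auto simp: differentiable_def)
    from fun_cong[OF has_derivative_unique[OF this h_der]] show ?thesis .
  qed
  have J_adj: "transpose (jacobian h (at x)) *v u = adjoint (A x) u" for x u
    using fun_cong[OF adjoint_matrix[of "jacobian h (at x)"], of u] by (simp add: J)
  have \<sigma>0: "0 \<le> \<sigma>" and \<eta>0: "0 \<le> \<eta>" using \<sigma>_pos \<eta>_pos by auto
  have \<beta>\<sigma>: "\<beta> * \<sigma> < 1" using \<beta>_less \<sigma>_pos by (simp add: field_simps)
  have "f (h y) \<le> f (h xs + A xs (y - xs)) + \<eta> / 2 * (norm (y - xs))\<^sup>2" for y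
    using abs_le_D1[OF model[of y xs]] unfolding J by linarith
  moreover have "0 \<in> subdiff (\<lambda>y. ereal (f (h y)) + g y) xs"
    using xs_critical by (simp add: critical_point_def F_eq)
  ultimately obtain w where w: "w \<in> subdiff (\<lambda>z. ereal (f z)) (h xs)" and v: "- adjoint (A xs) w \<in> subdiff g xs"
    using critical_point_multiplier[OF f_convex \<sigma>0 g_weakly_convex A_lin \<eta>0] by blast
  define v where "v = - adjoint (A xs) w"
  have "0 = transpose (jacobian h (at xs)) *v w + v" unfolding J_adj v_def by simp
  with M_active w v obtain \<G> \<F> where
    transversal: "{jacobian h (at xs) *v a + b |a b.
      a \<in> tangent_space 3 \<G> xs \<and> b \<in> tangent_space 3 \<F> (h xs)} = UNIV"
    and v_rint: "v \<in> rel_interior (subdiff g xs)"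
    and w_rint: "w \<in> rel_interior (subdiff (\<lambda>z. ereal (f z)) (h xs))"
    and active: "active_manifold 3 g \<G> xs" "active_manifold 3 (\<lambda>z. ereal (f z)) \<F> (h xs)"
    unfolding composite_active_manifold_def v_def by blast
  obtain sg eg lg \<delta>g where cg: "subdifferential_chart g \<sigma> (tangent_space 3 \<G> xs) xs v sg eg lg \<delta>g"
    by (rule active_manifold_subdifferential_chart[OF \<sigma>0 g_weakly_convex active(1) v_rint])
  obtain sf ef lf \<delta>f where
    cf: "subdifferential_chart (\<lambda>z. ereal (f z)) 0 (tangent_space 3 \<F> (h xs)) (h xs) w sf ef lf \<delta>f"
    by (rule active_manifold_subdifferential_chart[OF order_refl weakly_convex_0_convex_on[OF f_convex] active(2) w_rint])
  have trans: "\<exists>a\<in>tangent_space 3 \<G> xs. \<exists>b\<in>tangent_space 3 \<F> (h xs). z = A xs a + b" for z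
  proof -
    have "z \<in> {jacobian h (at xs) *v a + b |a b.
      a \<in> tangent_space 3 \<G> xs \<and> b \<in> tangent_space 3 \<F> (h xs)}"
      unfolding transversal by simp
    then show ?thesis by (auto simp: J)
  qed
  obtain \<epsilon> where \<epsilon>: "0 < \<epsilon>" "higher_differentiable_on (ball xs \<epsilon>) h 4" using h_C4 by blast
  have wv: "adjoint (A xs) w + v = 0" by (simp add: v_def)
  obtain \<rho> Y where \<rho>: "0 < \<rho>" and Y: "higher_differentiable_on (ball xs \<rho>) Y 2" "Y xs = xs"
    and stationary: "\<And>x. x \<in> ball xs \<rho> \<Longrightarrow>
      \<exists>w\<in>subdiff (\<lambda>z. ereal (f z)) (h x + A x (Y x - x)). \<exists>v\<in>subdiff g (Y x).
      adjoint (A x) w + v + (Y x - x) /\<^sub>R \<beta> = 0"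
  proof (rule smooth_stationary_point[OF cg cf wv[unfolded A_def] trans[unfolded A_def] \<epsilon> \<beta>_pos \<beta>\<sigma>])
    fix \<rho> Y
    assume "0 < \<rho>" "higher_differentiable_on (ball xs \<rho>) Y 2" "Y xs = xs"
      "\<And>x. x \<in> ball xs \<rho> \<Longrightarrow>
        \<exists>w\<in>subdiff (\<lambda>z. ereal (f z)) (h x + frechet_derivative h (at x) (Y x - x)). \<exists>v\<in>subdiff g (Y x).
        adjoint (frechet_derivative h (at x)) w + v + (Y x - x) /\<^sub>R \<beta> = 0"
    then show thesis by (rule that[unfolded A_def])
  qed
  have HY: "H x = Y x" if x: "x \<in> ball xs \<rho>" for x
  proof -
    obtain w' v' where "w' \<in> subdiff (\<lambda>z. ereal (f z)) (h x + A x (Y x - x))" "v' \<in> subdiff g (Y x)"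
      "adjoint (A x) w' + v' + (Y x - x) /\<^sub>R \<beta> = 0"
      using stationary[OF x] by blast
    from prox_linear_arg_min[OF f_convex g_weakly_convex g_range A_lin \<beta>_pos \<beta>\<sigma> this]
    show ?thesis by (simp add: H_eq J)
  qed
  have H_smooth: "higher_differentiable_on (ball xs \<rho>) H 2"
    by (rule higher_differentiable_on_cong[OF open_ball _ Y(1)]) (simp add: HY)
  have H_fixed: "H xs = xs" using HY[of xs] \<rho> Y(2) by simp
  \<comment> \<open>The Lipschitz bounds hold on the closed ball of half the radius, where
    compactness bounds the derivatives; the open ball inside it serves for all three claims.\<close>
  have sub: "ball xs (\<rho> / 2) \<subseteq> cball xs (\<rho> / 2)" "ball xs (\<rho> / 2) \<subseteq> ball xs \<rho>"
    using \<rho> by auto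
  have "higher_differentiable_on (ball xs \<rho>) H 1"
    by (rule higher_differentiable_on_le[OF H_smooth]) simp
  then obtain L1 where L1: "L1-lipschitz_on (cball xs (\<rho> / 2)) H"
    using higher_differentiable_on_lipschitz \<rho> by blast
  have "higher_differentiable_on (ball xs \<rho>) (\<lambda>x. jacobian H (at x)) 1"
    by (rule higher_differentiable_on_jacobian[OF open_ball]) (use H_smooth in \<open>simp add: numeral_2_eq_2\<close>)
  then obtain L2 where L2: "L2-lipschitz_on (cball xs (\<rho> / 2)) (\<lambda>x. jacobian H (at x))"
    using higher_differentiable_on_lipschitz \<rho> by blast
  obtain K where K: "0 \<le> K" "\<And>x. norm (x - xs) \<le> \<rho> / 2 \<Longrightarrow>
      norm (H x - H xs - frechet_derivative H (at xs) (x - xs)) \<le> K * (norm (x - xs))\<^sup>2"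
    using higher_differentiable_on_taylor[OF H_smooth \<rho>] by blast
  have B: "linear (frechet_derivative H (at xs))"
    by (rule has_derivative_linear[OF higher_differentiable_on_has_derivative[OF H_smooth]]) (use \<rho> in auto)
  show ?thesis
  proof (intro conjI allI impI)
    show "\<exists>\<epsilon>>0. higher_differentiable_on (ball xs \<epsilon>) H 2 \<and>
        (\<exists>L. L-lipschitz_on (ball xs \<epsilon>) H) \<and> (\<exists>L. L-lipschitz_on (ball xs \<epsilon>) (\<lambda>x. jacobian H (at x)))"
      using \<rho> higher_differentiable_on_subset[OF H_smooth sub(2)]
        lipschitz_on_subset[OF L1 sub(1)] lipschitz_on_subset[OF L2 sub(1)]
      by (intro exI[of _ "\<rho> / 2"]) auto
  next
    fix r \<gamma> M\<alpha> :: real and m :: nat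
    assume r: "r > 0" and \<gamma>: "0 < \<gamma>" "\<gamma> < 1"
      and contr: "\<forall>x\<in>cball xs r. \<forall>y\<in>cball xs r. norm (H x - H y) \<le> \<gamma> * norm (x - y)"
    show "\<exists>\<gamma>'\<in>{\<gamma><..<1}. \<exists>\<delta>>0. \<forall>x \<alpha>. anderson_iterates H m x \<alpha> \<longrightarrow>
      (\<forall>k. (\<Sum>i\<le>min m k. \<bar>\<alpha> k i\<bar>) \<le> M\<alpha>) \<longrightarrow> norm (x 0 - xs) < \<delta> \<longrightarrow>
      x \<longlonglongrightarrow> xs \<and>
      (\<forall>k. norm (H (x k) - x k) \<le> \<gamma>' ^ k * norm (H (x 0) - x 0) \<and>
           norm (x k - xs) \<le> (1 + \<gamma>) / (1 - \<gamma>) * \<gamma>' ^ k * norm (x 0 - xs))"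
    \<comment> \<open>The radius is the smaller of the one on which contraction is assumed and the
      one on which the Taylor estimate holds.\<close>
    proof (rule anderson_convergence[where H=H and xs=xs and R="min r (\<rho> / 2)", OF H_fixed B \<gamma> _ _ _ K(1)])
      show "0 < min r (\<rho> / 2)" using r \<rho> by simp
      show "norm (H x - H y) \<le> \<gamma> * norm (x - y)"
        if "norm (x - xs) \<le> min r (\<rho> / 2)" "norm (y - xs) \<le> min r (\<rho> / 2)" for x y
        using contr that by (simp add: dist_norm norm_minus_commute)
      show "norm (H x - xs - frechet_derivative H (at xs) (x - xs)) \<le> K * (norm (x - xs))\<^sup>2"
        if "norm (x - xs) \<le> min r (\<rho> / 2)" for x
        using K(2)[of x] that by (simp add: H_fixed)
    qed
  qed
qed

end
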